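(* Let $D\Gamma(N)$ be an $h$-normal $N$-linear connection on $E^*=J^{1*}(\mathcal T,M)$. Its curvature tensor $\mathbb R$ is characterized by the seven adapted local d-tensors $\chi_{abc}^d$, $R_{ibc}^l$, $R_{ibk}^l$, $P_{ib(c)}^{l\ (k)}$, $R_{ijk}^l$, $P_{ij(c)}^{l\ (k)}$, $S_{i(b)(c)}^{l(j)(k)}$ given below. Namely: (1) On $\delta/\delta t^a$: $\mathbb R(\frac{\delta}{\delta t^c},\frac{\delta}{\delta t^b})\frac{\delta}{\delta t^a}=\chi_{abc}^d\frac{\delta}{\delta t^d}$, while $\mathbb R(Y,Z)\frac{\delta}{\delta t^a}=0$ for $(Y,Z)$ equal to $(\frac{\delta}{\delta x^k},\frac{\delta}{\delta t^b})$, $(\frac{\partial}{\partial p_k^c},\frac{\delta}{\delta t^b})$, $(\frac{\delta}{\delta x^k},\frac{\delta}{\delta x^j})$, $(\frac{\partial}{\partial p_k^c},\frac{\delta}{\delta x^j})$, $(\frac{\partial}{\partial p_k^c},\frac{\partial}{\partial p_j^b})$. (2) On $\delta/\delta x^i$: $\mathbb R(Y,Z)\frac{\delta}{\delta x^i}=K_i^l\frac{\delta}{\delta x^l}$, where $K_i^l$ equals respectively $R_{ibc}^l$ for $(Y,Z)=(\frac{\delta}{\delta t^c},\frac{\delta}{\delta t^b})$; $R_{ibk}^l$ for $(\frac{\delta}{\delta x^k},\frac{\delta}{\delta t^b})$; $P_{ib(c)}^{l\ (k)}$ for $(\frac{\partial}{\partial p_k^c},\frac{\delta}{\delta t^b})$;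 $R_{ijk}^l$ for $(\frac{\delta}{\delta x^k},\frac{\delta}{\delta x^j})$; $P_{ij(c)}^{l\ (k)}$ for $(\frac{\partial}{\partial p_k^c},\frac{\delta}{\delta x^j})$; $S_{i(b)(c)}^{l(j)(k)}$ for $(\frac{\partial}{\partial p_k^c},\frac{\partial}{\partial p_j^b})$. (3) On $\partial/\partial p_i^a$: $\mathbb R(Y,Z)\frac{\partial}{\partial p_i^a}=V_{(l)(a)}^{(d)(i)}\frac{\partial}{\partial p_l^d}$, where, for the same six pairs in the same order, $V_{(l)(a)}^{(d)(i)}$ equals $-R_{(l)(a)bc}^{(d)(i)}=\delta_l^i\chi_{abc}^d-\delta_a^dR_{lbc}^i$; $-R_{(l)(a)bk}^{(d)(i)}=-\delta_a^dR_{lbk}^i$; $-P_{(l)(a)b(c)}^{(d)(i)\ (k)}=-\delta_a^dP_{lb(c)}^{i\ (k)}$; $-R_{(l)(a)jk}^{(d)(i)}=-\delta_a^dR_{ljk}^i$; $-P_{(l)(a)j(c)}^{(d)(i)\ (k)}=-\delta_a^dP_{lj(c)}^{i\ (k)}$; $-S_{(l)(a)(b)(c)}^{(d)(i)(j)(k)}=-\delta_a^dS_{l(b)(c)}^{i(j)(k)}$. Here $$\chi_{abc}^d=\frac{\delta\chi_{ab}^d}{\delta t^c}-\frac{\delta\chi_{ac}^d}{\delta t^b}+\chi_{ab}^f\chi_{fc}^d-\chi_{ac}^f\chi_{fb}^d,$$ $$R_{ibc}^l=\frac{\delta A_{ib}^l}{\delta t^c}-\frac{\delta A_{ic}^l}{\delta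 t^b}+A_{ib}^rA_{rc}^l-A_{ic}^rA_{rb}^l+C_{i(f)}^{l(r)}R_{(r)bc}^{(f)},$$ $$R_{ibk}^l=\frac{\delta A_{ib}^l}{\delta x^k}-\frac{\delta H_{ik}^l}{\delta t^b}+A_{ib}^rH_{rk}^l-H_{ik}^rA_{rb}^l+C_{i(f)}^{l(r)}R_{(r)bk}^{(f)},$$ $$P_{ib(c)}^{l\ (k)}=\frac{\partial A_{ib}^l}{\partial p_k^c}-C_{i(c)/b}^{l(k)}+C_{i(f)}^{l(r)}P_{(r)b(c)}^{(f)\ (k)},$$ $$R_{ijk}^l=\frac{\delta H_{ij}^l}{\delta x^k}-\frac{\delta H_{ik}^l}{\delta x^j}+H_{ij}^rH_{rk}^l-H_{ik}^rH_{rj}^l+C_{i(f)}^{l(r)}R_{(r)jk}^{(f)},$$ $$P_{ij(c)}^{l\ (k)}=\frac{\partial H_{ij}^l}{\partial p_k^c}-C_{i(c)|j}^{l(k)}+C_{i(f)}^{l(r)}P_{(r)j(c)}^{(f)\ (k)},$$ $$S_{i(b)(c)}^{l(j)(k)}=\frac{\partial C_{i(b)}^{l(j)}}{\partial p_k^c}-\frac{\partial C_{i(c)}^{l(k)}}{\partial p_j^b}+C_{i(b)}^{r(j)}C_{r(c)}^{l(k)}-C_{i(c)}^{r(k)}C_{r(b)}^{l(j)}.$$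
   Context: Setting. $\mathcal{T}$ and $M$ are smooth real manifolds of dimensions $m$ and $n$ with local coordinates $(t^a)$, $(x^i)$; indices $a,b,c,d,e,f,g$ run over $1,\dots,m$ and $i,j,k,l,p,r,s$ over $1,\dots,n$; the Einstein summation convention is used. $E^{*}=J^{1*}(\mathcal{T},M)$ is the dual 1-jet bundle with induced coordinates $(t^a,x^i,p_i^a)$, transforming by $\tilde t^a=\tilde t^a(t^b)$, $\tilde x^i=\tilde x^i(x^j)$, $\tilde p_i^a=\frac{\partial x^j}{\partial\tilde x^i}\frac{\partial\tilde t^a}{\partial t^b}p_j^b$. Nonlinear connection. $N=(\underset{1}{N}{}_{(i)b}^{(a)},\underset{2}{N}{}_{(i)j}^{(a)})$ is a fixed nonlinear connection on $E^*$, i.e. a collection of local functions with transformation rules $\underset{1}{\tilde N}{}_{(j)c}^{(b)}\frac{\partial\tilde t^c}{\partial t^a}=\underset{1}{N}{}_{(k)a}^{(c)}\frac{\partial\tilde t^b}{\partial t^c}\frac{\partial x^k}{\partial\tilde x^j}-\frac{\partial\tilde p_j^b}{\partial t^a}$ and $\underset{2}{\tilde N}{}_{(j)k}^{(b)}\frac{\partial\tilde x^k}{\partial x^i}=\underset{2}{N}{}_{(k)i}^{(c)}\frac{\partial\tilde t^b}{\partial t^c}\frac{\partial x^k}{\partial\tilde x^j}-\frac{\partial\tilde p_j^b}{\partial x^i}$. The adapted basis is $\frac{\delta}{\delta t^a}=\frac{\partial}{\partial t^a}-\underset{1}{N}{}_{(j)a}^{(b)}\frac{\partial}{\partial p_j^b}$,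 $\frac{\delta}{\delta x^i}=\frac{\partial}{\partial x^i}-\underset{2}{N}{}_{(j)i}^{(b)}\frac{\partial}{\partial p_j^b}$, $\frac{\partial}{\partial p_i^a}$, with dual basis $dt^a$, $dx^i$, $\delta p_i^a=dp_i^a+\underset{1}{N}{}_{(i)b}^{(a)}dt^b+\underset{2}{N}{}_{(i)j}^{(a)}dx^j$. Let $h_{\mathcal T},h_M,v$ be the projections of vector fields onto the spans of $\{\delta/\delta t^a\}$, $\{\delta/\delta x^i\}$, $\{\partial/\partial p_i^a\}$. $N$-linear connection. A linear connection $D$ on $E^*$ with $Dh_{\mathcal T}=0$, $Dh_M=0$, $Dv=0$. Its nine adapted components are defined by $D_{\delta/\delta t^c}\frac{\delta}{\delta t^b}=A_{bc}^a\frac{\delta}{\delta t^a}$, $D_{\delta/\delta t^c}\frac{\delta}{\delta x^j}=A_{jc}^i\frac{\delta}{\delta x^i}$, $D_{\delta/\delta t^c}\frac{\partial}{\partial p_j^b}=-A_{(i)(b)c}^{(a)(j)}\frac{\partial}{\partial p_i^a}$; $D_{\delta/\delta x^k}\frac{\delta}{\delta t^b}=H_{bk}^a\frac{\delta}{\delta t^a}$, $D_{\delta/\delta x^k}\frac{\delta}{\delta x^j}=H_{jk}^i\frac{\delta}{\delta x^i}$, $D_{\delta/\delta x^k}\frac{\partial}{\partial p_j^b}=-H_{(i)(b)k}^{(a)(j)}\frac{\partial}{\partial p_i^a}$; $D_{\partial/\partial p_k^c}\frac{\delta}{\delta t^b}=C_{b(c)}^{a(k)}\frac{\delta}{\delta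 t^a}$, $D_{\partial/\partial p_k^c}\frac{\delta}{\delta x^j}=C_{j(c)}^{i(k)}\frac{\delta}{\delta x^i}$, $D_{\partial/\partial p_k^c}\frac{\partial}{\partial p_j^b}=-C_{(i)(b)(c)}^{(a)(j)(k)}\frac{\partial}{\partial p_i^a}$. $h$-normal. Fix a semi-Riemannian metric $h_{ab}(t)$ on $\mathcal T$ with Christoffel symbols $\chi_{bc}^a(t)$, and let $\mathbb J=h_{ab}\delta_j^i\,\delta p_i^a\otimes dt^b\otimes dx^j$. An $N$-linear connection is $h$-normal if $A_{bc}^a=\chi_{bc}^a$, $H_{bi}^a=0$, $C_{b(c)}^{a(i)}=0$ and $D\mathbb J=0$. For such a connection $A_{(i)(b)c}^{(a)(j)}=\delta_b^aA_{ic}^j-\delta_i^j\chi_{bc}^a$, $H_{(i)(b)k}^{(a)(j)}=\delta_b^aH_{ik}^j$, $C_{(i)(b)(c)}^{(a)(j)(k)}=\delta_b^aC_{i(c)}^{j(k)}$, so it is determined by $(\chi_{bc}^a,A_{jc}^i,H_{jk}^i,C_{j(c)}^{i(k)})$. Curvature: $\mathbb R(X,Y)Z=D_XD_YZ-D_YD_XZ-D_{[X,Y]}Z$. Torsion d-tensors used: $R_{(r)bc}^{(f)}=\frac{\delta \underset{1}{N}{}_{(r)b}^{(f)}}{\delta t^c}-\frac{\delta \underset{1}{N}{}_{(r)c}^{(f)}}{\delta t^b}$, $R_{(r)bk}^{(f)}=\frac{\delta \underset{1}{N}{}_{(r)b}^{(f)}}{\delta x^k}-\frac{\delta \underset{2}{N}{}_{(r)k}^{(f)}}{\delta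 t^b}$, $R_{(r)jk}^{(f)}=\frac{\delta \underset{2}{N}{}_{(r)j}^{(f)}}{\delta x^k}-\frac{\delta \underset{2}{N}{}_{(r)k}^{(f)}}{\delta x^j}$, $P_{(r)b(c)}^{(f)\ (k)}=\frac{\partial \underset{1}{N}{}_{(r)b}^{(f)}}{\partial p_k^c}+\delta_c^fA_{rb}^k-\delta_r^k\chi_{cb}^f$, $P_{(r)j(c)}^{(f)\ (k)}=\frac{\partial \underset{2}{N}{}_{(r)j}^{(f)}}{\partial p_k^c}+\delta_c^fH_{rj}^k$. Covariant derivatives used: $C_{i(c)/b}^{l(k)}=\frac{\delta C_{i(c)}^{l(k)}}{\delta t^b}+C_{i(c)}^{r(k)}A_{rb}^l-C_{r(c)}^{l(k)}A_{ib}^r+C_{i(f)}^{l(r)}A_{(r)(c)b}^{(f)(k)}$ and $C_{i(c)|j}^{l(k)}=\frac{\delta C_{i(c)}^{l(k)}}{\delta x^j}+C_{i(c)}^{r(k)}H_{rj}^l-C_{r(c)}^{l(k)}H_{ij}^r+C_{i(f)}^{l(r)}H_{(r)(c)j}^{(f)(k)}$. *)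

theory Defs
  imports "HOL-Analysis.Analysis"
begin

section \<open>Smooth maps and smooth manifolds\<close>

text \<open>Both notions are used on open sets \<open>S\<close> only, where \<open>at x within S = at x\<close>.\<close>

fun Ck_on :: "nat \<Rightarrow> 'a::euclidean_space set \<Rightarrow> ('a \<Rightarrow> 'b::real_normed_vector) \<Rightarrow> bool" where
  "Ck_on 0 S f \<longleftrightarrow> continuous_on S f"
| "Ck_on (Suc k) S f \<longleftrightarrow>
     f differentiable_on S \<and> (\<forall>v. Ck_on k S (\<lambda>x. frechet_derivative f (at x) v))"

definition smooth_on :: "'a::euclidean_space set \<Rightarrow> ('a \<Rightarrow> 'b::real_normed_vector) \<Rightarrow> bool" where
  "smooth_on S f \<longleftrightarrow> (\<forall>k. Ck_on k S f)"

text \<open>A chart is its domain together with the coordinate map; the values of the map outside the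
  domain are irrelevant.\<close>

type_synonym ('p, 'd) chart = "'p set \<times> ('p \<Rightarrow> real ^ 'd)"

definition chart_inv :: "('p, 'd::finite) chart \<Rightarrow> real ^ 'd \<Rightarrow> 'p" where
  "chart_inv \<alpha> = inv_into (fst \<alpha>) (snd \<alpha>)"

text \<open>The manifold is the whole type \<open>'p\<close>, which in the theorem is Hausdorff and second countable;
  its dimension is \<open>CARD('d)\<close>.\<close>

definition smooth_atlas :: "('p::topological_space, 'd::finite) chart set \<Rightarrow> bool" where
  "smooth_atlas A \<longleftrightarrow>
     (\<forall>\<alpha>\<in>A. open (fst \<alpha>) \<and> open (snd \<alpha> ` fst \<alpha>) \<and>
        (\<exists>\<psi>. homeomorphism (fst \<alpha>) (snd \<alpha> ` fst \<alpha>) (snd \<alpha>) \<psi>)) \<and>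
     (\<Union>\<alpha>\<in>A. fst \<alpha>) = UNIV \<and>
     (\<forall>\<alpha>\<in>A. \<forall>\<beta>\<in>A. smooth_on (snd \<alpha> ` (fst \<alpha> \<inter> fst \<beta>)) (snd \<beta> \<circ> chart_inv \<alpha>))"

text \<open>\<open>jac \<alpha> \<beta> q $ i $ j\<close> is the derivative at \<open>q\<close> of the \<open>i\<close>-th \<open>\<beta>\<close>-coordinate in the direction of
  the \<open>j\<close>-th \<open>\<alpha>\<close>-coordinate.\<close>

definition jac :: "('p, 'd::finite) chart \<Rightarrow> ('p, 'd) chart \<Rightarrow> 'p \<Rightarrow> real ^ 'd ^ 'd" where
  "jac \<alpha> \<beta> q = matrix (frechet_derivative (snd \<beta> \<circ> chart_inv \<alpha>) (at (snd \<alpha> q)))"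


section \<open>The dual 1-jet bundle\<close>

text \<open>An induced chart of the bundle is given by a chart of the first and a chart of the second base
  manifold. A point over \<open>(t, x)\<close> is represented by the family of its fibre coordinates \<open>p $ i $ a\<close>
  (that is, \<open>p_i^a\<close>) in all induced charts around \<open>(t, x)\<close>; this family must obey the transformation
  rule of the bundle and is \<open>0\<close> at the other (irrelevant) arguments.

  A vector field is represented by its action on functions.\<close>

type_synonym ('t, 'm, 'x, 'n) jchart = "('t, 'm) chart \<times> ('x, 'n) chart"

type_synonym ('t, 'm, 'x, 'n) jpoint =
  "'t \<times> 'x \<times> (('t, 'm, 'x, 'n) jchart \<Rightarrow> real ^ 'm ^ 'n)"

type_synonym 'e vfield = "('e \<Rightarrow> real) \<Rightarrow> 'e \<Rightarrow> real"

text \<open>Order of index arguments here and below: first all upper indices from left to right, then all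
  lower indices from left to right, whether or not they are in parentheses. So \<open>N1 G K a i b\<close> is
  the component with upper index \<open>(a)\<close> and lower indices \<open>(i) b\<close> in the induced chart \<open>K\<close>.\<close>

record ('t, 'm, 'x, 'n) jet_data =
  T_atlas :: "('t, 'm::finite) chart set"
  M_atlas :: "('x, 'n::finite) chart set"
  N1 :: "('t, 'm, 'x, 'n) jchart \<Rightarrow> 'm \<Rightarrow> 'n \<Rightarrow> 'm \<Rightarrow> ('t, 'm, 'x, 'n) jpoint \<Rightarrow> real"
  N2 :: "('t, 'm, 'x, 'n) jchart \<Rightarrow> 'm \<Rightarrow> 'n \<Rightarrow> 'n \<Rightarrow> ('t, 'm, 'x, 'n) jpoint \<Rightarrow> real"
  metric :: "('t, 'm) chart \<Rightarrow> 't \<Rightarrow> real ^ 'm ^ 'm"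
  conn :: "('t, 'm, 'x, 'n) jpoint vfield \<Rightarrow> ('t, 'm, 'x, 'n) jpoint vfield \<Rightarrow>
           ('t, 'm, 'x, 'n) jpoint vfield"

definition jcharts :: "('t, 'm::finite, 'x, 'n::finite) jet_data \<Rightarrow> ('t, 'm, 'x, 'n) jchart set" where
  "jcharts G = T_atlas G \<times> M_atlas G"

definition jet_space :: "('t, 'm::finite, 'x, 'n::finite) jet_data \<Rightarrow> ('t, 'm, 'x, 'n) jpoint set" where
  "jet_space G = {(t, x, p).
     (\<forall>\<alpha> \<beta>. \<not> ((\<alpha>, \<beta>) \<in> jcharts G \<and> t \<in> fst \<alpha> \<and> x \<in> fst \<beta>) \<longrightarrow> p (\<alpha>, \<beta>) = 0) \<and>
     (\<forall>(\<alpha>, \<beta>)\<in>jcharts G. \<forall>(\<alpha>', \<beta>')\<in>jcharts G.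
        t \<in> fst \<alpha> \<inter> fst \<alpha>' \<and> x \<in> fst \<beta> \<inter> fst \<beta>' \<longrightarrow>
        (\<forall>i a. p (\<alpha>', \<beta>') $ i $ a =
           (\<Sum>j\<in>UNIV. \<Sum>b\<in>UNIV. jac \<beta>' \<beta> x $ j $ i * jac \<alpha> \<alpha>' t $ a $ b * p (\<alpha>, \<beta>) $ j $ b)))}"

definition jdom :: "('t, 'm::finite, 'x, 'n::finite) jet_data \<Rightarrow> ('t, 'm, 'x, 'n) jchart \<Rightarrow>
    ('t, 'm, 'x, 'n) jpoint set" where
  "jdom G K = {e \<in> jet_space G. fst e \<in> fst (fst K) \<and> fst (snd e) \<in> fst (snd K)}"

definition coords :: "('t, 'm::finite, 'x, 'n::finite) jchart \<Rightarrow> ('t, 'm, 'x, 'n) jpoint \<Rightarrow>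
    (real ^ 'm) \<times> (real ^ 'n) \<times> (real ^ 'm ^ 'n)" where
  "coords K e = (snd (fst K) (fst e), snd (snd K) (fst (snd e)), snd (snd e) K)"

definition coords_inv :: "('t, 'm::finite, 'x, 'n::finite) jet_data \<Rightarrow> ('t, 'm, 'x, 'n) jchart \<Rightarrow>
    (real ^ 'm) \<times> (real ^ 'n) \<times> (real ^ 'm ^ 'n) \<Rightarrow> ('t, 'm, 'x, 'n) jpoint" where
  "coords_inv G K = inv_into (jdom G K) (coords K)"

definition t_coord :: "('t, 'm::finite, 'x, 'n::finite) jchart \<Rightarrow> 'm \<Rightarrow> ('t, 'm, 'x, 'n) jpoint \<Rightarrow> real" where
  "t_coord K a e = fst (coords K e) $ a"

definition x_coord :: "('t, 'm::finite, 'x, 'n::finite) jchart \<Rightarrow> 'n \<Rightarrow> ('t, 'm, 'x, 'n) jpoint \<Rightarrow> real" where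
  "x_coord K i e = fst (snd (coords K e)) $ i"

definition p_coord :: "('t, 'm::finite, 'x, 'n::finite) jchart \<Rightarrow> 'm \<Rightarrow> 'n \<Rightarrow> ('t, 'm, 'x, 'n) jpoint \<Rightarrow> real" where
  "p_coord K a i e = snd (snd (coords K e)) $ i $ a"

definition jet_open :: "('t, 'm::finite, 'x, 'n::finite) jet_data \<Rightarrow> ('t, 'm, 'x, 'n) jpoint set \<Rightarrow> bool" where
  "jet_open G W \<longleftrightarrow> W \<subseteq> jet_space G \<and> (\<forall>K\<in>jcharts G. open (coords K ` (W \<inter> jdom G K)))"

definition smooth_funs :: "('t, 'm::finite, 'x, 'n::finite) jet_data \<Rightarrow> ('t, 'm, 'x, 'n) jpoint set \<Rightarrow>
    (('t, 'm, 'x, 'n) jpoint \<Rightarrow> real) set" where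
  "smooth_funs G W =
     {f. \<forall>K\<in>jcharts G. smooth_on (coords K ` (W \<inter> jdom G K)) (f \<circ> coords_inv G K)}"


section \<open>Vector fields on open subsets of the bundle\<close>

text \<open>A vector field on an open set \<open>W\<close> is a derivation of the sheaf of smooth functions on \<open>W\<close>.
  Its values on functions that are not smooth, or at points outside \<open>W\<close>, are junk, so vector fields
  are compared with \<open>vf_eq\<close> rather than with equality.\<close>

definition vector_fields :: "('t, 'm::finite, 'x, 'n::finite) jet_data \<Rightarrow> ('t, 'm, 'x, 'n) jpoint set \<Rightarrow>
    ('t, 'm, 'x, 'n) jpoint vfield set" where
  "vector_fields G W = {X. \<forall>V. jet_open G V \<and> V \<subseteq> W \<longrightarrow>
     (\<forall>f\<in>smooth_funs G V. X f \<in> smooth_funs G V) \<and>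
     (\<forall>f\<in>smooth_funs G V. \<forall>g\<in>smooth_funs G V. (\<forall>e\<in>V. f e = g e) \<longrightarrow> (\<forall>e\<in>V. X f e = X g e)) \<and>
     (\<forall>f\<in>smooth_funs G V. \<forall>g\<in>smooth_funs G V. \<forall>e\<in>V. X (\<lambda>y. f y + g y) e = X f e + X g e) \<and>
     (\<forall>r. \<forall>f\<in>smooth_funs G V. \<forall>e\<in>V. X (\<lambda>y. r * f y) e = r * X f e) \<and>
     (\<forall>f\<in>smooth_funs G V. \<forall>g\<in>smooth_funs G V. \<forall>e\<in>V.
        X (\<lambda>y. f y * g y) e = X f e * g e + f e * X g e)}"

definition vf_eq :: "('t, 'm::finite, 'x, 'n::finite) jet_data \<Rightarrow> ('t, 'm, 'x, 'n) jpoint set \<Rightarrow>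
    ('t, 'm, 'x, 'n) jpoint vfield \<Rightarrow> ('t, 'm, 'x, 'n) jpoint vfield \<Rightarrow> bool" where
  "vf_eq G W X Y \<longleftrightarrow>
     (\<forall>V. jet_open G V \<and> V \<subseteq> W \<longrightarrow> (\<forall>f\<in>smooth_funs G V. \<forall>e\<in>V. X f e = Y f e))"

definition vf_zero :: "'e vfield" where
  "vf_zero = (\<lambda>f e. 0)"

definition vf_add :: "'e vfield \<Rightarrow> 'e vfield \<Rightarrow> 'e vfield" where
  "vf_add X Y = (\<lambda>f e. X f e + Y f e)"

definition vf_diff :: "'e vfield \<Rightarrow> 'e vfield \<Rightarrow> 'e vfield" where
  "vf_diff X Y = (\<lambda>f e. X f e - Y f e)"

definition vf_scale :: "('e \<Rightarrow> real) \<Rightarrow> 'e vfield \<Rightarrow> 'e vfield" where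
  "vf_scale g X = (\<lambda>f e. g e * X f e)"

definition vf_comb :: "('i::finite \<Rightarrow> 'e \<Rightarrow> real) \<Rightarrow> ('i \<Rightarrow> 'e vfield) \<Rightarrow> 'e vfield" where
  "vf_comb g X = (\<lambda>f e. \<Sum>s\<in>UNIV. g s e * X s f e)"

definition lie_bracket :: "'e vfield \<Rightarrow> 'e vfield \<Rightarrow> 'e vfield" where
  "lie_bracket X Y = (\<lambda>f e. X (Y f) e - Y (X f) e)"

definition partial :: "('t, 'm::finite, 'x, 'n::finite) jet_data \<Rightarrow> ('t, 'm, 'x, 'n) jchart \<Rightarrow>
    (real ^ 'm) \<times> (real ^ 'n) \<times> (real ^ 'm ^ 'n) \<Rightarrow> ('t, 'm, 'x, 'n) jpoint vfield" where
  "partial G K v f e = frechet_derivative (f \<circ> coords_inv G K) (at (coords K e)) v"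

definition part_t :: "('t, 'm::finite, 'x, 'n::finite) jet_data \<Rightarrow> ('t, 'm, 'x, 'n) jchart \<Rightarrow> 'm \<Rightarrow>
    ('t, 'm, 'x, 'n) jpoint vfield" where
  "part_t G K a = partial G K (axis a 1, 0, 0)"

definition part_x :: "('t, 'm::finite, 'x, 'n::finite) jet_data \<Rightarrow> ('t, 'm, 'x, 'n) jchart \<Rightarrow> 'n \<Rightarrow>
    ('t, 'm, 'x, 'n) jpoint vfield" where
  "part_x G K i = partial G K (0, axis i 1, 0)"

text \<open>\<open>part_p G K i a\<close> is the partial derivative with respect to \<open>p_i^a\<close>; as an index of a vector
  field, \<open>i\<close> is an upper and \<open>a\<close> a lower index.\<close>

definition part_p :: "('t, 'm::finite, 'x, 'n::finite) jet_data \<Rightarrow> ('t, 'm, 'x, 'n) jchart \<Rightarrow> 'n \<Rightarrow> 'm \<Rightarrow>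
    ('t, 'm, 'x, 'n) jpoint vfield" where
  "part_p G K i a = partial G K (0, 0, axis i (axis a 1))"


section \<open>Nonlinear connections and the adapted basis\<close>

definition nonlinear_connection :: "('t, 'm::finite, 'x, 'n::finite) jet_data \<Rightarrow> bool" where
  "nonlinear_connection G \<longleftrightarrow>
     (\<forall>K\<in>jcharts G. (\<forall>a i b. N1 G K a i b \<in> smooth_funs G (jdom G K)) \<and>
                     (\<forall>a i j. N2 G K a i j \<in> smooth_funs G (jdom G K))) \<and>
     (\<forall>(\<alpha>, \<beta>)\<in>jcharts G. \<forall>(\<alpha>', \<beta>')\<in>jcharts G. \<forall>e\<in>jdom G (\<alpha>, \<beta>) \<inter> jdom G (\<alpha>', \<beta>').
        (\<forall>b j a.
           (\<Sum>c\<in>UNIV. N1 G (\<alpha>', \<beta>') b j c e * jac \<alpha> \<alpha>' (fst e) $ c $ a) =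
           (\<Sum>c\<in>UNIV. \<Sum>k\<in>UNIV. N1 G (\<alpha>, \<beta>) c k a e * jac \<alpha> \<alpha>' (fst e) $ b $ c
                                * jac \<beta>' \<beta> (fst (snd e)) $ k $ j)
           - part_t G (\<alpha>, \<beta>) a (p_coord (\<alpha>', \<beta>') b j) e) \<and>
        (\<forall>b j i.
           (\<Sum>k\<in>UNIV. N2 G (\<alpha>', \<beta>') b j k e * jac \<beta> \<beta>' (fst (snd e)) $ k $ i) =
           (\<Sum>c\<in>UNIV. \<Sum>k\<in>UNIV. N2 G (\<alpha>, \<beta>) c k i e * jac \<alpha> \<alpha>' (fst e) $ b $ c
                                * jac \<beta>' \<beta> (fst (snd e)) $ k $ j)
           - part_x G (\<alpha>, \<beta>) i (p_coord (\<alpha>', \<beta>') b j) e))"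

definition del_t :: "('t, 'm::finite, 'x, 'n::finite) jet_data \<Rightarrow> ('t, 'm, 'x, 'n) jchart \<Rightarrow> 'm \<Rightarrow>
    ('t, 'm, 'x, 'n) jpoint vfield" where
  "del_t G K a f e =
     part_t G K a f e - (\<Sum>j\<in>UNIV. \<Sum>b\<in>UNIV. N1 G K b j a e * part_p G K j b f e)"

definition del_x :: "('t, 'm::finite, 'x, 'n::finite) jet_data \<Rightarrow> ('t, 'm, 'x, 'n) jchart \<Rightarrow> 'n \<Rightarrow>
    ('t, 'm, 'x, 'n) jpoint vfield" where
  "del_x G K i f e =
     part_x G K i f e - (\<Sum>j\<in>UNIV. \<Sum>b\<in>UNIV. N2 G K b j i e * part_p G K j b f e)"

text \<open>The dual basis, as functions of a vector field.\<close>

definition d_t :: "('t, 'm::finite, 'x, 'n::finite) jchart \<Rightarrow> 'm \<Rightarrow>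
    ('t, 'm, 'x, 'n) jpoint vfield \<Rightarrow> ('t, 'm, 'x, 'n) jpoint \<Rightarrow> real" where
  "d_t K a X = X (t_coord K a)"

definition d_x :: "('t, 'm::finite, 'x, 'n::finite) jchart \<Rightarrow> 'n \<Rightarrow>
    ('t, 'm, 'x, 'n) jpoint vfield \<Rightarrow> ('t, 'm, 'x, 'n) jpoint \<Rightarrow> real" where
  "d_x K i X = X (x_coord K i)"

definition del_p :: "('t, 'm::finite, 'x, 'n::finite) jet_data \<Rightarrow> ('t, 'm, 'x, 'n) jchart \<Rightarrow> 'm \<Rightarrow> 'n \<Rightarrow>
    ('t, 'm, 'x, 'n) jpoint vfield \<Rightarrow> ('t, 'm, 'x, 'n) jpoint \<Rightarrow> real" where
  "del_p G K a i X e = X (p_coord K a i) e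
     + (\<Sum>b\<in>UNIV. N1 G K a i b e * d_t K b X e) + (\<Sum>j\<in>UNIV. N2 G K a i j e * d_x K j X e)"

definition proj_T :: "('t, 'm::finite, 'x, 'n::finite) jet_data \<Rightarrow> ('t, 'm, 'x, 'n) jchart \<Rightarrow>
    ('t, 'm, 'x, 'n) jpoint vfield \<Rightarrow> ('t, 'm, 'x, 'n) jpoint vfield" where
  "proj_T G K X = vf_comb (\<lambda>a. d_t K a X) (del_t G K)"

definition proj_M :: "('t, 'm::finite, 'x, 'n::finite) jet_data \<Rightarrow> ('t, 'm, 'x, 'n) jchart \<Rightarrow>
    ('t, 'm, 'x, 'n) jpoint vfield \<Rightarrow> ('t, 'm, 'x, 'n) jpoint vfield" where
  "proj_M G K X = vf_comb (\<lambda>i. d_x K i X) (del_x G K)"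

definition proj_V :: "('t, 'm::finite, 'x, 'n::finite) jet_data \<Rightarrow> ('t, 'm, 'x, 'n) jchart \<Rightarrow>
    ('t, 'm, 'x, 'n) jpoint vfield \<Rightarrow> ('t, 'm, 'x, 'n) jpoint vfield" where
  "proj_V G K X = vf_comb (\<lambda>(i, a). del_p G K a i X) (\<lambda>(i, a). part_p G K i a)"


section \<open>Linear connections, N-linear connections and their adapted components\<close>

text \<open>The covariant derivative acts on vector fields on every open set \<open>W\<close> and is compatible with
  restriction: on \<open>W\<close> it depends only on the restrictions of its arguments to \<open>W\<close>.\<close>

definition linear_connection :: "('t, 'm::finite, 'x, 'n::finite) jet_data \<Rightarrow> bool" where
  "linear_connection G \<longleftrightarrow> (\<forall>W. jet_open G W \<longrightarrow>
     (\<forall>X\<in>vector_fields G W. \<forall>Y\<in>vector_fields G W. conn G X Y \<in> vector_fields G W) \<and>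
     (\<forall>X\<in>vector_fields G W. \<forall>X'\<in>vector_fields G W. \<forall>Y\<in>vector_fields G W. \<forall>Y'\<in>vector_fields G W.
        vf_eq G W X X' \<and> vf_eq G W Y Y' \<longrightarrow> vf_eq G W (conn G X Y) (conn G X' Y')) \<and>
     (\<forall>X\<in>vector_fields G W. \<forall>Y\<in>vector_fields G W. \<forall>Z\<in>vector_fields G W.
        vf_eq G W (conn G (vf_add X Y) Z) (vf_add (conn G X Z) (conn G Y Z)) \<and>
        vf_eq G W (conn G X (vf_add Y Z)) (vf_add (conn G X Y) (conn G X Z))) \<and>
     (\<forall>X\<in>vector_fields G W. \<forall>Y\<in>vector_fields G W. \<forall>f\<in>smooth_funs G W.
        vf_eq G W (conn G (vf_scale f X) Y) (vf_scale f (conn G X Y)) \<and>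
        vf_eq G W (conn G X (vf_scale f Y))
                  (vf_add (vf_scale (X f) Y) (vf_scale f (conn G X Y)))))"

definition N_linear_connection :: "('t, 'm::finite, 'x, 'n::finite) jet_data \<Rightarrow> bool" where
  "N_linear_connection G \<longleftrightarrow> linear_connection G \<and>
     (\<forall>K\<in>jcharts G. \<forall>W. jet_open G W \<and> W \<subseteq> jdom G K \<longrightarrow>
        (\<forall>X\<in>vector_fields G W. \<forall>Y\<in>vector_fields G W.
           vf_eq G W (conn G X (proj_T G K Y)) (proj_T G K (conn G X Y)) \<and>
           vf_eq G W (conn G X (proj_M G K Y)) (proj_M G K (conn G X Y)) \<and>
           vf_eq G W (conn G X (proj_V G K Y)) (proj_V G K (conn G X Y))))"

text \<open>The nine adapted components are the coefficients of the covariant derivatives of the adapted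
  basis with respect to the adapted basis, read off with the dual basis. The letters \<open>A\<close>, \<open>H\<close>, \<open>C\<close>
  refer to the direction of differentiation, the suffixes \<open>T\<close>, \<open>M\<close>, \<open>V\<close> to the differentiated basis
  vector; in case \<open>V\<close> there is a minus sign by convention.\<close>

definition A_T where
  "A_T G K a b c = d_t K a (conn G (del_t G K c) (del_t G K b))"
definition A_M where
  "A_M G K i j c = d_x K i (conn G (del_t G K c) (del_x G K j))"
definition A_V where
  "A_V G K a j i b c e = - del_p G K a i (conn G (del_t G K c) (part_p G K j b)) e"

definition H_T where
  "H_T G K a b k = d_t K a (conn G (del_x G K k) (del_t G K b))"
definition H_M where
  "H_M G K i j k = d_x K i (conn G (del_x G K k) (del_x G K j))"
definition H_V where
  "H_V G K a j i b k e = - del_p G K a i (conn G (del_x G K k) (part_p G K j b)) e"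

definition C_T where
  "C_T G K a k b c = d_t K a (conn G (part_p G K k c) (del_t G K b))"
definition C_M where
  "C_M G K i k j c = d_x K i (conn G (part_p G K k c) (del_x G K j))"
definition C_V where
  "C_V G K a j k i b c e = - del_p G K a i (conn G (part_p G K k c) (part_p G K j b)) e"


section \<open>Semi-Riemannian metrics and h-normal connections\<close>

definition metric_index :: "real ^ 'm ^ 'm::finite \<Rightarrow> nat" where
  "metric_index g = Max {dim S |S. subspace S \<and> (\<forall>v\<in>S. v \<noteq> 0 \<longrightarrow> v \<bullet> (g *v v) < 0)}"

definition semi_riemannian :: "('t, 'm::finite, 'x, 'n::finite) jet_data \<Rightarrow> bool" where
  "semi_riemannian G \<longleftrightarrow>
     (\<forall>\<alpha>\<in>T_atlas G. \<forall>a b.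
        smooth_on (snd \<alpha> ` fst \<alpha>) (\<lambda>u. metric G \<alpha> (chart_inv \<alpha> u) $ a $ b)) \<and>
     (\<forall>\<alpha>\<in>T_atlas G. \<forall>t\<in>fst \<alpha>.
        transpose (metric G \<alpha> t) = metric G \<alpha> t \<and> det (metric G \<alpha> t) \<noteq> 0) \<and>
     (\<exists>\<nu>. \<forall>\<alpha>\<in>T_atlas G. \<forall>t\<in>fst \<alpha>. metric_index (metric G \<alpha> t) = \<nu>) \<and>
     (\<forall>\<alpha>\<in>T_atlas G. \<forall>\<alpha>'\<in>T_atlas G. \<forall>t\<in>fst \<alpha> \<inter> fst \<alpha>'. \<forall>a b.
        metric G \<alpha>' t $ a $ b =
          (\<Sum>c\<in>UNIV. \<Sum>d\<in>UNIV. jac \<alpha>' \<alpha> t $ c $ a * jac \<alpha>' \<alpha> t $ d $ b * metric G \<alpha> t $ c $ d))"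

text \<open>\<open>metric_deriv G \<alpha> c a b\<close> is the derivative of \<open>h_{ab}\<close> with respect to \<open>t^c\<close>.\<close>

definition metric_deriv :: "('t, 'm::finite, 'x, 'n::finite) jet_data \<Rightarrow> ('t, 'm) chart \<Rightarrow>
    'm \<Rightarrow> 'm \<Rightarrow> 'm \<Rightarrow> 't \<Rightarrow> real" where
  "metric_deriv G \<alpha> c a b t =
     frechet_derivative (\<lambda>u. metric G \<alpha> (chart_inv \<alpha> u) $ a $ b) (at (snd \<alpha> t)) (axis c 1)"

definition christoffel :: "('t, 'm::finite, 'x, 'n::finite) jet_data \<Rightarrow> ('t, 'm) chart \<Rightarrow>
    'm \<Rightarrow> 'm \<Rightarrow> 'm \<Rightarrow> 't \<Rightarrow> real" where
  "christoffel G \<alpha> a b c t = (1/2) * (\<Sum>d\<in>UNIV. matrix_inv (metric G \<alpha> t) $ a $ d *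
     (metric_deriv G \<alpha> b d c t + metric_deriv G \<alpha> c d b t - metric_deriv G \<alpha> d b c t))"

text \<open>The Christoffel symbols as functions on the bundle.\<close>

definition chris :: "('t, 'm::finite, 'x, 'n::finite) jet_data \<Rightarrow> ('t, 'm, 'x, 'n) jchart \<Rightarrow>
    'm \<Rightarrow> 'm \<Rightarrow> 'm \<Rightarrow> ('t, 'm, 'x, 'n) jpoint \<Rightarrow> real" where
  "chris G K a b c e = christoffel G (fst K) a b c (fst e)"

definition kron :: "'i \<Rightarrow> 'i \<Rightarrow> real" where
  "kron i j = (if i = j then 1 else 0)"

definition J_tensor :: "('t, 'm::finite, 'x, 'n::finite) jet_data \<Rightarrow> ('t, 'm, 'x, 'n) jchart \<Rightarrow>
    ('t, 'm, 'x, 'n) jpoint vfield \<Rightarrow> ('t, 'm, 'x, 'n) jpoint vfield \<Rightarrow>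
    ('t, 'm, 'x, 'n) jpoint vfield \<Rightarrow> ('t, 'm, 'x, 'n) jpoint \<Rightarrow> real" where
  "J_tensor G K X Y Z e = (\<Sum>a\<in>UNIV. \<Sum>b\<in>UNIV. \<Sum>i\<in>UNIV. \<Sum>j\<in>UNIV.
     metric G (fst K) (fst e) $ a $ b * kron i j
       * del_p G K a i X e * d_t K b Y e * d_x K j Z e)"

definition h_normal :: "('t, 'm::finite, 'x, 'n::finite) jet_data \<Rightarrow> bool" where
  "h_normal G \<longleftrightarrow> (\<forall>K\<in>jcharts G.
     (\<forall>e\<in>jdom G K. \<forall>a b c. A_T G K a b c e = chris G K a b c e) \<and>
     (\<forall>e\<in>jdom G K. \<forall>a b i. H_T G K a b i e = 0) \<and>
     (\<forall>e\<in>jdom G K. \<forall>a b i c. C_T G K a i b c e = 0) \<and>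
     (\<forall>W. jet_open G W \<and> W \<subseteq> jdom G K \<longrightarrow>
        (\<forall>U\<in>vector_fields G W. \<forall>X\<in>vector_fields G W. \<forall>Y\<in>vector_fields G W. \<forall>Z\<in>vector_fields G W.
           \<forall>e\<in>W. U (J_tensor G K X Y Z) e - J_tensor G K (conn G U X) Y Z e
              - J_tensor G K X (conn G U Y) Z e - J_tensor G K X Y (conn G U Z) e = 0)))"


section \<open>Curvature, torsion d-tensors, covariant derivatives\<close>

definition curvature :: "('t, 'm::finite, 'x, 'n::finite) jet_data \<Rightarrow>
    ('t, 'm, 'x, 'n) jpoint vfield \<Rightarrow> ('t, 'm, 'x, 'n) jpoint vfield \<Rightarrow>
    ('t, 'm, 'x, 'n) jpoint vfield \<Rightarrow> ('t, 'm, 'x, 'n) jpoint vfield" where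
  "curvature G X Y Z =
     vf_diff (vf_diff (conn G X (conn G Y Z)) (conn G Y (conn G X Z))) (conn G (lie_bracket X Y) Z)"

text \<open>The two suffix letters of the following names refer to the last two lower slots of the object:
  \<open>T\<close> for a lower \<open>b\<close> or \<open>c\<close>, \<open>M\<close> for a lower \<open>j\<close> or \<open>k\<close>, \<open>V\<close> for a pair like \<open>(c)\<close>, \<open>(k)\<close>.\<close>

definition tor_TT where
  "tor_TT G K f r b c e = del_t G K c (N1 G K f r b) e - del_t G K b (N1 G K f r c) e"
definition tor_TM where
  "tor_TM G K f r b k e = del_x G K k (N1 G K f r b) e - del_t G K b (N2 G K f r k) e"
definition tor_MM where
  "tor_MM G K f r j k e = del_x G K k (N2 G K f r j) e - del_x G K j (N2 G K f r k) e"
definition tor_TV where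
  "tor_TV G K f k r b c e =
     part_p G K k c (N1 G K f r b) e + kron f c * A_M G K k r b e - kron k r * chris G K f c b e"
definition tor_MV where
  "tor_MV G K f k r j c e = part_p G K k c (N2 G K f r j) e + kron f c * H_M G K k r j e"

text \<open>\<open>C_slash G K l k i c b\<close> and \<open>C_bar G K l k i c j\<close> are the covariant derivatives of \<open>C_M G K l k i c\<close>
  in the directions \<open>b\<close> (slash) and \<open>j\<close> (bar).\<close>

definition C_slash where
  "C_slash G K l k i c b e = del_t G K b (C_M G K l k i c) e
     + (\<Sum>r\<in>UNIV. C_M G K r k i c e * A_M G K l r b e)
     - (\<Sum>r\<in>UNIV. C_M G K l k r c e * A_M G K r i b e)
     + (\<Sum>f\<in>UNIV. \<Sum>r\<in>UNIV. C_M G K l r i f e * A_V G K f k r c b e)"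
definition C_bar where
  "C_bar G K l k i c j e = del_x G K j (C_M G K l k i c) e
     + (\<Sum>r\<in>UNIV. C_M G K r k i c e * H_M G K l r j e)
     - (\<Sum>r\<in>UNIV. C_M G K l k r c e * H_M G K r i j e)
     + (\<Sum>f\<in>UNIV. \<Sum>r\<in>UNIV. C_M G K l r i f e * H_V G K f k r c j e)"


section \<open>The seven curvature d-tensors\<close>

definition curv_chi where
  "curv_chi G K d a b c e =
     del_t G K c (chris G K d a b) e - del_t G K b (chris G K d a c) e
     + (\<Sum>f\<in>UNIV. chris G K f a b e * chris G K d f c e)
     - (\<Sum>f\<in>UNIV. chris G K f a c e * chris G K d f b e)"

definition curv_TT where
  "curv_TT G K l i b c e =
     del_t G K c (A_M G K l i b) e - del_t G K b (A_M G K l i c) e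
     + (\<Sum>r\<in>UNIV. A_M G K r i b e * A_M G K l r c e)
     - (\<Sum>r\<in>UNIV. A_M G K r i c e * A_M G K l r b e)
     + (\<Sum>f\<in>UNIV. \<Sum>r\<in>UNIV. C_M G K l r i f e * tor_TT G K f r b c e)"

definition curv_TM where
  "curv_TM G K l i b k e =
     del_x G K k (A_M G K l i b) e - del_t G K b (H_M G K l i k) e
     + (\<Sum>r\<in>UNIV. A_M G K r i b e * H_M G K l r k e)
     - (\<Sum>r\<in>UNIV. H_M G K r i k e * A_M G K l r b e)
     + (\<Sum>f\<in>UNIV. \<Sum>r\<in>UNIV. C_M G K l r i f e * tor_TM G K f r b k e)"

definition curv_TV where
  "curv_TV G K l k i b c e =
     part_p G K k c (A_M G K l i b) e - C_slash G K l k i c b e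
     + (\<Sum>f\<in>UNIV. \<Sum>r\<in>UNIV. C_M G K l r i f e * tor_TV G K f k r b c e)"

definition curv_MM where
  "curv_MM G K l i j k e =
     del_x G K k (H_M G K l i j) e - del_x G K j (H_M G K l i k) e
     + (\<Sum>r\<in>UNIV. H_M G K r i j e * H_M G K l r k e)
     - (\<Sum>r\<in>UNIV. H_M G K r i k e * H_M G K l r j e)
     + (\<Sum>f\<in>UNIV. \<Sum>r\<in>UNIV. C_M G K l r i f e * tor_MM G K f r j k e)"

definition curv_MV where
  "curv_MV G K l k i j c e =
     part_p G K k c (H_M G K l i j) e - C_bar G K l k i c j e
     + (\<Sum>f\<in>UNIV. \<Sum>r\<in>UNIV. C_M G K l r i f e * tor_MV G K f k r j c e)"

definition curv_VV where
  "curv_VV G K l j k i b c e =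
     part_p G K k c (C_M G K l j i b) e - part_p G K j b (C_M G K l k i c) e
     + (\<Sum>r\<in>UNIV. C_M G K r j i b e * C_M G K l k r c e)
     - (\<Sum>r\<in>UNIV. C_M G K r k i c e * C_M G K l j r b e)"

text \<open>A d-tensor with \<open>p\<close> upper and \<open>r\<close> lower indices of type \<open>'m\<close> and \<open>q\<close> upper and \<open>s\<close> lower
  indices of type \<open>'n\<close> is a family \<open>F K as is bs js\<close> of local functions, one for each induced chart
  \<open>K\<close> and all lists \<open>as\<close>, \<open>is\<close>, \<open>bs\<close>, \<open>js\<close> of indices of these four kinds, which transforms with the
  Jacobian matrices of the base coordinates only.\<close>

definition d_tensor :: "('t, 'm::finite, 'x, 'n::finite) jet_data \<Rightarrow> nat \<Rightarrow> nat \<Rightarrow> nat \<Rightarrow> nat \<Rightarrow>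
    (('t, 'm, 'x, 'n) jchart \<Rightarrow> 'm list \<Rightarrow> 'n list \<Rightarrow> 'm list \<Rightarrow> 'n list \<Rightarrow>
      ('t, 'm, 'x, 'n) jpoint \<Rightarrow> real) \<Rightarrow> bool" where
  "d_tensor G p q r s F \<longleftrightarrow>
     (\<forall>(\<alpha>, \<beta>)\<in>jcharts G. \<forall>(\<alpha>', \<beta>')\<in>jcharts G. \<forall>e\<in>jdom G (\<alpha>, \<beta>) \<inter> jdom G (\<alpha>', \<beta>').
        \<forall>as' is' bs' js'. length as' = p \<and> length is' = q \<and> length bs' = r \<and> length js' = s \<longrightarrow>
          F (\<alpha>', \<beta>') as' is' bs' js' e =
          (\<Sum>as\<in>{as. length as = p}. \<Sum>is\<in>{is. length is = q}.
           \<Sum>bs\<in>{bs. length bs = r}. \<Sum>js\<in>{js. length js = s}.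
             (\<Prod>u<p. jac \<alpha> \<alpha>' (fst e) $ (as' ! u) $ (as ! u))
           * (\<Prod>u<q. jac \<beta> \<beta>' (fst (snd e)) $ (is' ! u) $ (is ! u))
           * (\<Prod>u<r. jac \<alpha>' \<alpha> (fst e) $ (bs ! u) $ (bs' ! u))
           * (\<Prod>u<s. jac \<beta>' \<beta> (fst (snd e)) $ (js ! u) $ (js' ! u))
           * F (\<alpha>, \<beta>) as is bs js e))"

end

theory Submission
  imports Defs
begin

text \<open>Write \<open>X\<^sub>d\<close> for the adapted frame and \<open>E\<^sub>s\<close> for one of its three blocks. Since \<open>D\<close> commutes with the
  three projections, \<open>D X\<^sub>d E\<^sub>s\<close> is a combination of the \<open>E\<^sub>s\<close> alone, so each block has its own connection
  form \<open>\<omega>\<close>. The brackets \<open>[X\<^sub>d, X\<^sub>d']\<close> are vertical, because coordinate derivatives commute and only the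
  coefficients of \<open>N\<close> get differentiated. The curvature on a block is therefore
  \<open>d\<omega> + \<omega> \<and> \<omega>\<close> corrected by \<open>\<omega>\<close> of the vertical bracket; reading this off on the first two blocks
  gives the seven tensors. On the vertical block, \<open>DJ = 0\<close> and the metricity of the Christoffel
  symbols express \<open>\<omega>\<close> through the forms of the other two blocks (as for a tensor product with a dual),
  hence also its curvature. The transformation rules hold because the curvature operator is
  function-linear in all arguments and the adapted frames of two charts differ by Jacobian
  matrices.\<close>

section \<open>Smooth maps on open sets\<close>

text \<open>A vector field is an arbitrary operator on functions, meaningful only on smooth
  functions and at points of its domain. Fields are therefore compared up to \<open>vf_eq\<close>,
  and replacing something under \<open>conn\<close>, a bracket or another field needs a congruence
  whose premises are smoothness facts. This is why finite combinations, tensoriality and the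
  structure equation are settled for fields over an arbitrary open set before adapted frames enter.

  The main analytic input is the symmetry of second derivatives. Derivatives of the new fibre
  coordinates along the old base directions would involve second derivatives of the chart changes;
  they are never computed, because the transformation rule of the nonlinear connection expresses
  exactly these terms and eliminates them.

  In the vertical block the connection form has one part from each of the two other blocks. The
  mixed products of these parts are symmetric in the two directions and cancel in the curvature; the
  dual factor reverses the order of its products, which explains the minus signs of the vertical
  components.\<close>

lemma differentiable_on_open_at:
  "open S \<Longrightarrow> f differentiable_on S \<longleftrightarrow> (\<forall>x\<in>S. f differentiable (at x))"
  by (simp add: differentiable_on_def at_within_open[of _ S] cong: ball_cong)

lemma frechet_derivative_eq:
  "(f has_derivative f') (at x) \<Longrightarrow> frechet_derivative f (at x) = f'"
  by (rule frechet_derivative_at[symmetric])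

lemma differentiable_cong_open:
  assumes "open S" "x \<in> S" "\<And>y. y \<in> S \<Longrightarrow> f y = g y" "f differentiable (at x)"
  shows "g differentiable (at x)"
proof -
  obtain f' where "(f has_derivative f') (at x)"
    using assms(4) unfolding differentiable_def by (elim exE)
  then have "(g has_derivative f') (at x)"
    by (rule has_derivative_transform_within_open[OF _ assms(1,2)]) (rule assms(3))
  then show ?thesis by (rule Derivative.differentiableI)
qed

lemma frechet_derivative_cong_open:
  assumes "open S" "x \<in> S" "\<And>y. y \<in> S \<Longrightarrow> f y = g y" "f differentiable (at x)"
  shows "frechet_derivative f (at x) = frechet_derivative g (at x)"
  by (rule frechet_derivative_transform_within_open[OF assms(4,1,2)]) (rule assms(3))

lemma Ck_on_Suc_open:
  "open S \<Longrightarrow> Ck_on (Suc k) S f \<longleftrightarrow>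
     (\<forall>x\<in>S. f differentiable (at x)) \<and> (\<forall>v. Ck_on k S (\<lambda>x. frechet_derivative f (at x) v))"
  by (simp add: differentiable_on_open_at)

text \<open>\<open>Ck_on\<close> differentiates with \<open>at x\<close>, in a full neighbourhood of
  the point. Openness of \<open>S\<close> is what carries agreement on \<open>S\<close> over to the
  derivatives, to which the induction then applies.\<close>

lemma Ck_on_cong_open:
  assumes "open S" "\<And>x. x \<in> S \<Longrightarrow> f x = g x" "Ck_on k S f"
  shows "Ck_on k S g"
  using assms(2,3)
proof (induction k arbitrary: f g)
  case 0
  then show ?case using continuous_on_cong[of S S f g] by simp
next
  case (Suc k)
  have d: "f differentiable (at x)" if "x \<in> S" for x
    using Suc.prems(2) that unfolding Ck_on_Suc_open[OF \<open>open S\<close>] by blast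
  have "g differentiable (at x)" if "x \<in> S" for x
    using differentiable_cong_open[OF \<open>open S\<close> that _ d[OF that]] Suc.prems(1) by metis
  moreover have "Ck_on k S (\<lambda>x. frechet_derivative g (at x) v)" for v
  proof (rule Suc.IH)
    show "Ck_on k S (\<lambda>x. frechet_derivative f (at x) v)"
      using Suc.prems(2) by simp
    show "frechet_derivative f (at x) v = frechet_derivative g (at x) v" if "x \<in> S" for x
      using frechet_derivative_cong_open[OF \<open>open S\<close> that _ d[OF that]] Suc.prems(1) by metis
  qed
  ultimately show ?case
    unfolding Ck_on_Suc_open[OF \<open>open S\<close>] by blast
qed

lemma Ck_on_subset: "Ck_on k S f \<Longrightarrow> T \<subseteq> S \<Longrightarrow> Ck_on k T f"
  by (induction k arbitrary: f) (auto intro: continuous_on_subset differentiable_on_subset)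

lemma Ck_on_const: "Ck_on k S (\<lambda>x. c)"
  by (induction k arbitrary: c) auto

lemma Ck_on_linear:
  assumes "bounded_linear L" shows "Ck_on k S L"
proof (cases k)
  case 0
  then show ?thesis using assms by (simp add: linear_continuous_on)
next
  case (Suc j)
  have "frechet_derivative L (at x) = L" for x
    using assms by (intro frechet_derivative_eq bounded_linear_imp_has_derivative)
  then show ?thesis
    using bounded_linear_imp_differentiable_on[OF assms] by (simp add: Suc Ck_on_const)
qed

lemma Ck_on_bounded_linear_compose:
  assumes "open S" "bounded_linear L" "Ck_on k S f"
  shows "Ck_on k S (\<lambda>x. L (f x))"
  using assms(3)
proof (induction k arbitrary: f)
  case 0
  then show ?case using assms(2) by (simp add: bounded_linear.continuous_on)
next
  case (Suc k)
  have d: "((\<lambda>x. L (f x)) has_derivative (\<lambda>v. L (frechet_derivative f (at x) v))) (at x)"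
    if "x \<in> S" for x
    using Suc.prems that assms(2) frechet_derivative_works
    unfolding Ck_on_Suc_open[OF \<open>open S\<close>] by (blast intro: bounded_linear.has_derivative)
  have "Ck_on k S (\<lambda>x. L (frechet_derivative f (at x) v))" for v
    using Suc.IH Suc.prems by simp
  then have "Ck_on k S (\<lambda>x. frechet_derivative (\<lambda>x. L (f x)) (at x) v)" for v
    by (rule Ck_on_cong_open[OF \<open>open S\<close>, rotated]) (simp add: frechet_derivative_eq[OF d])
  with d show ?case
    unfolding Ck_on_Suc_open[OF \<open>open S\<close>] differentiable_def by blast
qed

lemma Ck_on_add:
  assumes "open S" "Ck_on k S f" "Ck_on k S g"
  shows "Ck_on k S (\<lambda>x. f x + g x)"
  using assms(2,3)
proof (induction k arbitrary: f g)
  case 0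
  then show ?case by (simp add: continuous_on_add)
next
  case (Suc k)
  have d: "((\<lambda>x. f x + g x) has_derivative
      (\<lambda>v. frechet_derivative f (at x) v + frechet_derivative g (at x) v)) (at x)" if "x \<in> S" for x
    using Suc.prems that frechet_derivative_works
    unfolding Ck_on_Suc_open[OF \<open>open S\<close>] by (blast intro: has_derivative_add)
  have "Ck_on k S (\<lambda>x. frechet_derivative f (at x) v + frechet_derivative g (at x) v)" for v
    using Suc.IH Suc.prems by simp
  then have "Ck_on k S (\<lambda>x. frechet_derivative (\<lambda>x. f x + g x) (at x) v)" for v
    by (rule Ck_on_cong_open[OF \<open>open S\<close>, rotated]) (simp add: frechet_derivative_eq[OF d])
  with d show ?case
    unfolding Ck_on_Suc_open[OF \<open>open S\<close>] differentiable_def by blast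
qed

lemma Ck_on_mono_Suc:
  "open S \<Longrightarrow> Ck_on (Suc k) S f \<Longrightarrow> Ck_on k S f"
proof (induction k arbitrary: f)
  case 0
  then show ?case by (simp add: differentiable_imp_continuous_on)
next
  case (Suc k)
  then show ?case by (metis Ck_on.simps(2))
qed

text \<open>The product rule leaves one factor of each term undifferentiated. That factor has one
  order more than the induction hypothesis speaks of, so \<open>Ck_on_mono_Suc\<close> lowers it
  first.\<close>

lemma Ck_on_mult:
  fixes f g :: "'a::euclidean_space \<Rightarrow> real"
  assumes "open S" "Ck_on k S f" "Ck_on k S g"
  shows "Ck_on k S (\<lambda>x. f x * g x)"
  using assms(2,3)
proof (induction k arbitrary: f g)
  case 0
  then show ?case by (simp add: continuous_on_mult)
next
  case (Suc k)
  have d: "((\<lambda>x. f x * g x) has_derivative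
      (\<lambda>v. f x * frechet_derivative g (at x) v + frechet_derivative f (at x) v * g x)) (at x)"
    if "x \<in> S" for x
    using Suc.prems that frechet_derivative_works
    unfolding Ck_on_Suc_open[OF \<open>open S\<close>] by (blast intro: has_derivative_mult)
  have "Ck_on k S f" "Ck_on k S g"
    using Suc.prems Ck_on_mono_Suc[OF \<open>open S\<close>] by auto
  then have "Ck_on k S (\<lambda>x. f x * frechet_derivative g (at x) v + frechet_derivative f (at x) v * g x)" for v
    using Suc.prems by (intro Ck_on_add[OF \<open>open S\<close>] Suc.IH) auto
  then have "Ck_on k S (\<lambda>x. frechet_derivative (\<lambda>x. f x * g x) (at x) v)" for v
    by (rule Ck_on_cong_open[OF \<open>open S\<close>, rotated]) (simp add: frechet_derivative_eq[OF d])
  with d show ?case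
    unfolding Ck_on_Suc_open[OF \<open>open S\<close>] differentiable_def by blast
qed

lemma Ck_on_sum:
  assumes "open S" "\<And>i. i \<in> A \<Longrightarrow> Ck_on k S (f i)"
  shows "Ck_on k S (\<lambda>x. \<Sum>i\<in>A. f i x)"
proof (cases "finite A")
  case True
  then show ?thesis using assms(2)
    by (induction A) (auto intro: Ck_on_const Ck_on_add[OF \<open>open S\<close>])
next
  case False
  then show ?thesis by (simp add: Ck_on_const)
qed

text \<open>Expanding the inner derivative along \<open>Basis\<close> turns the chain rule into a
  finite sum of products of real functions, for which closure under sums and products is available.
  The induction runs over \<open>f\<close> with \<open>g\<close> fixed.\<close>

lemma Ck_on_compose:
  fixes f :: "'b::euclidean_space \<Rightarrow> real" and g :: "'a::euclidean_space \<Rightarrow> 'b"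
  assumes S: "open S" and T: "open T" and gS: "g ` S \<subseteq> T"
    and "Ck_on k T f" "Ck_on k S g"
  shows "Ck_on k S (f \<circ> g)"
  using assms(4,5)
proof (induction k arbitrary: f)
  case 0
  then show ?case
    using gS by (metis Ck_on.simps(1) continuous_on_compose continuous_on_subset)
next
  case (Suc k)
  let ?D = "\<lambda>x v. \<Sum>b\<in>Basis. (frechet_derivative g (at x) v \<bullet> b) * frechet_derivative f (at (g x)) b"
  have df: "f differentiable (at (g x))" if "x \<in> S" for x
    using Suc.prems(1) gS that unfolding Ck_on_Suc_open[OF T] by blast
  have dg: "g differentiable (at x)" if "x \<in> S" for x
    using Suc.prems(2) that unfolding Ck_on_Suc_open[OF S] by blast
  have fr: "frechet_derivative (f \<circ> g) (at x) v = ?D x v" if "x \<in> S" for x v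
  proof -
    have lin: "linear (frechet_derivative f (at (g x)))"
      using linear_frechet_derivative df that by blast
    have "frechet_derivative (f \<circ> g) (at x) v =
        frechet_derivative f (at (g x)) (frechet_derivative g (at x) v)"
      using frechet_derivative_compose[OF dg df] that by simp
    also have "\<dots> = frechet_derivative f (at (g x))
        (\<Sum>b\<in>Basis. (frechet_derivative g (at x) v \<bullet> b) *\<^sub>R b)"
      by (simp add: euclidean_representation)
    also have "\<dots> = ?D x v"
      by (simp add: linear_sum[OF lin] linear_scale[OF lin])
    finally show ?thesis .
  qed
  have "Ck_on k S (\<lambda>x. ?D x v)" for v
  proof (intro Ck_on_sum[OF S] Ck_on_mult[OF S])
    fix b :: 'b
    show "Ck_on k S (\<lambda>x. frechet_derivative g (at x) v \<bullet> b)"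
      using Suc.prems(2) by (intro Ck_on_bounded_linear_compose[OF S bounded_linear_inner_left]) auto
    show "Ck_on k S (\<lambda>x. frechet_derivative f (at (g x)) b)"
      using Suc.IH[of "\<lambda>y. frechet_derivative f (at y) b"] Suc.prems Ck_on_mono_Suc[OF S]
      by (auto simp: o_def)
  qed
  then have "Ck_on k S (\<lambda>x. frechet_derivative (f \<circ> g) (at x) v)" for v
    by (rule Ck_on_cong_open[OF S, rotated]) (simp add: fr)
  moreover have "f \<circ> g differentiable (at x)" if "x \<in> S" for x
    using differentiable_chain_at[OF dg df] that by blast
  ultimately show ?case
    unfolding Ck_on_Suc_open[OF S] by blast
qed

lemma Ck_on_componentwise:
  fixes g :: "'a::euclidean_space \<Rightarrow> 'b::euclidean_space"
  assumes S: "open S" and "\<And>b. b \<in> Basis \<Longrightarrow> Ck_on k S (\<lambda>x. g x \<bullet> b)"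
  shows "Ck_on k S g"
proof -
  have "Ck_on k S (\<lambda>x. \<Sum>b\<in>Basis. (g x \<bullet> b) *\<^sub>R b)"
    using assms(2)
    by (intro Ck_on_sum[OF S] Ck_on_bounded_linear_compose[OF S bounded_linear_scaleR_left])
  then show ?thesis by (simp add: euclidean_representation)
qed

lemma smooth_on_cong_open:
  "open S \<Longrightarrow> (\<And>x. x \<in> S \<Longrightarrow> f x = g x) \<Longrightarrow> smooth_on S f \<Longrightarrow> smooth_on S g"
  unfolding smooth_on_def using Ck_on_cong_open by metis

lemma smooth_on_subset: "smooth_on S f \<Longrightarrow> T \<subseteq> S \<Longrightarrow> smooth_on T f"
  unfolding smooth_on_def using Ck_on_subset by metis

lemma smooth_on_const: "smooth_on S (\<lambda>x. c)"
  unfolding smooth_on_def by (simp add: Ck_on_const)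

lemma smooth_on_linear: "bounded_linear L \<Longrightarrow> smooth_on S L"
  unfolding smooth_on_def by (simp add: Ck_on_linear)

lemma smooth_on_bounded_linear_compose:
  "open S \<Longrightarrow> bounded_linear L \<Longrightarrow> smooth_on S f \<Longrightarrow> smooth_on S (\<lambda>x. L (f x))"
  unfolding smooth_on_def by (simp add: Ck_on_bounded_linear_compose)

lemma smooth_on_add:
  "open S \<Longrightarrow> smooth_on S f \<Longrightarrow> smooth_on S g \<Longrightarrow> smooth_on S (\<lambda>x. f x + g x)"
  unfolding smooth_on_def by (simp add: Ck_on_add)

lemma smooth_on_mult:
  fixes f g :: "'a::euclidean_space \<Rightarrow> real"
  shows "open S \<Longrightarrow> smooth_on S f \<Longrightarrow> smooth_on S g \<Longrightarrow> smooth_on S (\<lambda>x. f x * g x)"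
  unfolding smooth_on_def by (simp add: Ck_on_mult)

lemma smooth_on_sum:
  "open S \<Longrightarrow> (\<And>i. i \<in> A \<Longrightarrow> smooth_on S (f i)) \<Longrightarrow> smooth_on S (\<lambda>x. \<Sum>i\<in>A. f i x)"
  unfolding smooth_on_def by (simp add: Ck_on_sum)

lemma smooth_on_compose:
  fixes f :: "'b::euclidean_space \<Rightarrow> real"
  shows "open S \<Longrightarrow> open T \<Longrightarrow> g ` S \<subseteq> T \<Longrightarrow> smooth_on T f \<Longrightarrow> smooth_on S g \<Longrightarrow> smooth_on S (f \<circ> g)"
  unfolding smooth_on_def by (simp add: Ck_on_compose)

lemma smooth_on_componentwise:
  fixes g :: "'a::euclidean_space \<Rightarrow> 'b::euclidean_space"
  shows "open S \<Longrightarrow> (\<And>b. b \<in> Basis \<Longrightarrow> smooth_on S (\<lambda>x. g x \<bullet> b)) \<Longrightarrow> smooth_on S g"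
  unfolding smooth_on_def by (simp add: Ck_on_componentwise)

lemma smooth_on_differentiable:
  assumes "open S" "smooth_on S f" "x \<in> S" shows "f differentiable (at x)"
  using assms Ck_on_Suc_open[OF \<open>open S\<close>, of 0 f] unfolding smooth_on_def by blast

lemma smooth_on_continuous:
  assumes "smooth_on S f" shows "continuous_on S f"
  using assms Ck_on.simps(1)[of S f] unfolding smooth_on_def by blast

lemma smooth_on_frechet_derivative:
  "smooth_on S f \<Longrightarrow> smooth_on S (\<lambda>x. frechet_derivative f (at x) v)"
  unfolding smooth_on_def by (metis Ck_on.simps(2))

section \<open>Derivatives along lines and the symmetry of second derivatives\<close>

lemma frechet_derivative_line:
  fixes f :: "'a::euclidean_space \<Rightarrow> real"
  assumes "open S" "z \<in> S" "f differentiable (at z)"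
    and line: "\<And>s. z + s *\<^sub>R v \<in> S \<Longrightarrow> f (z + s *\<^sub>R v) = f z + s * c"
  shows "frechet_derivative f (at z) v = c"
proof -
  let ?l = "\<lambda>s::real. z + s *\<^sub>R v"
  have l: "(?l has_derivative (\<lambda>s. s *\<^sub>R v)) (at 0)"
    by (auto intro!: derivative_eq_intros)
  have "(f has_derivative frechet_derivative f (at z)) (at (?l 0))"
    using assms(3) by (simp add: frechet_derivative_works[symmetric])
  from diff_chain_at[OF l this]
  have 1: "(f \<circ> ?l has_derivative (\<lambda>s. frechet_derivative f (at z) (s *\<^sub>R v))) (at 0)"
    by (simp add: o_def)
  have op: "open (?l -` S)"
    by (intro open_vimage assms(1) continuous_intros)
  have lin: "((\<lambda>s. f z + s * c) has_derivative (\<lambda>s. s * c)) (at 0)"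
    by (auto intro!: derivative_eq_intros)
  have "(f \<circ> ?l has_derivative (\<lambda>s. s * c)) (at 0)"
    by (rule has_derivative_transform_within_open[OF lin op]) (use assms(2) line in auto)
  from has_derivative_unique[OF 1 this] show ?thesis
    by (metis mult_1 scaleR_one)
qed

text \<open>The one-variable form in which the mean value theorem can be applied.\<close>

lemma has_derivative_line:
  fixes f :: "'a::euclidean_space \<Rightarrow> real"
  assumes "f differentiable (at (y + s *\<^sub>R v))"
  shows "((\<lambda>s. f (y + s *\<^sub>R v)) has_real_derivative
            frechet_derivative f (at (y + s *\<^sub>R v)) v) (at s)"
proof -
  have l: "((\<lambda>s::real. y + s *\<^sub>R v) has_derivative (\<lambda>s. s *\<^sub>R v)) (at s)"
    by (auto intro!: derivative_eq_intros)
  have f: "(f has_derivative frechet_derivative f (at (y + s *\<^sub>R v))) (at (y + s *\<^sub>R v))"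
    using assms by (simp add: frechet_derivative_works[symmetric])
  from diff_chain_at[OF l f]
  show ?thesis
    unfolding has_field_derivative_def o_def
    by (rule has_derivative_eq_rhs)
       (auto simp: linear_scale[OF linear_frechet_derivative[OF assms]])
qed

text \<open>A second difference of \<open>f\<close> is, by the mean value theorem applied twice, a mixed second
  derivative at a nearby point, in either order of differentiation.\<close>

lemma second_difference:
  fixes f :: "'a::euclidean_space \<Rightarrow> real"
  assumes S: "open S" and f: "smooth_on S f" and h: "0 < h"
    and box: "\<And>s t. 0 \<le> s \<Longrightarrow> s \<le> h \<Longrightarrow> 0 \<le> t \<Longrightarrow> t \<le> h \<Longrightarrow> z + s *\<^sub>R v + t *\<^sub>R w \<in> S"
  obtains s t where "0 < s" "s < h" "0 < t" "t < h"
    "f (z + h *\<^sub>R v + h *\<^sub>R w) - f (z + h *\<^sub>R v) - f (z + h *\<^sub>R w) + f z =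
     h * h * frechet_derivative (\<lambda>y. frechet_derivative f (at y) v) (at (z + s *\<^sub>R v + t *\<^sub>R w)) w"
proof -
  let ?D = "\<lambda>y. frechet_derivative f (at y) v"
  let ?g = "\<lambda>s. f ((z + h *\<^sub>R w) + s *\<^sub>R v) - f (z + s *\<^sub>R v)"
  have 1: "(?g has_real_derivative ?D ((z + h *\<^sub>R w) + s *\<^sub>R v) - ?D (z + s *\<^sub>R v)) (at s)"
    if "0 \<le> s" "s \<le> h" for s
    using box[of s h] box[of s 0] h that
    by (intro DERIV_diff has_derivative_line smooth_on_differentiable[OF S f]) (auto simp: algebra_simps)
  obtain s where s: "0 < s" "s < h"
    and gs: "?g h - ?g 0 = (h - 0) * (?D ((z + h *\<^sub>R w) + s *\<^sub>R v) - ?D (z + s *\<^sub>R v))"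
    using MVT2[OF h 1] by blast
  let ?k = "\<lambda>t. ?D ((z + s *\<^sub>R v) + t *\<^sub>R w)"
  have 2: "(?k has_real_derivative frechet_derivative ?D (at ((z + s *\<^sub>R v) + t *\<^sub>R w)) w) (at t)"
    if "0 \<le> t" "t \<le> h" for t
    using box[of s t] s that
    by (intro has_derivative_line smooth_on_differentiable[OF S smooth_on_frechet_derivative[OF f]]) auto
  obtain t where t: "0 < t" "t < h"
    and kt: "?k h - ?k 0 = (h - 0) * frechet_derivative ?D (at ((z + s *\<^sub>R v) + t *\<^sub>R w)) w"
    using MVT2[OF h 2] by blast
  have "f (z + h *\<^sub>R v + h *\<^sub>R w) - f (z + h *\<^sub>R v) - f (z + h *\<^sub>R w) + f z = ?g h - ?g 0"
    by (simp add: algebra_simps)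
  also have "\<dots> = h * (?k h - ?k 0)"
    using gs by (simp add: algebra_simps)
  also have "\<dots> = h * h * frechet_derivative ?D (at (z + s *\<^sub>R v + t *\<^sub>R w)) w"
    using kt by simp
  finally show thesis using that s t by blast
qed

text \<open>The second difference over a small parallelogram is symmetric in \<open>v\<close> and
  \<open>w\<close>, so each mixed derivative takes the same value somewhere near \<open>z\<close>.
  If they differed at \<open>z\<close>, continuity with error half the gap would exclude a common
  value.\<close>

lemma frechet_derivative_commute:
  fixes f :: "'a::euclidean_space \<Rightarrow> real"
  assumes S: "open S" and f: "smooth_on S f" and z: "z \<in> S"
  shows "frechet_derivative (\<lambda>y. frechet_derivative f (at y) v) (at z) w =
         frechet_derivative (\<lambda>y. frechet_derivative f (at y) w) (at z) v"
    (is "?A z = ?B z")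
proof (rule ccontr)
  assume neq: "?A z \<noteq> ?B z"
  define \<epsilon> where "\<epsilon> = \<bar>?A z - ?B z\<bar> / 2"
  have "\<epsilon> > 0" using neq by (simp add: \<epsilon>_def)
  have cont: "continuous_on S ?A" "continuous_on S ?B"
    by (intro smooth_on_continuous smooth_on_frechet_derivative f)+
  obtain d1 where d1: "d1 > 0" "\<And>y. y \<in> S \<Longrightarrow> dist y z < d1 \<Longrightarrow> dist (?A y) (?A z) < \<epsilon>"
    using cont(1) z \<open>\<epsilon> > 0\<close> unfolding continuous_on_iff by metis
  obtain d2 where d2: "d2 > 0" "\<And>y. y \<in> S \<Longrightarrow> dist y z < d2 \<Longrightarrow> dist (?B y) (?B z) < \<epsilon>"
    using cont(2) z \<open>\<epsilon> > 0\<close> unfolding continuous_on_iff by metis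
  obtain d3 where d3: "d3 > 0" "ball z d3 \<subseteq> S"
    using S z openE by blast
  define d where "d = min d1 (min d2 d3)"
  \<comment> \<open>Chosen so that the whole parallelogram with sides \<open>h *\<^sub>R v\<close>
    and \<open>h *\<^sub>R w\<close> stays within distance \<open>d\<close> of \<open>z\<close>; the
    summand 1 keeps the denominator positive when both vectors are 0.\<close>
  define h where "h = d / (2 * (norm v + norm w + 1))"
  have "d > 0" using d1 d2 d3 by (simp add: d_def)
  have c: "2 * (norm v + norm w + 1) > 0"
    by (simp add: add_nonneg_pos)
  have h: "h > 0" using \<open>d > 0\<close> c by (simp add: h_def)
  have near: "dist (z + s *\<^sub>R v + t *\<^sub>R w) z < d" if "0 \<le> s" "s \<le> h" "0 \<le> t" "t \<le> h" for s t
  proof -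
    have "dist (z + s *\<^sub>R v + t *\<^sub>R w) z = norm (s *\<^sub>R v + t *\<^sub>R w)"
      by (simp add: dist_norm algebra_simps)
    also have "\<dots> \<le> s * norm v + t * norm w"
      using norm_triangle_ineq[of "s *\<^sub>R v" "t *\<^sub>R w"] that by simp
    also have "\<dots> \<le> h * norm v + h * norm w"
      using that by (intro add_mono mult_right_mono) auto
    also have "\<dots> < h * (2 * (norm v + norm w + 1))"
      using mult_strict_left_mono[of "norm v + norm w" "2 * (norm v + norm w + 1)" h] h
      by (simp add: distrib_left add_nonneg_pos)
    also have "\<dots> = d"
      using c by (simp add: h_def)
    finally show ?thesis .
  qed
  have inS: "z + s *\<^sub>R v + t *\<^sub>R w \<in> S" if "0 \<le> s" "s \<le> h" "0 \<le> t" "t \<le> h" for s t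
    using near[OF that] d3 by (auto simp: d_def dist_commute subset_eq)
  obtain s t where st: "0 < s" "s < h" "0 < t" "t < h"
    and e1: "f (z + h *\<^sub>R v + h *\<^sub>R w) - f (z + h *\<^sub>R v) - f (z + h *\<^sub>R w) + f z =
             h * h * ?A (z + s *\<^sub>R v + t *\<^sub>R w)"
    by (rule second_difference[OF S f h inS])
  have inS': "z + s *\<^sub>R w + t *\<^sub>R v \<in> S" if "0 \<le> s" "s \<le> h" "0 \<le> t" "t \<le> h" for s t
    using inS[OF that(3,4,1,2)] by (simp add: algebra_simps)
  obtain s' t' where st': "0 < s'" "s' < h" "0 < t'" "t' < h"
    and e2: "f (z + h *\<^sub>R w + h *\<^sub>R v) - f (z + h *\<^sub>R w) - f (z + h *\<^sub>R v) + f z =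
             h * h * ?B (z + s' *\<^sub>R w + t' *\<^sub>R v)"
    by (rule second_difference[OF S f h inS'])
  have "h * h * ?A (z + s *\<^sub>R v + t *\<^sub>R w) = h * h * ?B (z + t' *\<^sub>R v + s' *\<^sub>R w)"
    using e1 e2 by (simp add: algebra_simps)
  then have "?A (z + s *\<^sub>R v + t *\<^sub>R w) = ?B (z + t' *\<^sub>R v + s' *\<^sub>R w)"
    using h by simp
  moreover have "dist (?A (z + s *\<^sub>R v + t *\<^sub>R w)) (?A z) < \<epsilon>"
    using near[of s t] inS[of s t] st by (intro d1) (auto simp: d_def)
  moreover have "dist (?B (z + t' *\<^sub>R v + s' *\<^sub>R w)) (?B z) < \<epsilon>"
    using near[of t' s'] inS[of t' s'] st' by (intro d2) (auto simp: d_def)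
  ultimately have "\<bar>?A z - ?B z\<bar> < 2 * \<epsilon>"
    by (simp add: dist_real_def)
  then show False by (simp add: \<epsilon>_def)
qed


section \<open>Charts and Jacobian matrices\<close>

lemma chart_inv_left:
  assumes "smooth_atlas A" "\<alpha> \<in> A" "q \<in> fst \<alpha>"
  shows "chart_inv \<alpha> (snd \<alpha> q) = q"
proof -
  obtain \<psi> where "homeomorphism (fst \<alpha>) (snd \<alpha> ` fst \<alpha>) (snd \<alpha>) \<psi>"
    using assms(1,2) unfolding smooth_atlas_def by blast
  then have "inj_on (snd \<alpha>) (fst \<alpha>)"
    by (intro inj_on_inverseI[of _ \<psi>]) (rule homeomorphism_apply1)
  then show ?thesis
    using assms(3) by (simp add: chart_inv_def)
qed

lemma chart_inv_right:
  assumes "u \<in> snd \<alpha> ` fst \<alpha>"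
  shows "snd \<alpha> (chart_inv \<alpha> u) = u" "chart_inv \<alpha> u \<in> fst \<alpha>"
  using assms by (simp_all add: chart_inv_def f_inv_into_f inv_into_into)

lemma chart_overlap_open:
  assumes "smooth_atlas A" "\<alpha> \<in> A" "\<beta> \<in> A"
  shows "open (snd \<alpha> ` (fst \<alpha> \<inter> fst \<beta>))"
proof -
  obtain \<psi> where h: "homeomorphism (fst \<alpha>) (snd \<alpha> ` fst \<alpha>) (snd \<alpha>) \<psi>"
    using assms unfolding smooth_atlas_def by blast
  have o: "open (fst \<beta>)" "open (snd \<alpha> ` fst \<alpha>)"
    using assms unfolding smooth_atlas_def by blast+
  have "openin (top_of_set (fst \<alpha>)) (fst \<alpha> \<inter> fst \<beta>)"
    by (rule openin_open_Int[OF o(1)])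
  from homeomorphism_imp_open_map[OF h this] show ?thesis
    using openin_open_eq[OF o(2)] by simp
qed

lemma chart_image_open: "smooth_atlas A \<Longrightarrow> \<alpha> \<in> A \<Longrightarrow> open (snd \<alpha> ` fst \<alpha>)"
  unfolding smooth_atlas_def by blast

lemma transition_smooth:
  assumes "smooth_atlas A" "\<alpha> \<in> A" "\<beta> \<in> A"
  shows "smooth_on (snd \<alpha> ` (fst \<alpha> \<inter> fst \<beta>)) (snd \<beta> \<circ> chart_inv \<alpha>)"
  using assms unfolding smooth_atlas_def by blast

lemma transition_has_derivative:
  assumes A: "smooth_atlas A" "\<alpha> \<in> A" "\<beta> \<in> A" and q: "q \<in> fst \<alpha>" "q \<in> fst \<beta>"
  shows "((snd \<beta> \<circ> chart_inv \<alpha>) has_derivative (\<lambda>v. jac \<alpha> \<beta> q *v v)) (at (snd \<alpha> q))"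
proof -
  have d: "(snd \<beta> \<circ> chart_inv \<alpha>) differentiable (at (snd \<alpha> q))"
    using q by (intro smooth_on_differentiable[OF chart_overlap_open[OF A] transition_smooth[OF A]]) blast
  have "(\<lambda>v. jac \<alpha> \<beta> q *v v) = frechet_derivative (snd \<beta> \<circ> chart_inv \<alpha>) (at (snd \<alpha> q))"
    using linear_frechet_derivative[OF d] unfolding jac_def
    by (auto simp: matrix_works linear_matrix_vector_mul_eq)
  then show ?thesis
    using d by (simp add: frechet_derivative_works[symmetric])
qed

text \<open>The chain rule. The composite through \<beta> agrees with the direct transition on the
  overlap with the domain of \<beta>, an open set around the point, which suffices for the
  derivative there.\<close>

lemma jac_chain:
  assumes A: "smooth_atlas A" "\<alpha> \<in> A" "\<beta> \<in> A" "\<gamma> \<in> A"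
    and q: "q \<in> fst \<alpha>" "q \<in> fst \<beta>" "q \<in> fst \<gamma>"
  shows "jac \<beta> \<gamma> q ** jac \<alpha> \<beta> q = jac \<alpha> \<gamma> q"
proof -
  have 0: "(snd \<beta> \<circ> chart_inv \<alpha>) (snd \<alpha> q) = snd \<beta> q"
    using chart_inv_left[OF A(1,2) q(1)] by simp
  have "(snd \<gamma> \<circ> chart_inv \<beta> \<circ> (snd \<beta> \<circ> chart_inv \<alpha>) has_derivative
      (\<lambda>v. jac \<beta> \<gamma> q *v v) \<circ> (\<lambda>v. jac \<alpha> \<beta> q *v v)) (at (snd \<alpha> q))"
    using diff_chain_at[OF transition_has_derivative[OF A(1,2,3) q(1,2)],
        unfolded 0, OF transition_has_derivative[OF A(1,3,4) q(2,3)]] .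
  then have 1: "(snd \<gamma> \<circ> chart_inv \<alpha> has_derivative
      (\<lambda>v. jac \<beta> \<gamma> q *v v) \<circ> (\<lambda>v. jac \<alpha> \<beta> q *v v)) (at (snd \<alpha> q))"
  proof (rule has_derivative_transform_within_open)
    show "open (snd \<alpha> ` (fst \<alpha> \<inter> fst \<beta>))" "snd \<alpha> q \<in> snd \<alpha> ` (fst \<alpha> \<inter> fst \<beta>)"
      using chart_overlap_open[OF A(1-3)] q by auto
    show "(snd \<gamma> \<circ> chart_inv \<beta> \<circ> (snd \<beta> \<circ> chart_inv \<alpha>)) u = (snd \<gamma> \<circ> chart_inv \<alpha>) u"
      if "u \<in> snd \<alpha> ` (fst \<alpha> \<inter> fst \<beta>)" for u
      using that chart_inv_left[OF A(1,2)] chart_inv_left[OF A(1,3)] by auto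
  qed
  have "jac \<beta> \<gamma> q *v (jac \<alpha> \<beta> q *v v) = jac \<alpha> \<gamma> q *v v" for v
    using fun_cong[OF has_derivative_unique[OF 1 transition_has_derivative[OF A(1,2,4) q(1,3)]], of v]
    by simp
  then show ?thesis
    unfolding matrix_eq by (simp add: matrix_vector_mul_assoc)
qed

lemma jac_chain_sum:
  assumes A: "smooth_atlas A" "\<alpha> \<in> A" "\<beta> \<in> A" "\<gamma> \<in> A"
    and q: "q \<in> fst \<alpha>" "q \<in> fst \<beta>" "q \<in> fst \<gamma>"
  shows "(\<Sum>j\<in>UNIV. jac \<beta> \<gamma> q $ i $ j * jac \<alpha> \<beta> q $ j $ k) = jac \<alpha> \<gamma> q $ i $ k"
  unfolding jac_chain[OF assms, symmetric] by (simp add: matrix_matrix_mult_def)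

lemma jac_self:
  assumes A: "smooth_atlas A" "\<alpha> \<in> A" and q: "q \<in> fst \<alpha>"
  shows "jac \<alpha> \<alpha> q = mat 1"
proof -
  have "((\<lambda>u. u) has_derivative (\<lambda>v. v)) (at (snd \<alpha> q))"
    by (rule has_derivative_ident)
  then have 1: "(snd \<alpha> \<circ> chart_inv \<alpha> has_derivative (\<lambda>v. v)) (at (snd \<alpha> q))"
    by (rule has_derivative_transform_within_open[OF _ chart_image_open[OF A]])
       (use q chart_inv_left[OF A] in auto)
  have "v = jac \<alpha> \<alpha> q *v v" for v
    by (rule fun_cong[OF has_derivative_unique[OF 1 transition_has_derivative[OF A A(2) q q]]])
  then show ?thesis
    unfolding matrix_eq by simp
qed

lemma smooth_jac:
  assumes A: "smooth_atlas A" "\<alpha> \<in> A" "\<beta> \<in> A"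
  shows "smooth_on (snd \<alpha> ` (fst \<alpha> \<inter> fst \<beta>)) (\<lambda>u. jac \<alpha> \<beta> (chart_inv \<alpha> u) $ i $ j)"
proof -
  let ?U = "snd \<alpha> ` (fst \<alpha> \<inter> fst \<beta>)"
  have "smooth_on ?U (\<lambda>u. frechet_derivative (snd \<beta> \<circ> chart_inv \<alpha>) (at u) (axis j 1) $ i)"
    by (rule smooth_on_bounded_linear_compose[OF chart_overlap_open[OF A] bounded_linear_vec_nth
          smooth_on_frechet_derivative[OF transition_smooth[OF A]]])
  then show ?thesis
    by (rule smooth_on_cong_open[OF chart_overlap_open[OF A], rotated])
       (auto simp: jac_def matrix_def chart_inv_left[OF A(1,2)])
qed

text \<open>The backward Jacobian is smooth in \<beta>-coordinates by \<open>smooth_jac\<close>;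
  composing with the transition map expresses it in \<alpha>-coordinates without inverting a
  matrix.\<close>

lemma smooth_jac_inverse:
  assumes A: "smooth_atlas A" "\<alpha> \<in> A" "\<beta> \<in> A"
  shows "smooth_on (snd \<alpha> ` (fst \<alpha> \<inter> fst \<beta>)) (\<lambda>u. jac \<beta> \<alpha> (chart_inv \<alpha> u) $ i $ j)"
proof -
  let ?U = "snd \<alpha> ` (fst \<alpha> \<inter> fst \<beta>)" and ?V = "snd \<beta> ` (fst \<beta> \<inter> fst \<alpha>)"
  have "smooth_on ?U ((\<lambda>u. jac \<beta> \<alpha> (chart_inv \<beta> u) $ i $ j) \<circ> (snd \<beta> \<circ> chart_inv \<alpha>))"
    by (rule smooth_on_compose[OF chart_overlap_open[OF A] chart_overlap_open[OF A(1,3,2)] _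
          smooth_jac[OF A(1,3,2)] transition_smooth[OF A]])
       (use chart_inv_left[OF A(1,2)] in auto)
  then show ?thesis
    by (rule smooth_on_cong_open[OF chart_overlap_open[OF A], rotated])
       (auto simp: chart_inv_left[OF A(1,2)] chart_inv_left[OF A(1,3)])
qed


section \<open>Coordinates of the dual jet bundle\<close>

text \<open>The point over \<open>(t, x)\<close> with fibre coordinates \<open>p\<close> in the
  chart \<open>K\<close>: its coordinates in the other charts around the base point are forced by
  the transformation rule, and the remaining ones by the convention 0. It witnesses that the fibres
  are full vector spaces.\<close>

definition jet_pt :: "('t, 'm::finite, 'x, 'n::finite) jet_data \<Rightarrow> ('t, 'm, 'x, 'n) jchart \<Rightarrow>
    't \<Rightarrow> 'x \<Rightarrow> real ^ 'm ^ 'n \<Rightarrow> ('t, 'm, 'x, 'n) jpoint" where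
  "jet_pt G K t x p = (t, x, \<lambda>(\<alpha>', \<beta>').
     if (\<alpha>', \<beta>') \<in> jcharts G \<and> t \<in> fst \<alpha>' \<and> x \<in> fst \<beta>'
     then \<chi> i a. \<Sum>j\<in>UNIV. \<Sum>b\<in>UNIV. jac \<beta>' (snd K) x $ j $ i * jac (fst K) \<alpha>' t $ a $ b * p $ j $ b
     else 0)"

lemma sum3_swap:
  "(\<Sum>c\<in>B. \<Sum>j\<in>C. \<Sum>b\<in>D. f c j b) = (\<Sum>j\<in>C. \<Sum>b\<in>D. \<Sum>c\<in>B. f c j b)"
  by (subst sum.swap, rule sum.cong[OF refl], rule sum.swap)

lemma sum4_swap:
  "(\<Sum>k\<in>A. \<Sum>c\<in>B. \<Sum>j\<in>C. \<Sum>b\<in>D. f k c j b) = (\<Sum>j\<in>C. \<Sum>b\<in>D. \<Sum>k\<in>A. \<Sum>c\<in>B. f k c j b)"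
  by (subst sum3_swap) (rule sum3_swap)

text \<open>Transforming through an intermediate chart multiplies Jacobians; with the chain rule
  this makes the family in \<open>jet_pt\<close> consistent.\<close>

lemma fibre_cocycle:
  fixes B :: "'n::finite \<Rightarrow> real" and A :: "'m::finite \<Rightarrow> real"
    and B' :: "'k::finite \<Rightarrow> 'n \<Rightarrow> real" and A' :: "'m \<Rightarrow> 'l::finite \<Rightarrow> real"
  shows "(\<Sum>k\<in>UNIV. \<Sum>c\<in>UNIV. B k * A c * (\<Sum>j\<in>UNIV. \<Sum>b\<in>UNIV. B' j k * A' c b * p j b)) =
         (\<Sum>j\<in>UNIV. \<Sum>b\<in>UNIV. (\<Sum>k\<in>UNIV. B' j k * B k) * (\<Sum>c\<in>UNIV. A c * A' c b) * p j b)"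
proof -
  have "(\<Sum>k\<in>UNIV. \<Sum>c\<in>UNIV. B k * A c * (\<Sum>j\<in>UNIV. \<Sum>b\<in>UNIV. B' j k * A' c b * p j b)) =
        (\<Sum>k\<in>UNIV. \<Sum>c\<in>UNIV. \<Sum>j\<in>UNIV. \<Sum>b\<in>UNIV. (B' j k * B k) * (A c * A' c b) * p j b)"
    by (simp add: sum_distrib_left algebra_simps)
  also have "\<dots> = (\<Sum>j\<in>UNIV. \<Sum>b\<in>UNIV. \<Sum>k\<in>UNIV. \<Sum>c\<in>UNIV. (B' j k * B k) * (A c * A' c b) * p j b)"
    by (rule sum4_swap)
  also have "\<dots> = (\<Sum>j\<in>UNIV. \<Sum>b\<in>UNIV. (\<Sum>k\<in>UNIV. B' j k * B k) * (\<Sum>c\<in>UNIV. A c * A' c b) * p j b)"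
    by (simp only: sum_product) (simp only: sum_distrib_right)
  finally show ?thesis .
qed

lemma sum_mat1:
  fixes p :: "'n::finite \<Rightarrow> 'm::finite \<Rightarrow> real"
  shows "(\<Sum>j\<in>UNIV. \<Sum>b\<in>UNIV. mat 1 $ j $ i * mat 1 $ a $ b * p j b) = p i a"
proof -
  have "(\<Sum>b\<in>UNIV. mat 1 $ j $ i * mat 1 $ a $ b * p j b) = (if j = i then p j a else 0)" for j
    by (simp add: mat_def if_distrib[where f="\<lambda>x. x * _"] cong: if_cong)
  then show ?thesis by simp
qed

locale jet_bundle =
  fixes G :: "('t::topological_space, 'm::finite, 'x::topological_space, 'n::finite) jet_data"
  assumes T_atlas: "smooth_atlas (T_atlas G)" and M_atlas: "smooth_atlas (M_atlas G)"
begin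

lemma jchartsD: "K \<in> jcharts G \<Longrightarrow> fst K \<in> T_atlas G" "K \<in> jcharts G \<Longrightarrow> snd K \<in> M_atlas G"
  unfolding jcharts_def by auto

lemma jet_pt_in_jet_space:
  assumes K: "K \<in> jcharts G" and t: "t \<in> fst (fst K)" and x: "x \<in> fst (snd K)"
  shows "jet_pt G K t x p \<in> jet_space G"
proof -
  note c = jchartsD[OF K]
  have "(\<Sum>j\<in>UNIV. \<Sum>b\<in>UNIV. jac \<beta>'' (snd K) x $ j $ i * jac (fst K) \<alpha>'' t $ a $ b * p $ j $ b) =
        (\<Sum>k\<in>UNIV. \<Sum>c\<in>UNIV. jac \<beta>'' \<beta>' x $ k $ i * jac \<alpha>' \<alpha>'' t $ a $ c *
          (\<Sum>j\<in>UNIV. \<Sum>b\<in>UNIV. jac \<beta>' (snd K) x $ j $ k * jac (fst K) \<alpha>' t $ c $ b * p $ j $ b))"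
    if K': "(\<alpha>', \<beta>') \<in> jcharts G" and K'': "(\<alpha>'', \<beta>'') \<in> jcharts G"
    and t': "t \<in> fst \<alpha>'" "t \<in> fst \<alpha>''" and x': "x \<in> fst \<beta>'" "x \<in> fst \<beta>''"
    for \<alpha>' \<beta>' \<alpha>'' \<beta>'' i a
  proof -
    note c' = jchartsD[OF K', simplified] jchartsD[OF K'', simplified]
    have 1: "jac \<beta>'' (snd K) x $ j $ i = (\<Sum>k\<in>UNIV. jac \<beta>' (snd K) x $ j $ k * jac \<beta>'' \<beta>' x $ k $ i)" for j
      using c c' x x' by (intro jac_chain_sum[OF M_atlas, symmetric]) auto
    have 2: "jac (fst K) \<alpha>'' t $ a $ b = (\<Sum>c\<in>UNIV. jac \<alpha>' \<alpha>'' t $ a $ c * jac (fst K) \<alpha>' t $ c $ b)" for b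
      using c c' t t' by (intro jac_chain_sum[OF T_atlas, symmetric]) auto
    show ?thesis
      unfolding 1 2 by (rule fibre_cocycle[symmetric])
  qed
  note transition = this
  show ?thesis
    by (auto simp: jet_space_def jet_pt_def intro!: transition)
qed

lemma coords_jet_pt:
  assumes K: "K \<in> jcharts G" and t: "t \<in> fst (fst K)" and x: "x \<in> fst (snd K)"
  shows "coords K (jet_pt G K t x p) = (snd (fst K) t, snd (snd K) x, p)"
proof -
  have "jac (snd K) (snd K) x = mat 1" "jac (fst K) (fst K) t = mat 1"
    using jac_self[OF T_atlas] jac_self[OF M_atlas] jchartsD[OF K] t x by auto
  then have "snd (snd (jet_pt G K t x p)) K $ i $ a = p $ i $ a" for i a
    using K t x
    by (cases K) (simp add: jet_pt_def sum_mat1)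
  then show ?thesis
    by (simp add: coords_def jet_pt_def vec_eq_iff)
qed

lemma jdomD:
  assumes "e \<in> jdom G K"
  shows "e \<in> jet_space G" "fst e \<in> fst (fst K)" "fst (snd e) \<in> fst (snd K)"
  using assms by (auto simp: jdom_def)

lemma jet_pt_in_jdom:
  assumes "K \<in> jcharts G" "K' \<in> jcharts G" "t \<in> fst (fst K) \<inter> fst (fst K')" "x \<in> fst (snd K) \<inter> fst (snd K')"
  shows "jet_pt G K t x p \<in> jdom G K'"
proof -
  have "fst (jet_pt G K t x p) = t" "fst (snd (jet_pt G K t x p)) = x"
    by (simp_all add: jet_pt_def)
  then show ?thesis
    using assms jet_pt_in_jet_space[of K t x p] by (simp add: jdom_def)
qed

lemma fibre_transition:
  assumes K: "K \<in> jcharts G" "K' \<in> jcharts G" and e: "e \<in> jdom G K" "e \<in> jdom G K'"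
  shows "snd (snd e) K' $ i $ a = (\<Sum>j\<in>UNIV. \<Sum>b\<in>UNIV.
    jac (snd K') (snd K) (fst (snd e)) $ j $ i * jac (fst K) (fst K') (fst e) $ a $ b * snd (snd e) K $ j $ b)"
proof -
  obtain \<alpha> \<beta> \<alpha>' \<beta>' t x p where [simp]: "K = (\<alpha>, \<beta>)" "K' = (\<alpha>', \<beta>')" "e = (t, x, p)"
    by (cases K, cases K', cases e) auto
  have *: "\<forall>(\<alpha>, \<beta>)\<in>jcharts G. \<forall>(\<alpha>', \<beta>')\<in>jcharts G.
        t \<in> fst \<alpha> \<inter> fst \<alpha>' \<and> x \<in> fst \<beta> \<inter> fst \<beta>' \<longrightarrow>
        (\<forall>i a. p (\<alpha>', \<beta>') $ i $ a =
           (\<Sum>j\<in>UNIV. \<Sum>b\<in>UNIV. jac \<beta>' \<beta> x $ j $ i * jac \<alpha> \<alpha>' t $ a $ b * p (\<alpha>, \<beta>) $ j $ b))"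
    using jdomD(1)[OF e(1)] unfolding jet_space_def by simp
  show ?thesis
    using bspec[OF bspec[OF *, of K, OF K(1), simplified] K(2)] jdomD[OF e(1)] jdomD[OF e(2)] by simp
qed

text \<open>A point is a whole family of fibre coordinates, so equality has to be checked in every
  chart. Around the common base point the transformation rule determines the family from its value
  at \<open>K\<close>; elsewhere it is 0 by convention.\<close>

lemma coords_inject:
  assumes K: "K \<in> jcharts G" and e: "e \<in> jdom G K" "e' \<in> jdom G K" and eq: "coords K e = coords K e'"
  shows "e = e'"
proof -
  have t: "fst e = fst e'" and x: "fst (snd e) = fst (snd e')" and p: "snd (snd e) K = snd (snd e') K"
    using eq jdomD[OF e(1)] jdomD[OF e(2)] chart_inv_left[OF T_atlas jchartsD(1)[OF K]]
      chart_inv_left[OF M_atlas jchartsD(2)[OF K]]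
    by (auto simp: coords_def) metis+
  have "snd (snd e) K' = snd (snd e') K'" for K'
  proof (cases "K' \<in> jcharts G \<and> fst e \<in> fst (fst K') \<and> fst (snd e) \<in> fst (snd K')")
    case True
    then have "e \<in> jdom G K'" "e' \<in> jdom G K'"
      using jdomD(1)[OF e(1)] jdomD(1)[OF e(2)] t x by (auto simp: jdom_def)
    then show ?thesis
      using fibre_transition[OF K _ e(1)] fibre_transition[OF K _ e(2)] True t x p
      by (simp add: vec_eq_iff)
  next
    case False
    have "snd (snd f) K' = 0" if "f \<in> jet_space G" "fst f = fst e" "fst (snd f) = fst (snd e)" for f
      using that False unfolding jet_space_def by (cases K') force
    from this[of e] this[of e'] show ?thesis
      using jdomD(1)[OF e(1)] jdomD(1)[OF e(2)] t x by simp
  qed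
  with t x show ?thesis
    by (metis ext prod.collapse)
qed

lemma coords_inv_coords: "K \<in> jcharts G \<Longrightarrow> e \<in> jdom G K \<Longrightarrow> coords_inv G K (coords K e) = e"
  unfolding coords_inv_def by (rule inv_into_f_f[OF inj_onI[OF coords_inject]])

text \<open>The inclusion from right to left rests on \<open>jet_pt\<close>, which realizes every
  fibre coordinate over every base point of the overlap.\<close>

lemma coords_image:
  assumes K: "K \<in> jcharts G" "K' \<in> jcharts G"
  shows "coords K ` (jdom G K \<inter> jdom G K') =
    (snd (fst K) ` (fst (fst K) \<inter> fst (fst K'))) \<times> (snd (snd K) ` (fst (snd K) \<inter> fst (snd K'))) \<times> UNIV"
    (is "?L = ?R")
proof
  show "?L \<subseteq> ?R"
  proof (rule image_subsetI)
    fix e assume "e \<in> jdom G K \<inter> jdom G K'"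
    then show "coords K e \<in> ?R"
      using jdomD[of e K] jdomD[of e K'] by (simp add: coords_def)
  qed
  show "?R \<subseteq> ?L"
  proof clarify
    fix t x p assume t: "t \<in> fst (fst K)" "t \<in> fst (fst K')" and x: "x \<in> fst (snd K)" "x \<in> fst (snd K')"
    have "jet_pt G K t x p \<in> jdom G K \<inter> jdom G K'"
      using jet_pt_in_jdom[OF K(1)] K t x by auto
    then show "(snd (fst K) t, snd (snd K) x, p) \<in> ?L"
      using coords_jet_pt[OF K(1) t(1) x(1)] by (metis imageI)
  qed
qed

lemma jet_open_jdom:
  assumes "K \<in> jcharts G" shows "jet_open G (jdom G K)"
  unfolding jet_open_def
proof (intro conjI ballI)
  show "jdom G K \<subseteq> jet_space G"
    using jdomD(1) by blast
  fix K' assume K': "K' \<in> jcharts G"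
  show "open (coords K' ` (jdom G K \<inter> jdom G K'))"
    unfolding Int_commute[of "jdom G K"] coords_image[OF K' assms]
    by (intro open_Times open_UNIV chart_overlap_open[OF T_atlas] chart_overlap_open[OF M_atlas]
        jchartsD assms K')
qed

lemma jet_open_Int:
  assumes "jet_open G V" "jet_open G W" shows "jet_open G (V \<inter> W)"
proof -
  have "coords K ` (V \<inter> W \<inter> jdom G K) = coords K ` (V \<inter> jdom G K) \<inter> coords K ` (W \<inter> jdom G K)"
    if "K \<in> jcharts G" for K
    using coords_inject[OF that] by blast
  then show ?thesis
    using assms unfolding jet_open_def by auto
qed

lemma coords_open: "K \<in> jcharts G \<Longrightarrow> jet_open G V \<Longrightarrow> V \<subseteq> jdom G K \<Longrightarrow> open (coords K ` V)"
  unfolding jet_open_def by (metis inf.absorb1)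

lemma coords_open': "K \<in> jcharts G \<Longrightarrow> jet_open G V \<Longrightarrow> open (coords K ` (V \<inter> jdom G K))"
  unfolding jet_open_def by blast

section \<open>Smoothness of the induced coordinate changes\<close>

lemma smooth_on_fst:
  fixes f :: "'a::euclidean_space \<Rightarrow> real" and S :: "('a \<times> 'b::euclidean_space) set"
  assumes "open S" "open U" "fst ` S \<subseteq> U" "smooth_on U f"
  shows "smooth_on S (\<lambda>z. f (fst z))"
  using smooth_on_compose[OF assms(1-4) smooth_on_linear[OF bounded_linear_fst]] by (simp add: o_def)

lemma smooth_on_fst_snd:
  fixes f :: "'b::euclidean_space \<Rightarrow> real" and S :: "('a::euclidean_space \<times> 'b \<times> 'c::euclidean_space) set"
  assumes "open S" "open U" "(\<lambda>z. fst (snd z)) ` S \<subseteq> U" "smooth_on U f"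
  shows "smooth_on S (\<lambda>z. f (fst (snd z)))"
  using smooth_on_compose[OF assms(1-4) smooth_on_linear[OF bounded_linear_fst_comp[OF bounded_linear_snd]]]
  by (simp add: o_def)

lemma coords_inv_parts:
  assumes K: "K \<in> jcharts G" and z: "z \<in> coords K ` jdom G K"
  shows "fst (coords_inv G K z) = chart_inv (fst K) (fst z)"
    "fst (snd (coords_inv G K z)) = chart_inv (snd K) (fst (snd z))"
    "snd (snd (coords_inv G K z)) K = snd (snd z)"
proof -
  obtain e where e: "e \<in> jdom G K" "z = coords K e"
    using z by blast
  show "fst (coords_inv G K z) = chart_inv (fst K) (fst z)"
    "fst (snd (coords_inv G K z)) = chart_inv (snd K) (fst (snd z))"
    "snd (snd (coords_inv G K z)) K = snd (snd z)"
    unfolding e(2) coords_inv_coords[OF K e(1)]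
    by (simp_all add: coords_def chart_inv_left[OF T_atlas jchartsD(1)[OF K] jdomD(2)[OF e(1)]]
        chart_inv_left[OF M_atlas jchartsD(2)[OF K] jdomD(3)[OF e(1)]])
qed

text \<open>The base parts are transition maps of the two atlases. The fibre part is linear in
  \<open>p\<close>, with Jacobian entries depending on the base point as coefficients, hence a sum
  of products of smooth functions.\<close>

lemma coords_transition_smooth:
  assumes K: "K \<in> jcharts G" "K' \<in> jcharts G"
  shows "smooth_on (coords K ` (jdom G K \<inter> jdom G K')) (\<lambda>z. coords K' (coords_inv G K z))"
    (is "smooth_on ?S ?f")
proof -
  have oS: "open ?S"
    using K by (intro coords_open jet_open_Int jet_open_jdom) auto
  let ?T = "snd (fst K) ` (fst (fst K) \<inter> fst (fst K'))"
    and ?X = "snd (snd K) ` (fst (snd K) \<inter> fst (snd K'))"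
  note c = jchartsD[OF K(1)] jchartsD[OF K(2)]
  have oT: "open ?T" and oX: "open ?X"
    using c chart_overlap_open T_atlas M_atlas by blast+
  have sub: "fst ` ?S \<subseteq> ?T" "(\<lambda>z. fst (snd z)) ` ?S \<subseteq> ?X"
    unfolding coords_image[OF K] by auto
  have parts: "fst (?f z) = snd (fst K') (chart_inv (fst K) (fst z))"
    "fst (snd (?f z)) = snd (snd K') (chart_inv (snd K) (fst (snd z)))"
    "snd (snd (?f z)) $ i $ a = (\<Sum>j\<in>UNIV. \<Sum>b\<in>UNIV.
        jac (snd K') (snd K) (chart_inv (snd K) (fst (snd z))) $ j $ i *
        jac (fst K) (fst K') (chart_inv (fst K) (fst z)) $ a $ b * snd (snd z) $ j $ b)"
    if "z \<in> ?S" for z i a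
  proof -
    have z: "z \<in> coords K ` jdom G K" and dom: "coords_inv G K z \<in> jdom G K" "coords_inv G K z \<in> jdom G K'"
      using that by (auto simp: coords_inv_coords[OF K(1)])
    show "fst (?f z) = snd (fst K') (chart_inv (fst K) (fst z))"
      "fst (snd (?f z)) = snd (snd K') (chart_inv (snd K) (fst (snd z)))"
      unfolding coords_inv_parts[OF K(1) z, symmetric] by (simp_all add: coords_def)
    have "snd (snd (?f z)) $ i $ a = snd (snd (coords_inv G K z)) K' $ i $ a"
      by (simp add: coords_def)
    also note fibre_transition[OF K dom]
    finally show "snd (snd (?f z)) $ i $ a = (\<Sum>j\<in>UNIV. \<Sum>b\<in>UNIV.
        jac (snd K') (snd K) (chart_inv (snd K) (fst (snd z))) $ j $ i *
        jac (fst K) (fst K') (chart_inv (fst K) (fst z)) $ a $ b * snd (snd z) $ j $ b)"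
      unfolding coords_inv_parts[OF K(1) z] .
  qed
  have comp_t: "smooth_on ?S (\<lambda>z. fst (?f z) $ a)" for a
  proof (rule smooth_on_cong_open[OF oS])
    show "smooth_on ?S (\<lambda>z. snd (fst K') (chart_inv (fst K) (fst z)) $ a)"
      using transition_smooth[OF T_atlas c(1,3)]
      unfolding o_def
      by (rule smooth_on_fst[OF oS oT sub(1)
            smooth_on_bounded_linear_compose[OF oT bounded_linear_vec_nth]])
  qed (simp add: parts)
  have comp_x: "smooth_on ?S (\<lambda>z. fst (snd (?f z)) $ i)" for i
  proof (rule smooth_on_cong_open[OF oS])
    show "smooth_on ?S (\<lambda>z. snd (snd K') (chart_inv (snd K) (fst (snd z))) $ i)"
      using transition_smooth[OF M_atlas c(2,4)]
      unfolding o_def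
      by (rule smooth_on_fst_snd[OF oS oX sub(2)
            smooth_on_bounded_linear_compose[OF oX bounded_linear_vec_nth]])
  qed (simp add: parts)
  have comp_p: "smooth_on ?S (\<lambda>z. snd (snd (?f z)) $ i $ a)" for i a
  proof (rule smooth_on_cong_open[OF oS])
    show "smooth_on ?S (\<lambda>z. \<Sum>j\<in>UNIV. \<Sum>b\<in>UNIV.
        jac (snd K') (snd K) (chart_inv (snd K) (fst (snd z))) $ j $ i *
        jac (fst K) (fst K') (chart_inv (fst K) (fst z)) $ a $ b * snd (snd z) $ j $ b)"
    proof (intro smooth_on_sum[OF oS] smooth_on_mult[OF oS])
      fix j b
      show "smooth_on ?S (\<lambda>z. jac (snd K') (snd K) (chart_inv (snd K) (fst (snd z))) $ j $ i)"
        by (rule smooth_on_fst_snd[OF oS oX sub(2) smooth_jac_inverse[OF M_atlas c(2,4)]])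
      show "smooth_on ?S (\<lambda>z. jac (fst K) (fst K') (chart_inv (fst K) (fst z)) $ a $ b)"
        by (rule smooth_on_fst[OF oS oT sub(1) smooth_jac[OF T_atlas c(1,3)]])
      show "smooth_on ?S (\<lambda>z. snd (snd z) $ j $ b)"
        by (intro smooth_on_linear bounded_linear_compose[OF bounded_linear_vec_nth]
            bounded_linear_snd_comp bounded_linear_snd)
    qed
  qed (simp add: parts)
  show ?thesis
  proof (rule smooth_on_componentwise[OF oS])
    fix b :: "(real ^ 'm) \<times> (real ^ 'n) \<times> (real ^ 'm ^ 'n)"
    assume "b \<in> Basis"
    \<comment> \<open>The standard basis of the product space falls into three kinds, matching the
      three kinds of coordinates.\<close>
    then consider a where "b = (axis a 1, 0, 0)" | i where "b = (0, axis i 1, 0)"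
      | i a where "b = (0, 0, axis i (axis a 1))"
      by (auto simp: Basis_prod_def Basis_vec_def zero_prod_def)
    then show "smooth_on ?S (\<lambda>z. ?f z \<bullet> b)"
      by cases (simp_all add: inner_prod_def inner_axis comp_t comp_x comp_p)
  qed
qed

end


section \<open>Smooth functions on the bundle\<close>

context jet_bundle
begin

lemma coords_inv_image:
  assumes "K \<in> jcharts G" "V \<subseteq> jdom G K" "z \<in> coords K ` V"
  shows "coords_inv G K z \<in> V" "coords K (coords_inv G K z) = z"
proof -
  obtain e where "e \<in> V" "z = coords K e" using assms(3) by blast
  then show "coords_inv G K z \<in> V" "coords K (coords_inv G K z) = z"
    using coords_inv_coords[OF assms(1), of e] assms(2) by auto
qed

lemma smooth_funsD:
  assumes "f \<in> smooth_funs G V" "K \<in> jcharts G" "V \<subseteq> jdom G K"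
  shows "smooth_on (coords K ` V) (f \<circ> coords_inv G K)"
proof -
  have "V \<inter> jdom G K = V" using assms(3) by blast
  then show ?thesis
    using assms(1,2) unfolding smooth_funs_def by fastforce
qed

text \<open>Any other chart sees \<open>f\<close> through its transition map to \<open>K\<close>,
  which is smooth; so a single chart whose domain contains \<open>V\<close> decides.\<close>

lemma smooth_funsI:
  assumes V: "jet_open G V" "V \<subseteq> jdom G K" and K: "K \<in> jcharts G"
    and f: "smooth_on (coords K ` V) (f \<circ> coords_inv G K)"
  shows "f \<in> smooth_funs G V"
  unfolding smooth_funs_def mem_Collect_eq
proof
  fix K' assume K': "K' \<in> jcharts G"
  let ?S = "coords K' ` (V \<inter> jdom G K')" and ?\<phi> = "\<lambda>z. coords K (coords_inv G K' z)"
  have oS: "open ?S" by (rule coords_open'[OF K' V(1)])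
  have sub: "?S \<subseteq> coords K' ` (jdom G K' \<inter> jdom G K)"
    using V(2) by blast
  have im: "?\<phi> ` ?S \<subseteq> coords K ` V"
    using coords_inv_coords[OF K'] by auto
  have "smooth_on ?S ((f \<circ> coords_inv G K) \<circ> ?\<phi>)"
    by (rule smooth_on_compose[OF oS coords_open[OF K V] im f
          smooth_on_subset[OF coords_transition_smooth[OF K' K] sub]])
  then show "smooth_on ?S (f \<circ> coords_inv G K')"
  proof (rule smooth_on_cong_open[OF oS, rotated])
    fix z assume "z \<in> ?S"
    then obtain e where "e \<in> V" "e \<in> jdom G K'" "z = coords K' e" by blast
    then show "(f \<circ> coords_inv G K \<circ> ?\<phi>) z = (f \<circ> coords_inv G K') z"
      using coords_inv_coords[OF K', of e] coords_inv_coords[OF K, of e] V(2) by auto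
  qed
qed

lemma smooth_funs_subset: "f \<in> smooth_funs G W \<Longrightarrow> V \<subseteq> W \<Longrightarrow> f \<in> smooth_funs G V"
  unfolding smooth_funs_def mem_Collect_eq
  by (intro ballI, drule (1) bspec, erule smooth_on_subset) blast

lemma smooth_funs_cong:
  assumes V: "jet_open G V" and eq: "\<And>e. e \<in> V \<Longrightarrow> f e = g e" and f: "f \<in> smooth_funs G V"
  shows "g \<in> smooth_funs G V"
  unfolding smooth_funs_def mem_Collect_eq
proof
  fix K assume K: "K \<in> jcharts G"
  have "smooth_on (coords K ` (V \<inter> jdom G K)) (f \<circ> coords_inv G K)"
    using f K unfolding smooth_funs_def by blast
  then show "smooth_on (coords K ` (V \<inter> jdom G K)) (g \<circ> coords_inv G K)"
    by (rule smooth_on_cong_open[OF coords_open'[OF K V], rotated])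
       (use eq coords_inv_coords[OF K] in auto)
qed

lemma smooth_funs_const: "(\<lambda>e. c) \<in> smooth_funs G V"
  unfolding smooth_funs_def by (simp add: o_def smooth_on_const)

lemma smooth_funs_add:
  "jet_open G V \<Longrightarrow> f \<in> smooth_funs G V \<Longrightarrow> g \<in> smooth_funs G V \<Longrightarrow> (\<lambda>e. f e + g e) \<in> smooth_funs G V"
  unfolding smooth_funs_def by (auto simp: o_def intro!: smooth_on_add coords_open')

lemma smooth_funs_mult:
  "jet_open G V \<Longrightarrow> f \<in> smooth_funs G V \<Longrightarrow> g \<in> smooth_funs G V \<Longrightarrow> (\<lambda>e. f e * g e) \<in> smooth_funs G V"
  unfolding smooth_funs_def by (auto simp: o_def intro!: smooth_on_mult coords_open')

lemma smooth_funs_sum: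
  "jet_open G V \<Longrightarrow> (\<And>s. s \<in> A \<Longrightarrow> f s \<in> smooth_funs G V) \<Longrightarrow> (\<lambda>e. \<Sum>s\<in>A. f s e) \<in> smooth_funs G V"
  unfolding smooth_funs_def by (auto simp: o_def intro!: smooth_on_sum coords_open')

lemma smooth_funs_cmult:
  "jet_open G V \<Longrightarrow> f \<in> smooth_funs G V \<Longrightarrow> (\<lambda>e. c * f e) \<in> smooth_funs G V"
  by (rule smooth_funs_mult[OF _ smooth_funs_const])

lemma smooth_funs_minus:
  "jet_open G V \<Longrightarrow> f \<in> smooth_funs G V \<Longrightarrow> (\<lambda>e. - f e) \<in> smooth_funs G V"
  using smooth_funs_cmult[of V f "- 1"] by simp

lemma smooth_funs_diff:
  "jet_open G V \<Longrightarrow> f \<in> smooth_funs G V \<Longrightarrow> g \<in> smooth_funs G V \<Longrightarrow> (\<lambda>e. f e - g e) \<in> smooth_funs G V"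
  using smooth_funs_add[of V f "\<lambda>e. - g e"] smooth_funs_minus[of V g] by simp


section \<open>Vector fields as derivations\<close>

lemma vector_fieldsI:
  assumes "\<And>V f. jet_open G V \<Longrightarrow> V \<subseteq> W \<Longrightarrow> f \<in> smooth_funs G V \<Longrightarrow> X f \<in> smooth_funs G V"
    and "\<And>V f g e. jet_open G V \<Longrightarrow> V \<subseteq> W \<Longrightarrow> f \<in> smooth_funs G V \<Longrightarrow> g \<in> smooth_funs G V \<Longrightarrow>
      (\<And>e. e \<in> V \<Longrightarrow> f e = g e) \<Longrightarrow> e \<in> V \<Longrightarrow> X f e = X g e"
    and "\<And>V f g e. jet_open G V \<Longrightarrow> V \<subseteq> W \<Longrightarrow> f \<in> smooth_funs G V \<Longrightarrow> g \<in> smooth_funs G V \<Longrightarrow>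
      e \<in> V \<Longrightarrow> X (\<lambda>y. f y + g y) e = X f e + X g e"
    and "\<And>V f r e. jet_open G V \<Longrightarrow> V \<subseteq> W \<Longrightarrow> f \<in> smooth_funs G V \<Longrightarrow>
      e \<in> V \<Longrightarrow> X (\<lambda>y. r * f y) e = r * X f e"
    and "\<And>V f g e. jet_open G V \<Longrightarrow> V \<subseteq> W \<Longrightarrow> f \<in> smooth_funs G V \<Longrightarrow> g \<in> smooth_funs G V \<Longrightarrow>
      e \<in> V \<Longrightarrow> X (\<lambda>y. f y * g y) e = X f e * g e + f e * X g e"
  shows "X \<in> vector_fields G W"
  unfolding vector_fields_def mem_Collect_eq
proof (intro allI impI, elim conjE, intro conjI ballI allI impI)
  fix V f assume V: "jet_open G V" "V \<subseteq> W" and f: "f \<in> smooth_funs G V"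
  show "X f \<in> smooth_funs G V" by (rule assms(1)[OF V f])
  fix e assume e: "e \<in> V"
  show "X (\<lambda>y. r * f y) e = r * X f e" for r by (rule assms(4)[OF V f e])
  fix g assume g: "g \<in> smooth_funs G V"
  show "X f e = X g e" if "\<forall>e\<in>V. f e = g e" by (rule assms(2)[OF V f g bspec[OF that] e])
  show "X (\<lambda>y. f y + g y) e = X f e + X g e" by (rule assms(3)[OF V f g e])
  show "X (\<lambda>y. f y * g y) e = X f e * g e + f e * X g e" by (rule assms(5)[OF V f g e])
qed

lemma vector_fields_subset: "X \<in> vector_fields G W \<Longrightarrow> V \<subseteq> W \<Longrightarrow> X \<in> vector_fields G V"
  unfolding vector_fields_def mem_Collect_eq
  by (intro allI impI, drule spec, erule mp) blast

lemma vector_fieldsD: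
  assumes "X \<in> vector_fields G V" "jet_open G V"
  shows "(\<forall>f\<in>smooth_funs G V. X f \<in> smooth_funs G V) \<and>
     (\<forall>f\<in>smooth_funs G V. \<forall>g\<in>smooth_funs G V. (\<forall>e\<in>V. f e = g e) \<longrightarrow> (\<forall>e\<in>V. X f e = X g e)) \<and>
     (\<forall>f\<in>smooth_funs G V. \<forall>g\<in>smooth_funs G V. \<forall>e\<in>V. X (\<lambda>y. f y + g y) e = X f e + X g e) \<and>
     (\<forall>r. \<forall>f\<in>smooth_funs G V. \<forall>e\<in>V. X (\<lambda>y. r * f y) e = r * X f e) \<and>
     (\<forall>f\<in>smooth_funs G V. \<forall>g\<in>smooth_funs G V. \<forall>e\<in>V.
        X (\<lambda>y. f y * g y) e = X f e * g e + f e * X g e)"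
  using assms(1) unfolding vector_fields_def mem_Collect_eq
  by (elim allE[of _ V], elim mp) (simp add: assms(2))

lemma vf_smooth:
  assumes "X \<in> vector_fields G V" "jet_open G V" "f \<in> smooth_funs G V" shows "X f \<in> smooth_funs G V"
  by (rule vector_fieldsD[OF assms(1,2), THEN conjunct1, THEN bspec, OF assms(3)])

lemma vf_cong:
  assumes "X \<in> vector_fields G V" "jet_open G V" "f \<in> smooth_funs G V"
    and "\<And>e. e \<in> V \<Longrightarrow> f e = g e" "e \<in> V"
  shows "X f e = X g e"
  by (rule vector_fieldsD[OF assms(1,2), THEN conjunct2, THEN conjunct1, THEN bspec,
        THEN bspec, THEN mp, THEN bspec, OF assms(3) smooth_funs_cong[OF assms(2,4,3)] _ assms(5)])
    (simp_all add: assms(4))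

lemma vf_apply_add:
  assumes "X \<in> vector_fields G V" "jet_open G V" "f \<in> smooth_funs G V" "g \<in> smooth_funs G V" "e \<in> V"
  shows "X (\<lambda>y. f y + g y) e = X f e + X g e"
  by (rule vector_fieldsD[OF assms(1,2), THEN conjunct2, THEN conjunct2, THEN conjunct1, THEN bspec,
        THEN bspec, THEN bspec, OF assms(3-5)])

lemma vf_apply_cmult:
  assumes "X \<in> vector_fields G V" "jet_open G V" "f \<in> smooth_funs G V" "e \<in> V"
  shows "X (\<lambda>y. r * f y) e = r * X f e"
  by (rule vector_fieldsD[OF assms(1,2), THEN conjunct2, THEN conjunct2, THEN conjunct2, THEN conjunct1,
        THEN spec, THEN bspec, THEN bspec, OF assms(3,4)])

lemma vf_apply_mult:
  assumes "X \<in> vector_fields G V" "jet_open G V" "f \<in> smooth_funs G V" "g \<in> smooth_funs G V" "e \<in> V"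
  shows "X (\<lambda>y. f y * g y) e = X f e * g e + f e * X g e"
  by (rule vector_fieldsD[OF assms(1,2), THEN conjunct2, THEN conjunct2, THEN conjunct2, THEN conjunct2,
        THEN bspec, THEN bspec, THEN bspec, OF assms(3-5)])

text \<open>The Leibniz rule on \<open>1 * 1\<close> forces the value 0 on the constant 1, and
  homogeneity does the rest.\<close>

lemma vf_apply_const:
  assumes "X \<in> vector_fields G V" "jet_open G V" "e \<in> V"
  shows "X (\<lambda>y. c) e = 0"
proof -
  have "X (\<lambda>y. 1 * 1) e = X (\<lambda>y. 1) e * 1 + 1 * X (\<lambda>y. 1) e"
    using vf_apply_mult[OF assms(1,2) smooth_funs_const smooth_funs_const assms(3), of 1 1] .
  then have "X (\<lambda>y. 1) e = 0" by simp
  moreover have "X (\<lambda>y. c * 1) e = c * X (\<lambda>y. 1) e"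
    by (rule vf_apply_cmult[OF assms(1,2) smooth_funs_const assms(3)])
  ultimately show ?thesis by simp
qed

lemma vf_apply_minus:
  assumes "X \<in> vector_fields G V" "jet_open G V" "f \<in> smooth_funs G V" "e \<in> V"
  shows "X (\<lambda>y. - f y) e = - X f e"
  using vf_apply_cmult[OF assms, of "- 1"] by simp

lemma vf_apply_diff:
  assumes "X \<in> vector_fields G V" "jet_open G V" "f \<in> smooth_funs G V" "g \<in> smooth_funs G V" "e \<in> V"
  shows "X (\<lambda>y. f y - g y) e = X f e - X g e"
  using vf_apply_add[OF assms(1-3) smooth_funs_minus[OF assms(2,4)] assms(5)]
    vf_apply_minus[OF assms(1,2,4,5)] by simp

lemma vf_apply_sum:
  assumes "X \<in> vector_fields G V" "jet_open G V" "\<And>s. s \<in> A \<Longrightarrow> f s \<in> smooth_funs G V" "e \<in> V"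
  shows "X (\<lambda>y. \<Sum>s\<in>A. f s y) e = (\<Sum>s\<in>A. X (f s) e)"
proof (cases "finite A")
  case True
  then show ?thesis using assms(3)
  proof (induction A)
    case empty
    then show ?case using vf_apply_const[OF assms(1,2,4)] by simp
  next
    case (insert s A)
    have "X (\<lambda>y. f s y + (\<Sum>s\<in>A. f s y)) e = X (f s) e + X (\<lambda>y. \<Sum>s\<in>A. f s y) e"
      using insert.prems assms(4) by (intro vf_apply_add[OF assms(1,2)] smooth_funs_sum assms(2)) auto
    then show ?case using insert by simp
  qed
next
  case False
  then show ?thesis using vf_apply_const[OF assms(1,2,4)] by simp
qed

lemma vf_zero_field: "vf_zero \<in> vector_fields G W"
  unfolding vf_zero_def by (rule vector_fieldsI) (simp_all add: smooth_funs_const)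

lemma vf_add_field:
  assumes X: "X \<in> vector_fields G W" and Y: "Y \<in> vector_fields G W"
  shows "vf_add X Y \<in> vector_fields G W"
proof (rule vector_fieldsI; unfold vf_add_def)
  fix V f assume V: "jet_open G V" "V \<subseteq> W" and f: "f \<in> smooth_funs G V"
  note X' = vector_fields_subset[OF X V(2)] and Y' = vector_fields_subset[OF Y V(2)]
  show "(\<lambda>e. X f e + Y f e) \<in> smooth_funs G V"
    by (rule smooth_funs_add[OF V(1) vf_smooth[OF X' V(1) f] vf_smooth[OF Y' V(1) f]])
  fix e assume e: "e \<in> V"
  show "X (\<lambda>y. r * f y) e + Y (\<lambda>y. r * f y) e = r * (X f e + Y f e)" for r
    by (simp add: vf_apply_cmult[OF X' V(1) f e] vf_apply_cmult[OF Y' V(1) f e] distrib_left)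
  fix g assume g: "g \<in> smooth_funs G V"
  show "X f e + Y f e = X g e + Y g e" if "\<And>e. e \<in> V \<Longrightarrow> f e = g e"
    using vf_cong[OF X' V(1) f that e] vf_cong[OF Y' V(1) f that e] by simp
  show "X (\<lambda>y. f y + g y) e + Y (\<lambda>y. f y + g y) e = X f e + Y f e + (X g e + Y g e)"
    by (simp add: vf_apply_add[OF X' V(1) f g e] vf_apply_add[OF Y' V(1) f g e])
  show "X (\<lambda>y. f y * g y) e + Y (\<lambda>y. f y * g y) e = (X f e + Y f e) * g e + f e * (X g e + Y g e)"
    by (simp add: vf_apply_mult[OF X' V(1) f g e] vf_apply_mult[OF Y' V(1) f g e] algebra_simps)
qed

lemma vf_scale_field:
  assumes X: "X \<in> vector_fields G W" and h: "h \<in> smooth_funs G W"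
  shows "vf_scale h X \<in> vector_fields G W"
proof (rule vector_fieldsI; unfold vf_scale_def)
  fix V f assume V: "jet_open G V" "V \<subseteq> W" and f: "f \<in> smooth_funs G V"
  note X' = vector_fields_subset[OF X V(2)]
  show "(\<lambda>e. h e * X f e) \<in> smooth_funs G V"
    by (rule smooth_funs_mult[OF V(1) smooth_funs_subset[OF h V(2)] vf_smooth[OF X' V(1) f]])
  fix e assume e: "e \<in> V"
  show "h e * X (\<lambda>y. r * f y) e = r * (h e * X f e)" for r
    by (simp add: vf_apply_cmult[OF X' V(1) f e])
  fix g assume g: "g \<in> smooth_funs G V"
  show "h e * X f e = h e * X g e" if "\<And>e. e \<in> V \<Longrightarrow> f e = g e"
    using vf_cong[OF X' V(1) f that e] by simp
  show "h e * X (\<lambda>y. f y + g y) e = h e * X f e + h e * X g e"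
    by (simp add: vf_apply_add[OF X' V(1) f g e] distrib_left)
  show "h e * X (\<lambda>y. f y * g y) e = h e * X f e * g e + f e * (h e * X g e)"
    by (simp add: vf_apply_mult[OF X' V(1) f g e] algebra_simps)
qed

lemma vf_diff_eq_add: "vf_diff X Y = vf_add X (vf_scale (\<lambda>e. - 1) Y)"
  by (simp add: vf_diff_def vf_add_def vf_scale_def)

lemma vf_diff_field:
  "X \<in> vector_fields G W \<Longrightarrow> Y \<in> vector_fields G W \<Longrightarrow> vf_diff X Y \<in> vector_fields G W"
  unfolding vf_diff_eq_add by (intro vf_add_field vf_scale_field smooth_funs_const)

text \<open>Summing over a set of indices makes \<open>vf_comb\<close>, whose sum runs over a whole
  type, accessible to induction on finite sets.\<close>

definition vf_sum where
  "vf_sum A g X = (\<lambda>f e. \<Sum>s\<in>A. g s e * X s f e)"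

lemma vf_comb_eq_sum: "vf_comb g X = vf_sum UNIV g X"
  by (simp add: vf_comb_def vf_sum_def)

lemma vf_sum_empty: "vf_sum {} g X = vf_zero"
  by (simp add: vf_sum_def vf_zero_def)

lemma vf_sum_insert:
  "finite A \<Longrightarrow> s \<notin> A \<Longrightarrow> vf_sum (insert s A) g X = vf_add (vf_scale (g s) (X s)) (vf_sum A g X)"
  by (simp add: vf_sum_def vf_add_def vf_scale_def)

lemma vf_sum_field:
  assumes "finite A" "\<And>s. X s \<in> vector_fields G W" "\<And>s. g s \<in> smooth_funs G W"
  shows "vf_sum A g X \<in> vector_fields G W"
  using assms(1)
  by induction (simp_all add: vf_sum_empty vf_sum_insert vf_zero_field vf_add_field vf_scale_field assms)

lemma vf_comb_field:
  fixes g :: "'i::finite \<Rightarrow> _"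
  shows "(\<And>s. X s \<in> vector_fields G W) \<Longrightarrow> (\<And>s. g s \<in> smooth_funs G W) \<Longrightarrow>
    vf_comb g X \<in> vector_fields G W"
  unfolding vf_comb_eq_sum by (rule vf_sum_field) auto

text \<open>In the Leibniz rule for the commutator the mixed products of first derivatives cancel.
  The laws of the inner field hold only on \<open>V\<close>, so each of them is moved under the
  outer field by \<open>vf_cong\<close>.\<close>

lemma lie_bracket_field:
  assumes X: "X \<in> vector_fields G W" and Y: "Y \<in> vector_fields G W"
  shows "lie_bracket X Y \<in> vector_fields G W"
proof (rule vector_fieldsI; unfold lie_bracket_def)
  fix V f assume V: "jet_open G V" "V \<subseteq> W" and f: "f \<in> smooth_funs G V"
  note X' = vector_fields_subset[OF X V(2)] and Y' = vector_fields_subset[OF Y V(2)]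
  have Xs: "X f \<in> smooth_funs G V" if "f \<in> smooth_funs G V" for f
    by (rule vf_smooth[OF X' V(1) that])
  have Ys: "Y f \<in> smooth_funs G V" if "f \<in> smooth_funs G V" for f
    by (rule vf_smooth[OF Y' V(1) that])
  show "(\<lambda>e. X (Y f) e - Y (X f) e) \<in> smooth_funs G V"
    by (intro smooth_funs_diff Xs Ys V f)
  fix e assume e: "e \<in> V"
  show "X (Y (\<lambda>y. r * f y)) e - Y (X (\<lambda>y. r * f y)) e = r * (X (Y f) e - Y (X f) e)" for r
  proof -
    note rf = smooth_funs_cmult[OF V(1) f, of r]
    have "X (Y (\<lambda>y. r * f y)) e = X (\<lambda>y. r * Y f y) e"
      by (intro vf_cong[OF X' V(1)] Ys rf vf_apply_cmult[OF Y' V(1)] f e)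
    moreover have "Y (X (\<lambda>y. r * f y)) e = Y (\<lambda>y. r * X f y) e"
      by (intro vf_cong[OF Y' V(1)] Xs rf vf_apply_cmult[OF X' V(1)] f e)
    ultimately show ?thesis
      by (simp add: vf_apply_cmult[OF X' V(1) Ys[OF f] e] vf_apply_cmult[OF Y' V(1) Xs[OF f] e]
          right_diff_distrib)
  qed
  fix g assume g: "g \<in> smooth_funs G V"
  show "X (Y f) e - Y (X f) e = X (Y g) e - Y (X g) e" if eq: "\<And>e. e \<in> V \<Longrightarrow> f e = g e"
  proof -
    have "X (Y f) e = X (Y g) e"
      by (intro vf_cong[OF X' V(1)] Ys f vf_cong[OF Y' V(1) f] eq e)
    moreover have "Y (X f) e = Y (X g) e"
      by (intro vf_cong[OF Y' V(1)] Xs f vf_cong[OF X' V(1) f] eq e)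
    ultimately show ?thesis by simp
  qed
  show "X (Y (\<lambda>y. f y + g y)) e - Y (X (\<lambda>y. f y + g y)) e =
      X (Y f) e - Y (X f) e + (X (Y g) e - Y (X g) e)"
  proof -
    note fg = smooth_funs_add[OF V(1) f g]
    have "X (Y (\<lambda>y. f y + g y)) e = X (\<lambda>y. Y f y + Y g y) e"
      by (intro vf_cong[OF X' V(1)] Ys fg vf_apply_add[OF Y' V(1)] f g e)
    moreover have "Y (X (\<lambda>y. f y + g y)) e = Y (\<lambda>y. X f y + X g y) e"
      by (intro vf_cong[OF Y' V(1)] Xs fg vf_apply_add[OF X' V(1)] f g e)
    ultimately show ?thesis
      by (simp add: vf_apply_add[OF X' V(1) Ys[OF f] Ys[OF g] e]
          vf_apply_add[OF Y' V(1) Xs[OF f] Xs[OF g] e])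
  qed
  show "X (Y (\<lambda>y. f y * g y)) e - Y (X (\<lambda>y. f y * g y)) e =
      (X (Y f) e - Y (X f) e) * g e + f e * (X (Y g) e - Y (X g) e)"
  proof -
    note fg = smooth_funs_mult[OF V(1) f g] and m = smooth_funs_mult[OF V(1)]
    have "X (Y (\<lambda>y. f y * g y)) e = X (\<lambda>y. Y f y * g y + f y * Y g y) e"
      by (intro vf_cong[OF X' V(1)] Ys fg vf_apply_mult[OF Y' V(1)] f g e)
    also have "\<dots> = X (\<lambda>y. Y f y * g y) e + X (\<lambda>y. f y * Y g y) e"
      by (intro vf_apply_add[OF X' V(1)] m Ys f g e)
    also have "\<dots> = X (Y f) e * g e + Y f e * X g e + (X f e * Y g e + f e * X (Y g) e)"
      by (simp add: vf_apply_mult[OF X' V(1) Ys[OF f] g e] vf_apply_mult[OF X' V(1) f Ys[OF g] e])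
    finally have 1: "X (Y (\<lambda>y. f y * g y)) e =
        X (Y f) e * g e + Y f e * X g e + (X f e * Y g e + f e * X (Y g) e)" .
    have "Y (X (\<lambda>y. f y * g y)) e = Y (\<lambda>y. X f y * g y + f y * X g y) e"
      by (intro vf_cong[OF Y' V(1)] Xs fg vf_apply_mult[OF X' V(1)] f g e)
    also have "\<dots> = Y (\<lambda>y. X f y * g y) e + Y (\<lambda>y. f y * X g y) e"
      by (intro vf_apply_add[OF Y' V(1)] m Xs f g e)
    also have "\<dots> = Y (X f) e * g e + X f e * Y g e + (Y f e * X g e + f e * Y (X g) e)"
      by (simp add: vf_apply_mult[OF Y' V(1) Xs[OF f] g e] vf_apply_mult[OF Y' V(1) f Xs[OF g] e])
    finally have 2: "Y (X (\<lambda>y. f y * g y)) e =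
        Y (X f) e * g e + X f e * Y g e + (Y f e * X g e + f e * Y (X g) e)" .
    show ?thesis unfolding 1 2 by (simp add: algebra_simps)
  qed
qed

lemma vf_eqD: "vf_eq G W X Y \<Longrightarrow> jet_open G V \<Longrightarrow> V \<subseteq> W \<Longrightarrow> f \<in> smooth_funs G V \<Longrightarrow> e \<in> V \<Longrightarrow> X f e = Y f e"
  unfolding vf_eq_def by blast

lemma vf_eqI:
  "(\<And>V f e. jet_open G V \<Longrightarrow> V \<subseteq> W \<Longrightarrow> f \<in> smooth_funs G V \<Longrightarrow> e \<in> V \<Longrightarrow> X f e = Y f e) \<Longrightarrow> vf_eq G W X Y"
  unfolding vf_eq_def by blast

lemma vf_eq_refl: "vf_eq G W X X"
  unfolding vf_eq_def by blast

lemma vf_eq_sym: "vf_eq G W X Y \<Longrightarrow> vf_eq G W Y X"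
  unfolding vf_eq_def by simp

lemma vf_eq_trans: "vf_eq G W X Y \<Longrightarrow> vf_eq G W Y Z \<Longrightarrow> vf_eq G W X Z"
  unfolding vf_eq_def by simp

lemma vf_eq_add: "vf_eq G W X X' \<Longrightarrow> vf_eq G W Y Y' \<Longrightarrow> vf_eq G W (vf_add X Y) (vf_add X' Y')"
  unfolding vf_eq_def vf_add_def by simp

lemma vf_eq_diff: "vf_eq G W X X' \<Longrightarrow> vf_eq G W Y Y' \<Longrightarrow> vf_eq G W (vf_diff X Y) (vf_diff X' Y')"
  unfolding vf_eq_def vf_diff_def by simp

lemma vf_eq_comb:
  assumes "\<And>s. vf_eq G W (X s) (X' s)" "\<And>s e. e \<in> W \<Longrightarrow> g s e = g' s e"
  shows "vf_eq G W (vf_comb g X) (vf_comb g' X')"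
  using assms unfolding vf_eq_def vf_comb_def by (fastforce intro!: sum.cong)

lemma vf_eq_lie_bracket:
  assumes X: "X \<in> vector_fields G W" "X' \<in> vector_fields G W" "vf_eq G W X X'"
    and Y: "Y \<in> vector_fields G W" "Y' \<in> vector_fields G W" "vf_eq G W Y Y'"
  shows "vf_eq G W (lie_bracket X Y) (lie_bracket X' Y')"
proof (rule vf_eqI)
  fix V f e assume V: "jet_open G V" "V \<subseteq> W" and f: "f \<in> smooth_funs G V" and e: "e \<in> V"
  note sX = vector_fields_subset[OF X(1) V(2)] and sX' = vector_fields_subset[OF X(2) V(2)]
  note sY = vector_fields_subset[OF Y(1) V(2)] and sY' = vector_fields_subset[OF Y(2) V(2)]
  have "X (Y f) e = X (Y' f) e"
    by (intro vf_cong[OF sX V(1) vf_smooth[OF sY V(1) f]] vf_eqD[OF Y(3) V f] e)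
  also have "\<dots> = X' (Y' f) e"
    by (rule vf_eqD[OF X(3) V vf_smooth[OF sY' V(1) f] e])
  finally have 1: "X (Y f) e = X' (Y' f) e" .
  have "Y (X f) e = Y (X' f) e"
    by (intro vf_cong[OF sY V(1) vf_smooth[OF sX V(1) f]] vf_eqD[OF X(3) V f] e)
  also have "\<dots> = Y' (X' f) e"
    by (rule vf_eqD[OF Y(3) V vf_smooth[OF sX' V(1) f] e])
  finally show "lie_bracket X Y f e = lie_bracket X' Y' f e"
    unfolding lie_bracket_def 1 by simp
qed

end


section \<open>Coordinate fields\<close>

lemma linear_real_vec:
  fixes L :: "real ^ 'n::finite \<Rightarrow> real"
  assumes "linear L" shows "L u = (\<Sum>i\<in>UNIV. u $ i * L (axis i 1))"
proof -
  have "L u = L (\<Sum>i\<in>UNIV. u $ i *\<^sub>R axis i 1)"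
    by (simp add: basis_expansion flip: scalar_mult_eq_scaleR)
  then show ?thesis
    by (simp add: linear_sum[OF assms] linear_scale[OF assms])
qed

lemma axis_sum: "(\<Sum>i\<in>UNIV. axis i (u $ i)) = (u :: 'a::comm_monoid_add ^ 'n::finite)"
  by (simp add: vec_eq_iff axis_def)

lemma linear_real_vec_vec:
  fixes L :: "real ^ 'm::finite ^ 'n::finite \<Rightarrow> real"
  assumes "linear L" shows "L u = (\<Sum>i\<in>UNIV. \<Sum>a\<in>UNIV. u $ i $ a * L (axis i (axis a 1)))"
proof -
  have ax: "linear (axis i :: real ^ 'm \<Rightarrow> real ^ 'm ^ 'n)" for i
    by (rule linearI) (auto simp: vec_eq_iff axis_def)
  have "L u = (\<Sum>i\<in>UNIV. (L \<circ> axis i) (u $ i))"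
    using linear_sum[OF assms, of "\<lambda>i. axis i (u $ i)" UNIV] by (simp add: axis_sum)
  also have "\<dots> = (\<Sum>i\<in>UNIV. \<Sum>a\<in>UNIV. u $ i $ a * (L \<circ> axis i) (axis a 1))"
    by (intro sum.cong refl linear_real_vec linear_compose[OF ax assms])
  finally show ?thesis by simp
qed

lemma linear_real_triple:
  fixes L :: "(real ^ 'm::finite) \<times> (real ^ 'n::finite) \<times> (real ^ 'm ^ 'n) \<Rightarrow> real"
  assumes "linear L"
  shows "L w = (\<Sum>a\<in>UNIV. fst w $ a * L (axis a 1, 0, 0)) + (\<Sum>i\<in>UNIV. fst (snd w) $ i * L (0, axis i 1, 0)) +
    (\<Sum>i\<in>UNIV. \<Sum>a\<in>UNIV. snd (snd w) $ i $ a * L (0, 0, axis i (axis a 1)))"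
proof -
  have 1: "linear (\<lambda>u. L (u, 0, 0))" and 2: "linear (\<lambda>u. L (0, u, 0))" and 3: "linear (\<lambda>u. L (0, 0, u))"
    using linear_add[OF assms, of "(_, 0, 0)" "(_, 0, 0)"] linear_scale[OF assms, of _ "(_, 0, 0)"]
      linear_add[OF assms, of "(0, _, 0)" "(0, _, 0)"] linear_scale[OF assms, of _ "(0, _, 0)"]
      linear_add[OF assms, of "(0, 0, _)" "(0, 0, _)"] linear_scale[OF assms, of _ "(0, 0, _)"]
    by (auto intro!: linearI)
  have "L w = L (fst w, 0, 0) + L (0, fst (snd w), 0) + L (0, 0, snd (snd w))"
    by (simp flip: linear_add[OF assms])
  then show ?thesis
    using linear_real_vec[OF 1, of "fst w"] linear_real_vec[OF 2, of "fst (snd w)"]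
      linear_real_vec_vec[OF 3, of "snd (snd w)"] by simp
qed

context jet_bundle
begin

lemma rep_has_derivative:
  assumes "jet_open G V" "V \<subseteq> jdom G K" "K \<in> jcharts G" "f \<in> smooth_funs G V" "e \<in> V"
  shows "(f \<circ> coords_inv G K has_derivative (\<lambda>v. partial G K v f e)) (at (coords K e))"
proof -
  have "f \<circ> coords_inv G K differentiable (at (coords K e))"
    by (rule smooth_on_differentiable[OF coords_open[OF assms(3,1,2)] smooth_funsD[OF assms(4,3,2)]])
       (use assms(5) in blast)
  then show ?thesis
    by (simp add: partial_def frechet_derivative_works[symmetric])
qed

lemma partial_eqI:
  "(f \<circ> coords_inv G K has_derivative f') (at (coords K e)) \<Longrightarrow> partial G K v f e = f' v"
  unfolding partial_def by (simp add: frechet_derivative_eq)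

lemma partial_cong:
  assumes V: "jet_open G V" "V \<subseteq> jdom G K" and K: "K \<in> jcharts G" and f: "f \<in> smooth_funs G V"
    and eq: "\<And>e. e \<in> V \<Longrightarrow> f e = g e" and e: "e \<in> V"
  shows "partial G K v f e = partial G K v g e"
proof -
  have "(g \<circ> coords_inv G K has_derivative (\<lambda>v. partial G K v f e)) (at (coords K e))"
    by (rule has_derivative_transform_within_open[OF rep_has_derivative[OF V K f e] coords_open[OF K V]])
       (use e eq coords_inv_image[OF K V(2)] in auto)
  from partial_eqI[OF this] show ?thesis by simp
qed

lemma partial_field:
  assumes K: "K \<in> jcharts G" and W: "W \<subseteq> jdom G K"
  shows "partial G K v \<in> vector_fields G W"
proof (rule vector_fieldsI)
  fix V f assume V: "jet_open G V" "V \<subseteq> W" and f: "f \<in> smooth_funs G V"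
  have VK: "V \<subseteq> jdom G K" using V W by blast
  show "partial G K v f \<in> smooth_funs G V"
  proof (rule smooth_funsI[OF V(1) VK K], rule smooth_on_cong_open[OF coords_open[OF K V(1) VK]])
    show "smooth_on (coords K ` V) (\<lambda>z. frechet_derivative (f \<circ> coords_inv G K) (at z) v)"
      by (rule smooth_on_frechet_derivative[OF smooth_funsD[OF f K VK]])
  qed (simp add: partial_def coords_inv_image[OF K VK])
  fix e assume e: "e \<in> V"
  note df = rep_has_derivative[OF V(1) VK K f e]
  show "partial G K v (\<lambda>y. r * f y) e = r * partial G K v f e" for r
    by (rule partial_eqI[where f' = "\<lambda>v. r * partial G K v f e"])
       (use has_derivative_mult_right[OF df, of r] in \<open>simp add: o_def\<close>)
  fix g assume g: "g \<in> smooth_funs G V"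
  note dg = rep_has_derivative[OF V(1) VK K g e]
  show "partial G K v f e = partial G K v g e" if "\<And>e. e \<in> V \<Longrightarrow> f e = g e"
    by (rule partial_cong[OF V(1) VK K f that e])
  show "partial G K v (\<lambda>y. f y + g y) e = partial G K v f e + partial G K v g e"
    by (rule partial_eqI[where f' = "\<lambda>v. partial G K v f e + partial G K v g e"])
       (use has_derivative_add[OF df dg] in \<open>simp add: o_def\<close>)
  have "coords_inv G K (coords K e) = e"
    using coords_inv_coords[OF K] VK e by blast
  then show "partial G K v (\<lambda>y. f y * g y) e = partial G K v f e * g e + f e * partial G K v g e"
    by (subst partial_eqI[where f' = "\<lambda>v. f e * partial G K v g e + partial G K v f e * g e"])
       (use has_derivative_mult[OF df dg] in \<open>simp_all add: o_def\<close>)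
qed

lemma partial_commute:
  assumes V: "jet_open G V" "V \<subseteq> jdom G K" and K: "K \<in> jcharts G" and f: "f \<in> smooth_funs G V" and e: "e \<in> V"
  shows "partial G K v (partial G K w f) e = partial G K w (partial G K v f) e"
proof -
  let ?F = "f \<circ> coords_inv G K"
  note o = coords_open[OF K V] and sm = smooth_funsD[OF f K V(2)]
  have z: "coords K e \<in> coords K ` V" using e by blast
  have *: "partial G K v (partial G K w f) e =
      frechet_derivative (\<lambda>z. frechet_derivative ?F (at z) w) (at (coords K e)) v" for v w
    unfolding partial_def[of G K v]
    by (rule fun_cong[OF frechet_derivative_cong_open[OF o z, symmetric]])
       (simp_all add: partial_def coords_inv_image[OF K V(2)]
         smooth_on_differentiable[OF o smooth_on_frechet_derivative[OF sm] z])
  show ?thesis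
    unfolding * by (rule frechet_derivative_commute[OF o sm z])
qed

text \<open>Coordinates of all three kinds are linear functions of \<open>coords K\<close>, so one
  lemma provides the smoothness and the partial derivatives of each kind.\<close>

lemma linear_coord:
  fixes L :: "_ \<Rightarrow> real"
  assumes K: "K \<in> jcharts G" and L: "bounded_linear L" and f: "\<And>e. f e = L (coords K e)"
  shows "f \<in> smooth_funs G (jdom G K)" "e \<in> jdom G K \<Longrightarrow> partial G K v f e = L v"
proof -
  note o = coords_open[OF K jet_open_jdom[OF K] subset_refl]
  have eq: "L z = (f \<circ> coords_inv G K) z" if "z \<in> coords K ` jdom G K" for z
    using that by (simp add: f coords_inv_image[OF K subset_refl])
  show "f \<in> smooth_funs G (jdom G K)"
    by (rule smooth_funsI[OF jet_open_jdom[OF K] subset_refl K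
          smooth_on_cong_open[OF o eq smooth_on_linear[OF L]]])
  assume e: "e \<in> jdom G K"
  show "partial G K v f e = L v"
    by (rule partial_eqI[OF has_derivative_transform_within_open[OF
            bounded_linear_imp_has_derivative[OF L] o _ eq]]) (use e in auto)
qed

lemma bounded_linear_coords:
  "bounded_linear (\<lambda>z :: (real ^ 'm) \<times> (real ^ 'n) \<times> (real ^ 'm ^ 'n). fst z $ a)"
  "bounded_linear (\<lambda>z :: (real ^ 'm) \<times> (real ^ 'n) \<times> (real ^ 'm ^ 'n). fst (snd z) $ i)"
  "bounded_linear (\<lambda>z :: (real ^ 'm) \<times> (real ^ 'n) \<times> (real ^ 'm ^ 'n). snd (snd z) $ i $ a)"
  by (rule bounded_linear_compose[OF bounded_linear_vec_nth bounded_linear_fst])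
     (rule bounded_linear_compose[OF bounded_linear_vec_nth bounded_linear_fst_comp[OF bounded_linear_snd]],
      rule bounded_linear_compose[OF bounded_linear_vec_nth bounded_linear_compose[OF
        bounded_linear_vec_nth bounded_linear_snd_comp[OF bounded_linear_snd]]])

lemmas t_coord = linear_coord[OF _ bounded_linear_coords(1) t_coord_def]
lemmas x_coord = linear_coord[OF _ bounded_linear_coords(2) x_coord_def]
lemmas p_coord = linear_coord[OF _ bounded_linear_coords(3) p_coord_def]

text \<open>Serves two purposes: fibre coordinates of another chart are affine along lines in a
  fibre, and functions of the first base point alone are constant along directions without
  \<open>t\<close>-part.\<close>

lemma partial_line:
  assumes V: "jet_open G V" "V \<subseteq> jdom G K" and K: "K \<in> jcharts G" and f: "f \<in> smooth_funs G V" and e: "e \<in> V"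
    and line: "\<And>e' s. e' \<in> V \<Longrightarrow> coords K e' = coords K e + s *\<^sub>R v \<Longrightarrow> f e' = f e + s * c"
  shows "partial G K v f e = c"
  unfolding partial_def
proof (rule frechet_derivative_line[OF coords_open[OF K V]])
  show "coords K e \<in> coords K ` V" using e by blast
  then show "f \<circ> coords_inv G K differentiable at (coords K e)"
    by (rule smooth_on_differentiable[OF coords_open[OF K V] smooth_funsD[OF f K V(2)]])
  fix s assume "coords K e + s *\<^sub>R v \<in> coords K ` V"
  then obtain e' where e': "e' \<in> V" "coords K e + s *\<^sub>R v = coords K e'" by blast
  have "coords_inv G K (coords K e) = e" "coords_inv G K (coords K e') = e'"
    using coords_inv_coords[OF K] V(2) e e' by blast+
  then show "(f \<circ> coords_inv G K) (coords K e + s *\<^sub>R v) = (f \<circ> coords_inv G K) (coords K e) + s * c"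
    using line[OF e'(1) e'(2)[symmetric]] by (simp add: e'(2))
qed


section \<open>Change of coordinates\<close>

lemma partial_chain:
  assumes V: "jet_open G V" "V \<subseteq> jdom G K" "V \<subseteq> jdom G K'" and K: "K \<in> jcharts G" "K' \<in> jcharts G"
    and f: "f \<in> smooth_funs G V" and e: "e \<in> V"
  shows "partial G K v f e =
    (\<Sum>a\<in>UNIV. partial G K v (t_coord K' a) e * part_t G K' a f e) +
    (\<Sum>i\<in>UNIV. partial G K v (x_coord K' i) e * part_x G K' i f e) +
    (\<Sum>j\<in>UNIV. \<Sum>b\<in>UNIV. partial G K v (p_coord K' b j) e * part_p G K' j b f e)"
proof -
  let ?\<Phi> = "\<lambda>z. coords K' (coords_inv G K z)" and ?S = "coords K ` V" and ?z = "coords K e"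
  note oS = coords_open[OF K(1) V(1,2)]
  have z: "?z \<in> ?S" using e by blast
  have inv: "coords_inv G K ?z = e" using coords_inv_coords[OF K(1)] V(2) e by blast
  have "smooth_on ?S ?\<Phi>"
    using coords_transition_smooth[OF K] by (rule smooth_on_subset) (use V in blast)
  then have "?\<Phi> differentiable (at ?z)"
    by (rule smooth_on_differentiable[OF oS _ z])
  then obtain \<Phi>' where \<Phi>': "(?\<Phi> has_derivative \<Phi>') (at ?z)"
    unfolding differentiable_def by (elim exE)
  have df: "(f \<circ> coords_inv G K' has_derivative (\<lambda>v. partial G K' v f e)) (at (?\<Phi> ?z))"
    unfolding inv by (rule rep_has_derivative[OF V(1,3) K(2) f e])
  have comp: "(f \<circ> coords_inv G K' \<circ> ?\<Phi>) y = (f \<circ> coords_inv G K) y" if "y \<in> ?S" for y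
    using coords_inv_coords[OF K(2), of "coords_inv G K y"] coords_inv_image(1)[OF K(1) V(2) that] V(3)
    by auto
  have "(f \<circ> coords_inv G K has_derivative (\<lambda>v. partial G K' v f e) \<circ> \<Phi>') (at ?z)"
    by (rule has_derivative_transform_within_open[OF diff_chain_at[OF \<Phi>' df] oS z comp])
  then have *: "partial G K v f e = partial G K' (\<Phi>' v) f e"
    by (simp add: partial_eqI)
  \<comment> \<open>The components of \<open>\<Phi>' v\<close> are the derivatives of the new
    coordinate functions, so the Jacobian of the induced coordinate change need not be written
    out.\<close>
  have coord: "partial G K v g e = L (\<Phi>' v)" if "bounded_linear L" "\<And>e. g e = L (coords K' e)" for g and L :: "_ \<Rightarrow> real"
    by (rule partial_eqI[where f' = "\<lambda>v. L (\<Phi>' v)"])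
       (use bounded_linear.has_derivative[OF that(1) \<Phi>'] in \<open>simp add: o_def that(2)\<close>)
  have lin: "linear (\<lambda>v. partial G K' v f e)"
    using has_derivative_linear[OF df] .
  show ?thesis
    unfolding * linear_real_triple[OF lin, of "\<Phi>' v"] part_t_def part_x_def part_p_def
      coord[OF bounded_linear_coords(1) t_coord_def] coord[OF bounded_linear_coords(2) x_coord_def]
      coord[OF bounded_linear_coords(3) p_coord_def] ..
qed

lemma partial_t_coord:
  assumes K: "K \<in> jcharts G" "K' \<in> jcharts G" and e: "e \<in> jdom G K" "e \<in> jdom G K'"
  shows "partial G K v (t_coord K' a) e = (jac (fst K) (fst K') (fst e) *v fst v) $ a"
proof -
  let ?S = "coords K ` (jdom G K \<inter> jdom G K')"
  have oS: "open ?S" by (intro coords_open K jet_open_Int jet_open_jdom) auto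
  have z: "coords K e \<in> ?S" using e by blast
  have "(snd (fst K') \<circ> chart_inv (fst K) has_derivative (\<lambda>v. jac (fst K) (fst K') (fst e) *v v)) (at (fst (coords K e)))"
    using transition_has_derivative[OF T_atlas jchartsD(1)[OF K(1)] jchartsD(1)[OF K(2)]] e jdomD
    by (simp add: coords_def)
  from bounded_linear.has_derivative[OF bounded_linear_vec_nth diff_chain_at[OF
      bounded_linear_imp_has_derivative[OF bounded_linear_fst] this]]
  have 1: "((\<lambda>z. snd (fst K') (chart_inv (fst K) (fst z)) $ a) has_derivative
      (\<lambda>v. (jac (fst K) (fst K') (fst e) *v fst v) $ a)) (at (coords K e))"
    by (simp add: o_def)
  have 2: "snd (fst K') (chart_inv (fst K) (fst z)) $ a = (t_coord K' a \<circ> coords_inv G K) z" if "z \<in> ?S" for z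
  proof -
    have "z \<in> coords K ` jdom G K" using that by blast
    then show ?thesis
      by (simp add: t_coord_def coords_def[of K'] coords_inv_parts(1)[OF K(1)])
  qed
  show ?thesis
    by (rule partial_eqI[OF has_derivative_transform_within_open[OF 1 oS z 2]])
qed

lemma partial_x_coord:
  assumes K: "K \<in> jcharts G" "K' \<in> jcharts G" and e: "e \<in> jdom G K" "e \<in> jdom G K'"
  shows "partial G K v (x_coord K' i) e = (jac (snd K) (snd K') (fst (snd e)) *v fst (snd v)) $ i"
proof -
  let ?S = "coords K ` (jdom G K \<inter> jdom G K')"
  have oS: "open ?S" by (intro coords_open K jet_open_Int jet_open_jdom) auto
  have z: "coords K e \<in> ?S" using e by blast
  have "(snd (snd K') \<circ> chart_inv (snd K) has_derivative (\<lambda>v. jac (snd K) (snd K') (fst (snd e)) *v v)) (at (fst (snd (coords K e))))"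
    using transition_has_derivative[OF M_atlas jchartsD(2)[OF K(1)] jchartsD(2)[OF K(2)]] e jdomD
    by (simp add: coords_def)
  from bounded_linear.has_derivative[OF bounded_linear_vec_nth diff_chain_at[OF
      bounded_linear_imp_has_derivative[OF bounded_linear_fst_comp[OF bounded_linear_snd]] this]]
  have 1: "((\<lambda>z. snd (snd K') (chart_inv (snd K) (fst (snd z))) $ i) has_derivative
      (\<lambda>v. (jac (snd K) (snd K') (fst (snd e)) *v fst (snd v)) $ i)) (at (coords K e))"
    by (simp add: o_def)
  have 2: "snd (snd K') (chart_inv (snd K) (fst (snd z))) $ i = (x_coord K' i \<circ> coords_inv G K) z" if "z \<in> ?S" for z
  proof -
    have "z \<in> coords K ` jdom G K" using that by blast
    then show ?thesis
      by (simp add: x_coord_def coords_def[of K'] coords_inv_parts(2)[OF K(1)])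
  qed
  show ?thesis
    by (rule partial_eqI[OF has_derivative_transform_within_open[OF 1 oS z 2]])
qed

lemma coords_fibre_line:
  assumes K: "K \<in> jcharts G" and e: "e \<in> jdom G K" "e' \<in> jdom G K"
    and eq: "coords K e' = coords K e + s *\<^sub>R (0, 0, P)"
  shows "fst e' = fst e" "fst (snd e') = fst (snd e)" "snd (snd e') K = snd (snd e) K + s *\<^sub>R P"
proof -
  have "snd (fst K) (fst e') = snd (fst K) (fst e)" "snd (snd K) (fst (snd e')) = snd (snd K) (fst (snd e))"
    using eq by (simp_all add: coords_def)
  then show "fst e' = fst e" "fst (snd e') = fst (snd e)"
    using chart_inv_left[OF T_atlas jchartsD(1)[OF K]] chart_inv_left[OF M_atlas jchartsD(2)[OF K]]
      jdomD[OF e(1)] jdomD[OF e(2)] by metis+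
  show "snd (snd e') K = snd (snd e) K + s *\<^sub>R P"
    using eq by (simp add: coords_def)
qed

text \<open>Along a fibre the base point and hence the Jacobians are fixed, so the new fibre
  coordinates vary linearly. Only vertical directions are treated: derivatives along the base are
  taken from the transformation rule of the nonlinear connection in
  \<open>frame_change\<close>.\<close>

lemma partial_p_coord:
  assumes K: "K \<in> jcharts G" "K' \<in> jcharts G" and e: "e \<in> jdom G K" "e \<in> jdom G K'"
  shows "partial G K (0, 0, P) (p_coord K' b j) e = (\<Sum>k\<in>UNIV. \<Sum>c\<in>UNIV.
    jac (snd K') (snd K) (fst (snd e)) $ k $ j * jac (fst K) (fst K') (fst e) $ b $ c * P $ k $ c)"
proof (rule partial_line[where V = "jdom G K \<inter> jdom G K'"])
  show "jet_open G (jdom G K \<inter> jdom G K')" "K \<in> jcharts G" "jdom G K \<inter> jdom G K' \<subseteq> jdom G K"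
    "e \<in> jdom G K \<inter> jdom G K'"
    using K e by (auto intro: jet_open_Int jet_open_jdom)
  show "p_coord K' b j \<in> smooth_funs G (jdom G K \<inter> jdom G K')"
    by (rule smooth_funs_subset[OF p_coord(1)[OF K(2)]]) blast
  fix e' s assume e': "e' \<in> jdom G K \<inter> jdom G K'" and eq: "coords K e' = coords K e + s *\<^sub>R (0, 0, P)"
  have e'': "e' \<in> jdom G K" "e' \<in> jdom G K'" using e' by auto
  note l = coords_fibre_line[OF K(1) e(1) e''(1) eq]
  show "p_coord K' b j e' = p_coord K' b j e + s * (\<Sum>k\<in>UNIV. \<Sum>c\<in>UNIV.
    jac (snd K') (snd K) (fst (snd e)) $ k $ j * jac (fst K) (fst K') (fst e) $ b $ c * P $ k $ c)"
    by (simp add: p_coord_def coords_def fibre_transition[OF K e] fibre_transition[OF K e''] l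
        sum.distrib sum_distrib_left algebra_simps)
qed

lemma jac_smooth_funs:
  assumes K: "K \<in> jcharts G" "K' \<in> jcharts G"
  shows "(\<lambda>e. jac (fst K) (fst K') (fst e) $ a $ b) \<in> smooth_funs G (jdom G K \<inter> jdom G K')"
    "(\<lambda>e. jac (snd K) (snd K') (fst (snd e)) $ i $ j) \<in> smooth_funs G (jdom G K \<inter> jdom G K')"
proof -
  let ?W = "jdom G K \<inter> jdom G K'" and ?S = "coords K ` (jdom G K \<inter> jdom G K')"
  have oW: "jet_open G ?W" by (intro K jet_open_Int jet_open_jdom)
  have oS: "open ?S" by (intro coords_open K oW) auto
  note c = jchartsD[OF K(1)] jchartsD[OF K(2)]
  have im: "fst ` ?S \<subseteq> snd (fst K) ` (fst (fst K) \<inter> fst (fst K'))"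
    "(\<lambda>z. fst (snd z)) ` ?S \<subseteq> snd (snd K) ` (fst (snd K) \<inter> fst (snd K'))"
    unfolding coords_image[OF K] by auto
  have parts: "fst (coords_inv G K z) = chart_inv (fst K) (fst z)"
    "fst (snd (coords_inv G K z)) = chart_inv (snd K) (fst (snd z))" if "z \<in> ?S" for z
    using that coords_inv_parts[OF K(1)] by blast+
  show "(\<lambda>e. jac (fst K) (fst K') (fst e) $ a $ b) \<in> smooth_funs G ?W"
  proof (rule smooth_funsI[OF oW _ K(1)], blast)
    show "smooth_on ?S ((\<lambda>e. jac (fst K) (fst K') (fst e) $ a $ b) \<circ> coords_inv G K)"
      by (rule smooth_on_cong_open[OF oS _ smooth_on_fst[OF oS chart_overlap_open[OF T_atlas c(1,3)] im(1)
            smooth_jac[OF T_atlas c(1,3)]]]) (simp add: parts)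
  qed
  show "(\<lambda>e. jac (snd K) (snd K') (fst (snd e)) $ i $ j) \<in> smooth_funs G ?W"
  proof (rule smooth_funsI[OF oW _ K(1)], blast)
    show "smooth_on ?S ((\<lambda>e. jac (snd K) (snd K') (fst (snd e)) $ i $ j) \<circ> coords_inv G K)"
      by (rule smooth_on_cong_open[OF oS _ smooth_on_fst_snd[OF oS chart_overlap_open[OF M_atlas c(2,4)] im(2)
            smooth_jac[OF M_atlas c(2,4)]]]) (simp add: parts)
  qed
qed

end


section \<open>The adapted frame\<close>

text \<open>One index for the whole adapted frame, so that the nine families of components and the
  six pairs of directions are instances of uniform statements.\<close>

type_synonym ('m, 'n) dir = "'m + 'n + 'n \<times> 'm"

fun frame :: "('t, 'm::finite, 'x, 'n::finite) jet_data \<Rightarrow> ('t, 'm, 'x, 'n) jchart \<Rightarrow> ('m, 'n) dir \<Rightarrow>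
    ('t, 'm, 'x, 'n) jpoint vfield" where
  "frame G K (Inl a) = del_t G K a"
| "frame G K (Inr (Inl i)) = del_x G K i"
| "frame G K (Inr (Inr (i, a))) = part_p G K i a"

fun dir_vec :: "('m, 'n) dir \<Rightarrow> (real ^ 'm::finite) \<times> (real ^ 'n::finite) \<times> (real ^ 'm ^ 'n)" where
  "dir_vec (Inl a) = (axis a 1, 0, 0)"
| "dir_vec (Inr (Inl i)) = (0, axis i 1, 0)"
| "dir_vec (Inr (Inr (i, a))) = (0, 0, axis i (axis a 1))"

text \<open>The coefficients subtracted from a coordinate field to make it adapted. The value 0 in
  vertical directions lets \<open>frame_eq\<close> and \<open>frame_bracket\<close> cover every
  direction.\<close>

fun nlc :: "('t, 'm::finite, 'x, 'n::finite) jet_data \<Rightarrow> ('t, 'm, 'x, 'n) jchart \<Rightarrow> ('m, 'n) dir \<Rightarrow>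
    'n \<times> 'm \<Rightarrow> ('t, 'm, 'x, 'n) jpoint \<Rightarrow> real" where
  "nlc G K (Inl a) (j, b) = N1 G K b j a"
| "nlc G K (Inr (Inl i)) (j, b) = N2 G K b j i"
| "nlc G K (Inr (Inr _)) _ = (\<lambda>e. 0)"

abbreviation (input) vert where "vert G K \<equiv> (\<lambda>(i, a). part_p G K i a)"

text \<open>The vertical coefficients of the bracket of two frame fields. Up to sign they are the
  torsions \<open>tor_TT\<close>, \<open>tor_TM\<close>, \<open>tor_MM\<close> for two horizontal
  directions, the fibre derivative of the nonlinear connection for a mixed pair, and 0 for two
  vertical ones.\<close>

definition tau :: "('t, 'm::finite, 'x, 'n::finite) jet_data \<Rightarrow> ('t, 'm, 'x, 'n) jchart \<Rightarrow> ('m, 'n) dir \<Rightarrow>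
    ('m, 'n) dir \<Rightarrow> 'n \<times> 'm \<Rightarrow> ('t, 'm, 'x, 'n) jpoint \<Rightarrow> real" where
  "tau G K d d' s e = frame G K d' (nlc G K d s) e - frame G K d (nlc G K d' s) e"

text \<open>Coefficients of the frame of \<open>K\<close> in the frame of \<open>K'\<close>, with
  the index of \<open>K'\<close> first. In the vertical block the factor for the second base
  manifold is the inverse Jacobian, since \<open>p\<close> is covariant in that index. The zeros off
  the diagonal blocks are the reason for adapting the frame.\<close>

fun frame_jac :: "('t, 'm::finite, 'x, 'n::finite) jchart \<Rightarrow> ('t, 'm, 'x, 'n) jchart \<Rightarrow> ('m, 'n) dir \<Rightarrow>
    ('m, 'n) dir \<Rightarrow> ('t, 'm, 'x, 'n) jpoint \<Rightarrow> real" where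
  "frame_jac K K' (Inl a') (Inl a) = (\<lambda>e. jac (fst K) (fst K') (fst e) $ a' $ a)"
| "frame_jac K K' (Inr (Inl i')) (Inr (Inl i)) = (\<lambda>e. jac (snd K) (snd K') (fst (snd e)) $ i' $ i)"
| "frame_jac K K' (Inr (Inr (i', a'))) (Inr (Inr (i, a))) =
     (\<lambda>e. jac (snd K') (snd K) (fst (snd e)) $ i $ i' * jac (fst K) (fst K') (fst e) $ a' $ a)"
| "frame_jac K K' _ _ = (\<lambda>e. 0)"

lemma sum_UNIV_Times: "(\<Sum>s\<in>UNIV. f s) = (\<Sum>i\<in>UNIV. \<Sum>a\<in>UNIV. f (i, a))"
  unfolding sum.cartesian_product by simp

lemma sum_UNIV_Plus:
  "(\<Sum>d\<in>UNIV. f d) = (\<Sum>a\<in>UNIV. f (Inl a)) + (\<Sum>b\<in>UNIV. f (Inr b))"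
  for f :: "'a::finite + 'b::finite \<Rightarrow> real"
proof -
  have "(\<Sum>d\<in>UNIV. f d) = sum f (UNIV <+> UNIV)"
    by (simp only: UNIV_Plus_UNIV)
  also have "\<dots> = (\<Sum>a\<in>UNIV. f (Inl a)) + (\<Sum>b\<in>UNIV. f (Inr b))"
    by (subst sum.Plus) (simp_all add: o_def)
  finally show ?thesis .
qed

lemma sum_exchange:
  fixes J :: "'c::finite \<Rightarrow> real"
  shows "(\<Sum>j\<in>B. \<Sum>b\<in>D. (\<Sum>c\<in>UNIV. n b j c * J c) * q j b) =
    (\<Sum>c\<in>UNIV. J c * (\<Sum>j\<in>B. \<Sum>b\<in>D. n b j c * q j b))"
proof -
  have "(\<Sum>c\<in>UNIV. J c * (\<Sum>j\<in>B. \<Sum>b\<in>D. n b j c * q j b)) =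
      (\<Sum>c\<in>UNIV. \<Sum>j\<in>B. \<Sum>b\<in>D. n b j c * J c * q j b)"
    by (simp add: sum_distrib_left algebra_simps)
  also have "\<dots> = (\<Sum>j\<in>B. \<Sum>b\<in>D. \<Sum>c\<in>UNIV. n b j c * J c * q j b)"
    by (rule sum3_swap)
  finally show ?thesis by (simp only: sum_distrib_right)
qed

lemma sum_dir:
  "(\<Sum>d\<in>UNIV. f d) = (\<Sum>a\<in>UNIV. f (Inl a)) + (\<Sum>i\<in>UNIV. f (Inr (Inl i))) +
     (\<Sum>i\<in>UNIV. \<Sum>a\<in>UNIV. f (Inr (Inr (i, a))))"
  for f :: "('m::finite, 'n::finite) dir \<Rightarrow> real"
  by (simp add: sum_UNIV_Plus sum_UNIV_Times[of "\<lambda>s. f (Inr (Inr s))"])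

lemma dir_cases:
  obtains a where "d = Inl a" | i where "d = Inr (Inl i)" | i a where "d = Inr (Inr (i, a))"
  by (metis obj_sumE surj_pair)

lemma frame_eq:
  "frame G K d = vf_diff (partial G K (dir_vec d)) (vf_comb (nlc G K d) (vert G K))"
  by (cases d rule: dir_cases)
     (auto simp: vf_diff_def vf_comb_def del_t_def del_x_def part_t_def part_x_def part_p_def
       sum_UNIV_Times intro!: ext)

lemma frame_apply:
  "frame G K d f e = partial G K (dir_vec d) f e - (\<Sum>s\<in>UNIV. nlc G K d s e * vert G K s f e)"
  by (simp add: frame_eq vf_diff_def vf_comb_def)

lemma vert_eq_partial: "vert G K s = partial G K (0, 0, axis (fst s) (axis (snd s) 1))"
  by (simp add: case_prod_unfold part_p_def)

lemma vert_eq_frame: "vert G K s = frame G K (Inr (Inr s))"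
  by (cases s) simp

locale nl_jet_bundle = jet_bundle +
  assumes nonlinear: "nonlinear_connection G"
begin

lemma nlc_smooth: "K \<in> jcharts G \<Longrightarrow> nlc G K d s \<in> smooth_funs G (jdom G K)"
  using nonlinear unfolding nonlinear_connection_def
  by (cases d rule: dir_cases; cases s) (auto simp: smooth_funs_const)

lemma vert_field: "K \<in> jcharts G \<Longrightarrow> W \<subseteq> jdom G K \<Longrightarrow> vert G K s \<in> vector_fields G W"
  unfolding vert_eq_partial by (rule partial_field)

lemma frame_field:
  assumes "K \<in> jcharts G" "W \<subseteq> jdom G K" shows "frame G K d \<in> vector_fields G W"
  unfolding frame_eq
  by (intro vf_diff_field vf_comb_field partial_field[OF assms] vert_field[OF assms]
      smooth_funs_subset[OF nlc_smooth assms(2)] assms(1))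

lemma tau_smooth:
  assumes "K \<in> jcharts G" shows "tau G K d d' s \<in> smooth_funs G (jdom G K)"
proof -
  have "tau G K d d' s = (\<lambda>e. frame G K d' (nlc G K d s) e - frame G K d (nlc G K d' s) e)"
    by (rule ext) (rule tau_def)
  then show ?thesis
    using vf_smooth[OF frame_field[OF assms subset_refl] jet_open_jdom[OF assms] nlc_smooth[OF assms]]
    by (simp only: smooth_funs_diff[OF jet_open_jdom[OF assms]])
qed

lemma frame_bracket:
  assumes K: "K \<in> jcharts G"
  shows "vf_eq G (jdom G K) (lie_bracket (frame G K d) (frame G K d')) (vf_comb (tau G K d d') (vert G K))"
proof (rule vf_eqI)
  fix V f e assume V: "jet_open G V" "V \<subseteq> jdom G K" and f: "f \<in> smooth_funs G V" and e: "e \<in> V"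
  note pf = partial_field[OF K V(2)] and ps = vf_smooth[OF partial_field[OF K V(2)] V(1) f]
  have nl: "nlc G K d s \<in> smooth_funs G V" for d s
    by (rule smooth_funs_subset[OF nlc_smooth[OF K] V(2)])
  have vs: "vert G K s f \<in> smooth_funs G V" for s
    by (rule vf_smooth[OF vert_field[OF K V(2)] V(1) f])
  let ?P = "\<lambda>d. partial G K (dir_vec d)" and ?Q = "vert G K" and ?n = "nlc G K"
  \<comment> \<open>Written so that, once coordinate derivatives commute, every term except the one
    differentiating \<open>?n d' s\<close> is symmetric in \<open>d\<close> and \<open>d'\<close>.
    Only that term survives in the bracket.\<close>
  have second: "frame G K d (frame G K d' f) e =
      ?P d (?P d' f) e - (\<Sum>r\<in>UNIV. ?n d r e * ?P d' (?Q r f) e)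
      - (\<Sum>s\<in>UNIV. frame G K d (?n d' s) e * ?Q s f e)
      - (\<Sum>s\<in>UNIV. ?n d' s e * ?P d (?Q s f) e)
      + (\<Sum>s\<in>UNIV. \<Sum>r\<in>UNIV. ?n d' s e * ?n d r e * ?Q r (?Q s f) e)" for d d'
  proof -
    note X = frame_field[OF K V(2), of d]
    have sums: "(\<lambda>y. \<Sum>s\<in>UNIV. ?n d' s y * ?Q s f y) \<in> smooth_funs G V"
      by (intro smooth_funs_sum smooth_funs_mult V(1) nl vs)
    have "frame G K d (frame G K d' f) e = frame G K d (\<lambda>y. ?P d' f y - (\<Sum>s\<in>UNIV. ?n d' s y * ?Q s f y)) e"
      by (rule vf_cong[OF X V(1) vf_smooth[OF frame_field[OF K V(2)] V(1) f] frame_apply e])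
    also have "\<dots> = frame G K d (?P d' f) e - (\<Sum>s\<in>UNIV. frame G K d (\<lambda>y. ?n d' s y * ?Q s f y) e)"
      by (simp only: vf_apply_diff[OF X V(1) ps sums e] vf_apply_sum[OF X V(1) smooth_funs_mult[OF V(1) nl vs] e])
    also have "\<dots> = frame G K d (?P d' f) e -
        (\<Sum>s\<in>UNIV. frame G K d (?n d' s) e * ?Q s f e + ?n d' s e * frame G K d (?Q s f) e)"
      by (simp only: vf_apply_mult[OF X V(1) nl vs e])
    also have "\<dots> = ?P d (?P d' f) e - (\<Sum>r\<in>UNIV. ?n d r e * ?Q r (?P d' f) e) -
        (\<Sum>s\<in>UNIV. frame G K d (?n d' s) e * ?Q s f e) -
        (\<Sum>s\<in>UNIV. ?n d' s e * (?P d (?Q s f) e - (\<Sum>r\<in>UNIV. ?n d r e * ?Q r (?Q s f) e)))"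
      by (simp only: frame_apply[of G K d "?P d' f"] frame_apply[of G K d "?Q _ f"] sum.distrib diff_diff_eq add.assoc)
    also have "\<dots> = ?P d (?P d' f) e - (\<Sum>r\<in>UNIV. ?n d r e * ?P d' (?Q r f) e)
      - (\<Sum>s\<in>UNIV. frame G K d (?n d' s) e * ?Q s f e)
      - (\<Sum>s\<in>UNIV. ?n d' s e * ?P d (?Q s f) e)
      + (\<Sum>s\<in>UNIV. \<Sum>r\<in>UNIV. ?n d' s e * ?n d r e * ?Q r (?Q s f) e)"
    proof -
      have "?Q r (?P d' f) e = ?P d' (?Q r f) e" for r
        unfolding vert_eq_partial by (rule partial_commute[OF V K f e])
      then show ?thesis
        by (simp add: right_diff_distrib sum_subtractf sum_distrib_left mult.assoc)
    qed
    finally show ?thesis .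
  qed
  have PP: "?P d (?P d' f) e = ?P d' (?P d f) e"
    by (rule partial_commute[OF V K f e])
  have QQ: "?Q r (?Q s f) e = ?Q s (?Q r f) e" for r s
    unfolding vert_eq_partial by (rule partial_commute[OF V K f e])
  have "(\<Sum>s\<in>UNIV. \<Sum>r\<in>UNIV. ?n d' s e * ?n d r e * ?Q r (?Q s f) e) =
      (\<Sum>r\<in>UNIV. \<Sum>s\<in>UNIV. ?n d' s e * ?n d r e * ?Q r (?Q s f) e)"
    by (rule sum.swap)
  also have "\<dots> = (\<Sum>s\<in>UNIV. \<Sum>r\<in>UNIV. ?n d s e * ?n d' r e * ?Q r (?Q s f) e)"
    by (intro sum.cong refl) (simp only: QQ mult.commute)
  finally have nn: "(\<Sum>s\<in>UNIV. \<Sum>r\<in>UNIV. ?n d' s e * ?n d r e * ?Q r (?Q s f) e) =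
      (\<Sum>s\<in>UNIV. \<Sum>r\<in>UNIV. ?n d s e * ?n d' r e * ?Q r (?Q s f) e)" .
  show "lie_bracket (frame G K d) (frame G K d') f e = vf_comb (tau G K d d') (vert G K) f e"
    unfolding lie_bracket_def second vf_comb_def tau_def nn PP
    by (simp add: left_diff_distrib sum_subtractf)
qed

text \<open>A base coordinate field of \<open>K\<close> acquires in \<open>K'\<close> a vertical
  part made of derivatives of the new fibre coordinates. The transformation rule, solved for these
  derivatives, trades them for the coefficients in both charts: those of \<open>K\<close> cancel,
  those of \<open>K'\<close> complete the adapted fields of \<open>K'\<close>.\<close>

lemma frame_change:
  assumes K: "K \<in> jcharts G" "K' \<in> jcharts G" and V: "jet_open G V" "V \<subseteq> jdom G K" "V \<subseteq> jdom G K'"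
    and f: "f \<in> smooth_funs G V" and e: "e \<in> V"
  shows "frame G K d f e = (\<Sum>d'\<in>UNIV. frame_jac K K' d' d e * frame G K' d' f e)"
proof -
  have eK: "e \<in> jdom G K" "e \<in> jdom G K'" using V e by auto
  let ?A = "jac (fst K) (fst K') (fst e)" and ?B = "jac (snd K) (snd K') (fst (snd e))"
    and ?C = "jac (snd K') (snd K) (fst (snd e))"
  let ?Q = "\<lambda>j b. part_p G K' j b f e"
  have vert: "part_p G K k c f e = (\<Sum>j\<in>UNIV. \<Sum>b\<in>UNIV. ?C $ k $ j * ?A $ b $ c * ?Q j b)" for k c
  proof -
    have "(\<Sum>k'\<in>UNIV. \<Sum>c'\<in>UNIV. ?C $ k' $ j * ?A $ b $ c' * axis k (axis c 1) $ k' $ c') =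
        ?C $ k $ j * ?A $ b $ c" for j b
    proof -
      have "(\<Sum>c'\<in>UNIV. ?C $ k' $ j * ?A $ b $ c' * axis k (axis c 1) $ k' $ c') =
          (if k' = k then ?C $ k' $ j * ?A $ b $ c else 0)" for k'
        by (simp add: axis_def if_distrib[where f = "\<lambda>x. _ * x"] cong: if_cong)
      then show ?thesis by simp
    qed
    then show ?thesis
      unfolding part_p_def[of G K] partial_chain[OF V K f e]
      by (simp add: partial_t_coord[OF K eK] partial_x_coord[OF K eK] partial_p_coord[OF K eK])
  qed
  have t: "part_t G K a f e = (\<Sum>c\<in>UNIV. ?A $ c $ a * part_t G K' c f e) +
      (\<Sum>j\<in>UNIV. \<Sum>b\<in>UNIV. part_t G K a (p_coord K' b j) e * ?Q j b)" for a
    unfolding part_t_def[of G K] partial_chain[OF V K f e]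
    by (simp add: partial_t_coord[OF K eK] partial_x_coord[OF K eK] matrix_vector_mul_component column_def
        matrix_vector_mult_basis)
  have x: "part_x G K i f e = (\<Sum>k\<in>UNIV. ?B $ k $ i * part_x G K' k f e) +
      (\<Sum>j\<in>UNIV. \<Sum>b\<in>UNIV. part_x G K i (p_coord K' b j) e * ?Q j b)" for i
    unfolding part_x_def[of G K] partial_chain[OF V K f e]
    by (simp add: partial_t_coord[OF K eK] partial_x_coord[OF K eK] matrix_vector_mul_component column_def
        matrix_vector_mult_basis)
  have "(\<forall>b j a. (\<Sum>c\<in>UNIV. N1 G K' b j c e * ?A $ c $ a) =
           (\<Sum>c\<in>UNIV. \<Sum>k\<in>UNIV. N1 G K c k a e * ?A $ b $ c * ?C $ k $ j)
           - part_t G K a (p_coord K' b j) e) \<and>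
        (\<forall>b j i. (\<Sum>k\<in>UNIV. N2 G K' b j k e * ?B $ k $ i) =
           (\<Sum>c\<in>UNIV. \<Sum>k\<in>UNIV. N2 G K c k i e * ?A $ b $ c * ?C $ k $ j)
           - part_x G K i (p_coord K' b j) e)"
    using bspec[OF bspec[OF conjunct2[OF nonlinear[unfolded nonlinear_connection_def]] K(1),
          simplified case_prod_unfold] K(2)] eK by (simp add: case_prod_unfold)
  then have N: "part_t G K a (p_coord K' b j) e =
        (\<Sum>c\<in>UNIV. \<Sum>k\<in>UNIV. N1 G K c k a e * ?A $ b $ c * ?C $ k $ j) - (\<Sum>c\<in>UNIV. N1 G K' b j c e * ?A $ c $ a)"
      "part_x G K i (p_coord K' b j) e =
        (\<Sum>c\<in>UNIV. \<Sum>k\<in>UNIV. N2 G K c k i e * ?A $ b $ c * ?C $ k $ j) - (\<Sum>k\<in>UNIV. N2 G K' b j k e * ?B $ k $ i)"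
    for a b j i by auto
  have swap: "(\<Sum>k\<in>UNIV. \<Sum>c\<in>UNIV. n c k * (\<Sum>j\<in>UNIV. \<Sum>b\<in>UNIV. ?C $ k $ j * ?A $ b $ c * ?Q j b)) =
      (\<Sum>j\<in>UNIV. \<Sum>b\<in>UNIV. (\<Sum>c\<in>UNIV. \<Sum>k\<in>UNIV. n c k * ?A $ b $ c * ?C $ k $ j) * ?Q j b)" for n
  proof -
    have "(\<Sum>k\<in>UNIV. \<Sum>c\<in>UNIV. n c k * (\<Sum>j\<in>UNIV. \<Sum>b\<in>UNIV. ?C $ k $ j * ?A $ b $ c * ?Q j b)) =
        (\<Sum>c\<in>UNIV. \<Sum>k\<in>UNIV. \<Sum>j\<in>UNIV. \<Sum>b\<in>UNIV. n c k * ?A $ b $ c * ?C $ k $ j * ?Q j b)"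
      by (subst sum.swap) (simp add: sum_distrib_left algebra_simps)
    also have "\<dots> = (\<Sum>j\<in>UNIV. \<Sum>b\<in>UNIV. \<Sum>c\<in>UNIV. \<Sum>k\<in>UNIV. n c k * ?A $ b $ c * ?C $ k $ j * ?Q j b)"
      by (rule sum4_swap)
    finally show ?thesis by (simp only: sum_distrib_right)
  qed
  show ?thesis
  proof (cases d rule: dir_cases)
    case (1 a)
    show ?thesis
      by (simp add: 1 sum_dir del_t_def t vert N left_diff_distrib sum_subtractf swap sum_exchange right_diff_distrib)
  next
    case (2 i)
    show ?thesis
      by (simp add: 2 sum_dir del_x_def x vert N left_diff_distrib sum_subtractf swap sum_exchange right_diff_distrib)
  next
    case (3 k c)
    show ?thesis
      by (simp add: 3 sum_dir vert)
  qed
qed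

lemma frame_jac_smooth:
  assumes "K \<in> jcharts G" "K' \<in> jcharts G"
  shows "frame_jac K K' d' d \<in> smooth_funs G (jdom G K \<inter> jdom G K')"
proof -
  have *: "(\<lambda>e. jac (snd K') (snd K) (fst (snd e)) $ i $ j) \<in> smooth_funs G (jdom G K \<inter> jdom G K')" for i j
    using jac_smooth_funs(2)[OF assms(2,1)] by (simp add: Int_commute)
  have o: "jet_open G (jdom G K \<inter> jdom G K')"
    by (intro jet_open_Int jet_open_jdom assms)
  show ?thesis
    by (cases d rule: dir_cases; cases d' rule: dir_cases)
       (simp_all add: jac_smooth_funs[OF assms] smooth_funs_const smooth_funs_mult[OF o *])
qed

end


section \<open>Linear connections and curvature\<close>

context jet_bundle
begin

text \<open>Linearity over smooth functions, up to \<open>vf_eq\<close>. Compatibility with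
  \<open>vf_eq\<close> is part of it, since an operator on representatives might otherwise react to
  their junk values.\<close>

definition tensorial where
  "tensorial W L \<longleftrightarrow>
     (\<forall>X\<in>vector_fields G W. L X \<in> vector_fields G W) \<and>
     (\<forall>X\<in>vector_fields G W. \<forall>X'\<in>vector_fields G W. vf_eq G W X X' \<longrightarrow> vf_eq G W (L X) (L X')) \<and>
     (\<forall>X\<in>vector_fields G W. \<forall>X'\<in>vector_fields G W. vf_eq G W (L (vf_add X X')) (vf_add (L X) (L X'))) \<and>
     (\<forall>X\<in>vector_fields G W. \<forall>h\<in>smooth_funs G W. vf_eq G W (L (vf_scale h X)) (vf_scale h (L X)))"

lemma vf_zero_eq_scale: "vf_zero = vf_scale (\<lambda>e. 0) X"
  by (simp add: vf_zero_def vf_scale_def)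

lemma tensorial_comb:
  fixes g :: "'i::finite \<Rightarrow> _"
  assumes L: "tensorial W L" and X: "\<And>s. X s \<in> vector_fields G W" and g: "\<And>s. g s \<in> smooth_funs G W"
  shows "vf_eq G W (L (vf_comb g X)) (vf_comb g (\<lambda>s. L (X s)))"
proof -
  have "vf_eq G W (L (vf_sum A g X)) (vf_sum A g (\<lambda>s. L (X s)))" for A
    using finite[of A]
  proof induction
    case empty
    \<comment> \<open>The empty combination is written as a multiple by the zero function, so that
      homogeneity applies to it.\<close>
    have "vf_eq G W (L (vf_scale (\<lambda>e. 0) vf_zero)) (vf_scale (\<lambda>e. 0) (L vf_zero))"
      using L vf_zero_field smooth_funs_const unfolding tensorial_def by blast
    then show ?case
      unfolding vf_sum_empty vf_zero_eq_scale[symmetric] .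
  next
    case (insert s A)
    have f: "vf_scale (g s) (X s) \<in> vector_fields G W" "vf_sum A g X \<in> vector_fields G W"
      by (intro vf_scale_field vf_sum_field X g finite)+
    have "vf_eq G W (L (vf_add (vf_scale (g s) (X s)) (vf_sum A g X)))
        (vf_add (L (vf_scale (g s) (X s))) (L (vf_sum A g X)))"
      using L f unfolding tensorial_def by blast
    moreover have "vf_eq G W (L (vf_scale (g s) (X s))) (vf_scale (g s) (L (X s)))"
      using L X g unfolding tensorial_def by blast
    ultimately show ?case
      unfolding vf_sum_insert[OF insert.hyps]
      using vf_eq_trans vf_eq_add[OF _ insert.IH] by blast
  qed
  then show ?thesis unfolding vf_comb_eq_sum .
qed

end

locale connection_bundle = jet_bundle +
  assumes linear: "linear_connection G"
begin

lemma conn_field: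
  "jet_open G W \<Longrightarrow> X \<in> vector_fields G W \<Longrightarrow> Y \<in> vector_fields G W \<Longrightarrow> conn G X Y \<in> vector_fields G W"
  using linear unfolding linear_connection_def by (elim allE impE) (assumption, elim conjE, drule (1) bspec, erule (1) bspec)

lemma conn_cong:
  assumes "jet_open G W" "X \<in> vector_fields G W" "X' \<in> vector_fields G W" "vf_eq G W X X'"
    "Y \<in> vector_fields G W" "Y' \<in> vector_fields G W" "vf_eq G W Y Y'"
  shows "vf_eq G W (conn G X Y) (conn G X' Y')"
  using linear[unfolded linear_connection_def, rule_format, OF assms(1), THEN conjunct2, THEN conjunct1,
      THEN bspec, THEN bspec, THEN bspec, THEN bspec, THEN mp, OF assms(2,3,5,6)] assms(4,7) by blast

lemma conn_add:
  assumes "jet_open G W" "X \<in> vector_fields G W" "Y \<in> vector_fields G W" "Z \<in> vector_fields G W"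
  shows "vf_eq G W (conn G (vf_add X Y) Z) (vf_add (conn G X Z) (conn G Y Z))"
    "vf_eq G W (conn G X (vf_add Y Z)) (vf_add (conn G X Y) (conn G X Z))"
  using linear[unfolded linear_connection_def, rule_format, OF assms(1), THEN conjunct2, THEN conjunct2,
      THEN conjunct1, THEN bspec, THEN bspec, THEN bspec, OF assms(2-4)] by blast+

lemma conn_scale:
  assumes "jet_open G W" "X \<in> vector_fields G W" "Y \<in> vector_fields G W" "f \<in> smooth_funs G W"
  shows "vf_eq G W (conn G (vf_scale f X) Y) (vf_scale f (conn G X Y))"
    "vf_eq G W (conn G X (vf_scale f Y)) (vf_add (vf_scale (X f) Y) (vf_scale f (conn G X Y)))"
  using linear[unfolded linear_connection_def, rule_format, OF assms(1), THEN conjunct2, THEN conjunct2,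
      THEN conjunct2, THEN bspec, THEN bspec, THEN bspec, OF assms(2-4)] by blast+

lemma conn_tensorial:
  assumes W: "jet_open G W" and Y: "Y \<in> vector_fields G W"
  shows "tensorial W (\<lambda>X. conn G X Y)"
  unfolding tensorial_def
  by (intro conjI ballI impI conn_field[OF W _ Y] conn_cong[OF W _ _ _ Y Y vf_eq_refl]
      conn_add(1)[OF W _ _ Y] conn_scale(1)[OF W _ Y])

lemma conn_leibniz_comb:
  fixes g :: "'i::finite \<Rightarrow> _"
  assumes W: "jet_open G W" and X: "X \<in> vector_fields G W" and Y: "\<And>s. Y s \<in> vector_fields G W"
    and g: "\<And>s. g s \<in> smooth_funs G W"
  shows "vf_eq G W (conn G X (vf_comb g Y)) (vf_add (vf_comb (\<lambda>s. X (g s)) Y) (vf_comb g (\<lambda>s. conn G X (Y s))))"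
proof -
  have "vf_eq G W (conn G X (vf_sum A g Y)) (vf_add (vf_sum A (\<lambda>s. X (g s)) Y) (vf_sum A g (\<lambda>s. conn G X (Y s))))"
    for A using finite[of A]
  proof induction
    case empty
    have "vf_eq G W (conn G X (vf_scale (\<lambda>e. 0) vf_zero))
        (vf_add (vf_scale (X (\<lambda>e. 0)) vf_zero) (vf_scale (\<lambda>e. 0) (conn G X vf_zero)))"
      by (rule conn_scale(2)[OF W X vf_zero_field smooth_funs_const])
    then show ?case
      unfolding vf_sum_empty vf_zero_eq_scale[symmetric] by (simp add: vf_zero_def vf_add_def vf_scale_def)
  next
    case (insert s A)
    have f: "vf_scale (g s) (Y s) \<in> vector_fields G W" "vf_sum A g Y \<in> vector_fields G W"
      by (intro vf_scale_field vf_sum_field Y g finite)+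
    note 1 = conn_add(2)[OF W X f]
    note 2 = conn_scale(2)[OF W X Y g, of s s]
    show ?case
    proof (rule vf_eqI)
      fix V f e assume V: "jet_open G V" "V \<subseteq> W" "f \<in> smooth_funs G V" "e \<in> V"
      show "conn G X (vf_sum (insert s A) g Y) f e =
          vf_add (vf_sum (insert s A) (\<lambda>s. X (g s)) Y) (vf_sum (insert s A) g (\<lambda>s. conn G X (Y s))) f e"
        unfolding vf_sum_insert[OF insert.hyps]
        using vf_eqD[OF 1 V] vf_eqD[OF 2 V] vf_eqD[OF insert.IH V] by (simp add: vf_add_def)
    qed
  qed
  then show ?thesis unfolding vf_comb_eq_sum .
qed

section \<open>The curvature operator and its linearity over smooth functions\<close>

lemma curvature_field:
  "jet_open G W \<Longrightarrow> X \<in> vector_fields G W \<Longrightarrow> Y \<in> vector_fields G W \<Longrightarrow> Z \<in> vector_fields G W \<Longrightarrow>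
    curvature G X Y Z \<in> vector_fields G W"
  unfolding curvature_def by (intro vf_diff_field conn_field lie_bracket_field)

lemma curvature_cong:
  assumes W: "jet_open G W"
    and X: "X \<in> vector_fields G W" "X' \<in> vector_fields G W" "vf_eq G W X X'"
    and Y: "Y \<in> vector_fields G W" "Y' \<in> vector_fields G W" "vf_eq G W Y Y'"
    and Z: "Z \<in> vector_fields G W" "Z' \<in> vector_fields G W" "vf_eq G W Z Z'"
  shows "vf_eq G W (curvature G X Y Z) (curvature G X' Y' Z')"
  unfolding curvature_def
  by (intro vf_eq_diff conn_cong[OF W] conn_field[OF W] lie_bracket_field vf_eq_lie_bracket X Y Z)

text \<open>Comes from the antisymmetry of the bracket; it transfers linearity from the first slot
  to the second.\<close>

lemma curvature_swap:
  assumes W: "jet_open G W" and X: "X \<in> vector_fields G W" and Y: "Y \<in> vector_fields G W" and Z: "Z \<in> vector_fields G W"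
  shows "vf_eq G W (curvature G X Y Z) (vf_scale (\<lambda>e. - 1) (curvature G Y X Z))"
proof -
  have "lie_bracket X Y = vf_scale (\<lambda>e. - 1) (lie_bracket Y X)"
    by (simp add: lie_bracket_def vf_scale_def)
  then have 1: "vf_eq G W (conn G (lie_bracket X Y) Z) (vf_scale (\<lambda>e. - 1) (conn G (lie_bracket Y X) Z))"
    using conn_scale(1)[OF W lie_bracket_field[OF Y X] Z smooth_funs_const] by simp
  show ?thesis
  proof (rule vf_eqI)
    fix V f e assume "jet_open G V" "V \<subseteq> W" "f \<in> smooth_funs G V" "e \<in> V"
    from vf_eqD[OF 1 this] show "curvature G X Y Z f e = vf_scale (\<lambda>e. - 1) (curvature G Y X Z) f e"
      by (simp add: curvature_def vf_diff_def vf_scale_def)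
  qed
qed

text \<open>Derivatives of a factor \<open>h\<close> arise twice: when \<open>Y\<close>
  differentiates \<open>h\<close> times the derivative of \<open>Z\<close> along \<open>X\<close>,
  and from the bracket of \<open>h X\<close> with \<open>Y\<close>, which is
  \<open>h [X, Y] - (Y h) X\<close>. The two contributions cancel.\<close>

lemma curvature_tensorial_1:
  assumes W: "jet_open G W" and Y: "Y \<in> vector_fields G W" and Z: "Z \<in> vector_fields G W"
  shows "tensorial W (\<lambda>X. curvature G X Y Z)"
  unfolding tensorial_def
proof (intro conjI ballI impI)
  fix X assume X: "X \<in> vector_fields G W"
  note cf = conn_field[OF W]
  show "curvature G X Y Z \<in> vector_fields G W" by (rule curvature_field[OF W X Y Z])
  show "vf_eq G W (curvature G X Y Z) (curvature G X' Y Z)" if "X' \<in> vector_fields G W" "vf_eq G W X X'" for X'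
    by (rule curvature_cong[OF W X that Y Y vf_eq_refl Z Z vf_eq_refl])
  show "vf_eq G W (curvature G (vf_add X X') Y Z) (vf_add (curvature G X Y Z) (curvature G X' Y Z))"
    if X': "X' \<in> vector_fields G W" for X'
  proof -
    note XX = vf_add_field[OF X X']
    note 1 = conn_add(1)[OF W X X' cf[OF Y Z]]
    have 2: "vf_eq G W (conn G Y (conn G (vf_add X X') Z)) (vf_add (conn G Y (conn G X Z)) (conn G Y (conn G X' Z)))"
      by (rule vf_eq_trans[OF conn_cong[OF W Y Y vf_eq_refl cf[OF XX Z] vf_add_field[OF cf[OF X Z] cf[OF X' Z]]
              conn_add(1)[OF W X X' Z]] conn_add(2)[OF W Y cf[OF X Z] cf[OF X' Z]]])
    have "vf_eq G W (lie_bracket (vf_add X X') Y) (vf_add (lie_bracket X Y) (lie_bracket X' Y))"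
    proof (rule vf_eqI)
      fix V f e assume V: "jet_open G V" "V \<subseteq> W" and f: "f \<in> smooth_funs G V" and e: "e \<in> V"
      note s = vector_fields_subset[OF _ V(2)]
      show "lie_bracket (vf_add X X') Y f e = vf_add (lie_bracket X Y) (lie_bracket X' Y) f e"
        using vf_apply_add[OF s[OF Y] V(1) vf_smooth[OF s[OF X] V(1) f] vf_smooth[OF s[OF X'] V(1) f] e]
        by (simp add: lie_bracket_def vf_add_def)
    qed
    note br = this
    have 3: "vf_eq G W (conn G (lie_bracket (vf_add X X') Y) Z)
        (vf_add (conn G (lie_bracket X Y) Z) (conn G (lie_bracket X' Y) Z))"
      by (rule vf_eq_trans[OF conn_cong[OF W lie_bracket_field[OF XX Y] _ br Z Z vf_eq_refl]])
         (intro vf_add_field lie_bracket_field X X' Y conn_add(1)[OF W _ _ Z])+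
    show ?thesis
    proof (rule vf_eqI)
      fix V f e assume V: "jet_open G V" "V \<subseteq> W" "f \<in> smooth_funs G V" "e \<in> V"
      show "curvature G (vf_add X X') Y Z f e = vf_add (curvature G X Y Z) (curvature G X' Y Z) f e"
        using vf_eqD[OF 1 V] vf_eqD[OF 2 V] vf_eqD[OF 3 V] by (simp add: curvature_def vf_diff_def vf_add_def[abs_def])
    qed
  qed
  show "vf_eq G W (curvature G (vf_scale h X) Y Z) (vf_scale h (curvature G X Y Z))"
    if h: "h \<in> smooth_funs G W" for h
  proof -
    note hX = vf_scale_field[OF X h]
    have Yh: "Y h \<in> smooth_funs G W" by (rule vf_smooth[OF Y W h])
    have mYh: "(\<lambda>e. - Y h e) \<in> smooth_funs G W" by (rule smooth_funs_minus[OF W Yh])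
    note 1 = conn_scale(1)[OF W X cf[OF Y Z] h]
    have 2: "vf_eq G W (conn G Y (conn G (vf_scale h X) Z))
        (vf_add (vf_scale (Y h) (conn G X Z)) (vf_scale h (conn G Y (conn G X Z))))"
      by (rule vf_eq_trans[OF conn_cong[OF W Y Y vf_eq_refl cf[OF hX Z] vf_scale_field[OF cf[OF X Z] h]
              conn_scale(1)[OF W X Z h]] conn_scale(2)[OF W Y cf[OF X Z] h]])
    note lf = lie_bracket_field[OF X Y]
    have br: "vf_eq G W (lie_bracket (vf_scale h X) Y) (vf_add (vf_scale h (lie_bracket X Y)) (vf_scale (\<lambda>e. - Y h e) X))"
    proof (rule vf_eqI)
      fix V f e assume V: "jet_open G V" "V \<subseteq> W" and f: "f \<in> smooth_funs G V" and e: "e \<in> V"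
      note s = vector_fields_subset[OF _ V(2)]
      show "lie_bracket (vf_scale h X) Y f e =
          vf_add (vf_scale h (lie_bracket X Y)) (vf_scale (\<lambda>e. - Y h e) X) f e"
        using vf_apply_mult[OF s[OF Y] V(1) smooth_funs_subset[OF h V(2)] vf_smooth[OF s[OF X] V(1) f] e]
        by (simp add: lie_bracket_def vf_add_def vf_scale_def algebra_simps)
    qed
    note rf = vf_add_field[OF vf_scale_field[OF lf h] vf_scale_field[OF X mYh]]
    note 3 = conn_cong[OF W lie_bracket_field[OF hX Y] rf br Z Z vf_eq_refl]
    note 4 = conn_add(1)[OF W vf_scale_field[OF lf h] vf_scale_field[OF X mYh] Z]
    note 5 = conn_scale(1)[OF W lf Z h] and 6 = conn_scale(1)[OF W X Z mYh]
    show ?thesis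
    proof (rule vf_eqI)
      fix V f e assume V: "jet_open G V" "V \<subseteq> W" "f \<in> smooth_funs G V" "e \<in> V"
      show "curvature G (vf_scale h X) Y Z f e = vf_scale h (curvature G X Y Z) f e"
        using vf_eqD[OF 1 V] vf_eqD[OF 2 V] vf_eqD[OF 3 V] vf_eqD[OF 4 V] vf_eqD[OF 5 V] vf_eqD[OF 6 V]
        unfolding curvature_def vf_diff_def vf_scale_def[of h "\<lambda>f e. _ f e"] vf_add_def[of "vf_scale _ _"]
          vf_add_def[of "conn G _ _"]
        by (simp add: vf_scale_def[where X = "conn G _ _"] algebra_simps)
    qed
  qed
qed

text \<open>Terms with first derivatives of \<open>h\<close> are symmetric in \<open>X\<close> and
  \<open>Y\<close> and drop out. The second derivatives leave \<open>[X, Y] h\<close>, which the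
  bracket term of the curvature removes.\<close>

lemma curvature_tensorial_3:
  assumes W: "jet_open G W" and X: "X \<in> vector_fields G W" and Y: "Y \<in> vector_fields G W"
  shows "tensorial W (\<lambda>Z. curvature G X Y Z)"
  unfolding tensorial_def
proof (intro conjI ballI impI)
  fix Z assume Z: "Z \<in> vector_fields G W"
  note cf = conn_field[OF W] and lf = lie_bracket_field[OF X Y]
  show "curvature G X Y Z \<in> vector_fields G W" by (rule curvature_field[OF W X Y Z])
  show "vf_eq G W (curvature G X Y Z) (curvature G X Y Z')" if "Z' \<in> vector_fields G W" "vf_eq G W Z Z'" for Z'
    by (rule curvature_cong[OF W X X vf_eq_refl Y Y vf_eq_refl Z that])
  show "vf_eq G W (curvature G X Y (vf_add Z Z')) (vf_add (curvature G X Y Z) (curvature G X Y Z'))"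
    if Z': "Z' \<in> vector_fields G W" for Z'
  proof -
    note ZZ = vf_add_field[OF Z Z']
    have 1: "vf_eq G W (conn G A (conn G B (vf_add Z Z'))) (vf_add (conn G A (conn G B Z)) (conn G A (conn G B Z')))"
      if A: "A \<in> vector_fields G W" and B: "B \<in> vector_fields G W" for A B
      by (rule vf_eq_trans[OF conn_cong[OF W A A vf_eq_refl cf[OF B ZZ] vf_add_field[OF cf[OF B Z] cf[OF B Z']]
              conn_add(2)[OF W B Z Z']] conn_add(2)[OF W A cf[OF B Z] cf[OF B Z']]])
    note 3 = conn_add(2)[OF W lf Z Z']
    show ?thesis
    proof (rule vf_eqI)
      fix V f e assume V: "jet_open G V" "V \<subseteq> W" "f \<in> smooth_funs G V" "e \<in> V"
      show "curvature G X Y (vf_add Z Z') f e = vf_add (curvature G X Y Z) (curvature G X Y Z') f e"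
        using vf_eqD[OF 1[OF X Y] V] vf_eqD[OF 1[OF Y X] V] vf_eqD[OF 3 V]
        by (simp add: curvature_def vf_diff_def vf_add_def[abs_def])
    qed
  qed
  show "vf_eq G W (curvature G X Y (vf_scale h Z)) (vf_scale h (curvature G X Y Z))"
    if h: "h \<in> smooth_funs G W" for h
  proof -
    note hZ = vf_scale_field[OF Z h]
    have hs: "A h \<in> smooth_funs G W" if "A \<in> vector_fields G W" for A by (rule vf_smooth[OF that W h])
    have 1: "conn G A (conn G B (vf_scale h Z)) f e =
        A (B h) e * Z f e + B h e * conn G A Z f e + A h e * conn G B Z f e + h e * conn G A (conn G B Z) f e"
      if A: "A \<in> vector_fields G W" and B: "B \<in> vector_fields G W"
      and V: "jet_open G V" "V \<subseteq> W" "f \<in> smooth_funs G V" "e \<in> V" for A B V f e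
    proof -
      note s1 = vf_scale_field[OF Z hs[OF B]] and s2 = vf_scale_field[OF cf[OF B Z] h]
      note a = conn_cong[OF W A A vf_eq_refl cf[OF B hZ] vf_add_field[OF s1 s2] conn_scale(2)[OF W B Z h]]
      note b = conn_add(2)[OF W A s1 s2] and c = conn_scale(2)[OF W A Z hs[OF B]]
        and d = conn_scale(2)[OF W A cf[OF B Z] h]
      have "conn G A (conn G B (vf_scale h Z)) f e =
          conn G A (vf_scale (B h) Z) f e + conn G A (vf_scale h (conn G B Z)) f e"
        using vf_eqD[OF a V] vf_eqD[OF b V] by (simp add: vf_add_def)
      also have "\<dots> = A (B h) e * Z f e + B h e * conn G A Z f e + (A h e * conn G B Z f e + h e * conn G A (conn G B Z) f e)"
        unfolding vf_eqD[OF c V] vf_eqD[OF d V] by (simp add: vf_add_def vf_scale_def)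
      finally show ?thesis by simp
    qed
    note 3 = conn_scale(2)[OF W lf Z h]
    show ?thesis
    proof (rule vf_eqI)
      fix V f e assume V: "jet_open G V" "V \<subseteq> W" "f \<in> smooth_funs G V" "e \<in> V"
      show "curvature G X Y (vf_scale h Z) f e = vf_scale h (curvature G X Y Z) f e"
        unfolding curvature_def vf_diff_def 1[OF X Y V] 1[OF Y X V] vf_eqD[OF 3 V]
        by (simp add: vf_add_def vf_scale_def lie_bracket_def algebra_simps)
    qed
  qed
qed

lemma curvature_comb_1:
  fixes g :: "'i::finite \<Rightarrow> _"
  assumes "jet_open G W" "\<And>s. X s \<in> vector_fields G W" "\<And>s. g s \<in> smooth_funs G W"
    "Y \<in> vector_fields G W" "Z \<in> vector_fields G W"
  shows "vf_eq G W (curvature G (vf_comb g X) Y Z) (vf_comb g (\<lambda>s. curvature G (X s) Y Z))"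
  by (rule tensorial_comb[OF curvature_tensorial_1[OF assms(1,4,5)] assms(2,3)])

lemma curvature_comb_2:
  fixes g :: "'i::finite \<Rightarrow> _"
  assumes W: "jet_open G W" and Y: "\<And>s. Y s \<in> vector_fields G W" and g: "\<And>s. g s \<in> smooth_funs G W"
    and X: "X \<in> vector_fields G W" and Z: "Z \<in> vector_fields G W"
  shows "vf_eq G W (curvature G X (vf_comb g Y) Z) (vf_comb g (\<lambda>s. curvature G X (Y s) Z))"
proof (rule vf_eqI)
  fix V f e assume V: "jet_open G V" "V \<subseteq> W" "f \<in> smooth_funs G V" "e \<in> V"
  have "curvature G X (vf_comb g Y) Z f e = - curvature G (vf_comb g Y) X Z f e"
    unfolding vf_eqD[OF curvature_swap[OF W X vf_comb_field[OF Y g] Z] V] by (simp add: vf_scale_def)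
  also have "\<dots> = - (\<Sum>s\<in>UNIV. g s e * curvature G (Y s) X Z f e)"
    unfolding vf_eqD[OF curvature_comb_1[OF W Y g X Z] V] by (simp add: vf_comb_def)
  also have "\<dots> = vf_comb g (\<lambda>s. curvature G X (Y s) Z) f e"
    by (simp add: vf_comb_def vf_eqD[OF curvature_swap[OF W X Y Z] V] vf_scale_def sum_negf)
  finally show "curvature G X (vf_comb g Y) Z f e = vf_comb g (\<lambda>s. curvature G X (Y s) Z) f e" .
qed

lemma curvature_comb_3:
  fixes g :: "'i::finite \<Rightarrow> _"
  assumes "jet_open G W" "\<And>s. Z s \<in> vector_fields G W" "\<And>s. g s \<in> smooth_funs G W"
    "X \<in> vector_fields G W" "Y \<in> vector_fields G W"
  shows "vf_eq G W (curvature G X Y (vf_comb g Z)) (vf_comb g (\<lambda>s. curvature G X Y (Z s)))"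
  by (rule tensorial_comb[OF curvature_tensorial_3[OF assms(1,4,5)] assms(2,3)])

text \<open>Cartan's structure equation for a family \<open>E\<close> that may span only a
  subbundle: it is enough that derivatives along \<open>X\<close>, \<open>Y\<close> and along the
  fields \<open>Q\<close>, in which the bracket is expanded, stay in the span of \<open>E\<close>.
  Each block of the adapted frame qualifies.\<close>

lemma curvature_structure_equation:
  fixes E :: "'i::finite \<Rightarrow> _" and Q :: "'j::finite \<Rightarrow> _"
  assumes W: "jet_open G W" and X: "X \<in> vector_fields G W" and Y: "Y \<in> vector_fields G W"
    and E: "\<And>s. E s \<in> vector_fields G W" and Q: "\<And>r. Q r \<in> vector_fields G W"
    and wX: "\<And>s s'. wX s s' \<in> smooth_funs G W" "\<And>s. vf_eq G W (conn G X (E s)) (vf_comb (wX s) E)"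
    and wY: "\<And>s s'. wY s s' \<in> smooth_funs G W" "\<And>s. vf_eq G W (conn G Y (E s)) (vf_comb (wY s) E)"
    and \<tau>: "\<And>r. \<tau> r \<in> smooth_funs G W" "vf_eq G W (lie_bracket X Y) (vf_comb \<tau> Q)"
    and wQ: "\<And>r s. vf_eq G W (conn G (Q r) (E s)) (vf_comb (wQ r s) E)"
  shows "vf_eq G W (curvature G X Y (E s)) (vf_comb (\<lambda>s' e.
      X (wY s s') e - Y (wX s s') e + (\<Sum>r\<in>UNIV. wY s r e * wX r s' e) - (\<Sum>r\<in>UNIV. wX s r e * wY r s' e)
      - (\<Sum>r\<in>UNIV. \<tau> r e * wQ r s s' e)) E)"
proof (rule vf_eqI)
  fix V f e assume V: "jet_open G V" "V \<subseteq> W" "f \<in> smooth_funs G V" "e \<in> V"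
  \<comment> \<open>Collects a derivative of a derivative by basis field: the coefficients multiply
    like matrices.\<close>
  have nested: "(\<Sum>r\<in>UNIV. a r * (\<Sum>s'\<in>UNIV. b r s' * E s' f e)) = (\<Sum>s'\<in>UNIV. (\<Sum>r\<in>UNIV. a r * b r s') * E s' f e)"
    for a :: "'i \<Rightarrow> real" and b
    by (simp only: sum_distrib_left sum_distrib_right mult.assoc) (rule sum.swap)
  have nested': "(\<Sum>r\<in>UNIV. a r * (\<Sum>s'\<in>UNIV. b r s' * E s' f e)) = (\<Sum>s'\<in>UNIV. (\<Sum>r\<in>UNIV. a r * b r s') * E s' f e)"
    for a :: "'j \<Rightarrow> real" and b
    by (simp only: sum_distrib_left sum_distrib_right mult.assoc) (rule sum.swap)
  have second: "conn G A (conn G B (E s)) f e =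
      (\<Sum>s'\<in>UNIV. A (wB s s') e * E s' f e) + (\<Sum>s'\<in>UNIV. (\<Sum>r\<in>UNIV. wB s r e * wA r s' e) * E s' f e)"
    if A: "A \<in> vector_fields G W" and B: "B \<in> vector_fields G W"
    and wA: "\<And>s. vf_eq G W (conn G A (E s)) (vf_comb (wA s) E)"
    and wB: "\<And>s s'. wB s s' \<in> smooth_funs G W" "\<And>s. vf_eq G W (conn G B (E s)) (vf_comb (wB s) E)" for A B wA wB
  proof -
    note 1 = conn_cong[OF W A A vf_eq_refl conn_field[OF W B E] vf_comb_field[OF E wB(1)] wB(2)]
    note 2 = conn_leibniz_comb[OF W A E, where g = "wB s", OF wB(1)]
    have "conn G A (conn G B (E s)) f e =
        (\<Sum>s'\<in>UNIV. A (wB s s') e * E s' f e) + (\<Sum>r\<in>UNIV. wB s r e * conn G A (E r) f e)"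
      using vf_eqD[OF 1 V] vf_eqD[OF 2 V] by (simp add: vf_add_def vf_comb_def)
    then show ?thesis
      unfolding vf_eqD[OF wA V] vf_comb_def nested .
  qed
  have "conn G (lie_bracket X Y) (E s) f e = conn G (vf_comb \<tau> Q) (E s) f e"
    by (rule vf_eqD[OF conn_cong[OF W lie_bracket_field[OF X Y] vf_comb_field[OF Q \<tau>(1)] \<tau>(2) E E vf_eq_refl] V])
  also have "\<dots> = (\<Sum>r\<in>UNIV. \<tau> r e * conn G (Q r) (E s) f e)"
    unfolding vf_eqD[OF tensorial_comb[OF conn_tensorial[OF W E] Q \<tau>(1)] V] by (simp add: vf_comb_def)
  also have "\<dots> = (\<Sum>s'\<in>UNIV. (\<Sum>r\<in>UNIV. \<tau> r e * wQ r s s' e) * E s' f e)"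
    unfolding vf_eqD[OF wQ V] vf_comb_def nested' ..
  finally have 3: "conn G (lie_bracket X Y) (E s) f e = (\<Sum>s'\<in>UNIV. (\<Sum>r\<in>UNIV. \<tau> r e * wQ r s s' e) * E s' f e)" .
  show "curvature G X Y (E s) f e = vf_comb (\<lambda>s' e.
      X (wY s s') e - Y (wX s s') e + (\<Sum>r\<in>UNIV. wY s r e * wX r s' e) - (\<Sum>r\<in>UNIV. wX s r e * wY r s' e)
      - (\<Sum>r\<in>UNIV. \<tau> r e * wQ r s s' e)) E f e"
    unfolding curvature_def vf_diff_def second[OF X Y wX(2) wY] second[OF Y X wY(2) wX] 3 vf_comb_def
    by (simp add: left_diff_distrib distrib_right sum.distrib sum_subtractf)
qed

end


section \<open>Components of an $h$-normal connection\<close>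

text \<open>The connection forms of the three blocks merge the components for the three kinds of
  directions. Arguments: direction, differentiated basis field, resulting component.\<close>

definition conn_T :: "('t, 'm::finite, 'x, 'n::finite) jet_data \<Rightarrow> ('t, 'm, 'x, 'n) jchart \<Rightarrow> ('m, 'n) dir \<Rightarrow>
    'm \<Rightarrow> 'm \<Rightarrow> ('t, 'm, 'x, 'n) jpoint \<Rightarrow> real" where
  "conn_T G K d b a = d_t K a (conn G (frame G K d) (del_t G K b))"

definition conn_M :: "('t, 'm::finite, 'x, 'n::finite) jet_data \<Rightarrow> ('t, 'm, 'x, 'n) jchart \<Rightarrow> ('m, 'n) dir \<Rightarrow>
    'n \<Rightarrow> 'n \<Rightarrow> ('t, 'm, 'x, 'n) jpoint \<Rightarrow> real" where
  "conn_M G K d j i = d_x K i (conn G (frame G K d) (del_x G K j))"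

text \<open>The plain coefficient; \<open>A_V\<close>, \<open>H_V\<close> and \<open>C_V\<close> are
  its negatives.\<close>

definition conn_V :: "('t, 'm::finite, 'x, 'n::finite) jet_data \<Rightarrow> ('t, 'm, 'x, 'n) jchart \<Rightarrow> ('m, 'n) dir \<Rightarrow>
    'n \<times> 'm \<Rightarrow> 'n \<times> 'm \<Rightarrow> ('t, 'm, 'x, 'n) jpoint \<Rightarrow> real" where
  "conn_V G K d s = (\<lambda>(i, a). del_p G K a i (conn G (frame G K d) (vert G K s)))"

text \<open>The curvature matrix of a block with connection form \<open>w\<close>. In each product
  the factor of the inner derivative comes first, because the first block index of \<open>w\<close>
  is the differentiated field; the last sum accounts for the vertical bracket of the two frame
  fields.\<close>

definition curv_form :: "('t, 'm::finite, 'x, 'n::finite) jet_data \<Rightarrow> ('t, 'm, 'x, 'n) jchart \<Rightarrow>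
    (('m, 'n) dir \<Rightarrow> 'i::finite \<Rightarrow> 'i \<Rightarrow> ('t, 'm, 'x, 'n) jpoint \<Rightarrow> real) \<Rightarrow>
    ('m, 'n) dir \<Rightarrow> ('m, 'n) dir \<Rightarrow> 'i \<Rightarrow> 'i \<Rightarrow> ('t, 'm, 'x, 'n) jpoint \<Rightarrow> real" where
  "curv_form G K w d d' s s' e =
     frame G K d (w d' s s') e - frame G K d' (w d s s') e
     + (\<Sum>r\<in>UNIV. w d' s r e * w d r s' e) - (\<Sum>r\<in>UNIV. w d s r e * w d' r s' e)
     - (\<Sum>r\<in>UNIV. tau G K d d' r e * w (Inr (Inr r)) s s' e)"

lemma sum_frame_jac:
  "(\<Sum>c\<in>UNIV. frame_jac K K' c (Inl a) e * F c) =
    (\<Sum>b\<in>UNIV. jac (fst K) (fst K') (fst e) $ b $ a * F (Inl b))"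
  "(\<Sum>c\<in>UNIV. frame_jac K K' c (Inr (Inl i)) e * F c) =
    (\<Sum>j\<in>UNIV. jac (snd K) (snd K') (fst (snd e)) $ j $ i * F (Inr (Inl j)))"
  "(\<Sum>c\<in>UNIV. frame_jac K K' c (Inr (Inr (i, a))) e * F c) =
    (\<Sum>j\<in>UNIV. \<Sum>b\<in>UNIV. jac (snd K') (snd K) (fst (snd e)) $ i $ j *
      jac (fst K) (fst K') (fst e) $ b $ a * F (Inr (Inr (j, b))))"
  by (simp_all add: sum_dir)

lemma sum_kron:
  fixes f :: "'i::finite \<Rightarrow> real"
  shows "(\<Sum>i\<in>UNIV. f i * kron i j) = f j" "(\<Sum>i\<in>UNIV. f i * kron j i) = f j"
    "(\<Sum>i\<in>UNIV. kron i j * f i) = f j" "(\<Sum>i\<in>UNIV. kron j i * f i) = f j"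
  by (simp_all add: kron_def if_distrib[where f = "\<lambda>x. x * _"] if_distrib[where f = "\<lambda>x. _ * x"] cong: if_cong)

locale N_linear_bundle = nl_jet_bundle G
  for G :: "('t::topological_space, 'm::finite, 'x::topological_space, 'n::finite) jet_data" +
  assumes N_linear: "N_linear_connection G"

sublocale N_linear_bundle \<subseteq> connection_bundle
  by unfold_locales (use N_linear in \<open>simp add: N_linear_connection_def\<close>)

context N_linear_bundle
begin

lemma frame_coords:
  assumes K: "K \<in> jcharts G" and e: "e \<in> jdom G K"
  shows "del_t G K b (t_coord K a) e = kron a b" "del_x G K j (x_coord K i) e = kron i j"
    "part_p G K j b (t_coord K a) e = 0" "part_p G K j b (x_coord K i) e = 0"
    "part_p G K j b (p_coord K a i) e = kron i j * kron a b"
  by (simp_all add: del_t_def del_x_def part_t_def part_x_def part_p_def t_coord(2)[OF K e] x_coord(2)[OF K e]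
      p_coord(2)[OF K e] axis_def kron_def)

lemma dual_frame:
  assumes K: "K \<in> jcharts G" and e: "e \<in> jdom G K"
  shows "d_t K a (del_t G K b) e = kron a b" "d_x K i (del_x G K j) e = kron i j"
    "del_p G K a i (part_p G K j b) e = kron i j * kron a b"
  by (simp_all add: d_t_def d_x_def del_p_def frame_coords[OF K e])

lemma proj_frame:
  assumes K: "K \<in> jcharts G"
  shows "vf_eq G (jdom G K) (proj_T G K (del_t G K b)) (del_t G K b)"
    "vf_eq G (jdom G K) (proj_M G K (del_x G K j)) (del_x G K j)"
    "vf_eq G (jdom G K) (proj_V G K (vert G K s)) (vert G K s)"
proof -
  show "vf_eq G (jdom G K) (proj_T G K (del_t G K b)) (del_t G K b)"
    by (rule vf_eqI) (auto simp: proj_T_def vf_comb_def dual_frame[OF K] sum_kron subset_eq)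
  show "vf_eq G (jdom G K) (proj_M G K (del_x G K j)) (del_x G K j)"
    by (rule vf_eqI) (auto simp: proj_M_def vf_comb_def dual_frame[OF K] sum_kron subset_eq)
  obtain j b where s: "s = (j, b)" by (cases s)
  show "vf_eq G (jdom G K) (proj_V G K (vert G K s)) (vert G K s)"
    by (rule vf_eqI)
      (auto simp: s proj_V_def vf_comb_def dual_frame[OF K] sum_kron subset_eq sum_UNIV_Times mult.assoc
        simp flip: sum_distrib_left)
qed

lemma d_t_smooth:
  assumes "K \<in> jcharts G" "X \<in> vector_fields G (jdom G K)" shows "d_t K a X \<in> smooth_funs G (jdom G K)"
  unfolding d_t_def by (rule vf_smooth[OF assms(2) jet_open_jdom[OF assms(1)] t_coord(1)[OF assms(1)]])

lemma d_x_smooth: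
  assumes "K \<in> jcharts G" "X \<in> vector_fields G (jdom G K)" shows "d_x K i X \<in> smooth_funs G (jdom G K)"
  unfolding d_x_def by (rule vf_smooth[OF assms(2) jet_open_jdom[OF assms(1)] x_coord(1)[OF assms(1)]])

lemma del_p_smooth:
  assumes K: "K \<in> jcharts G" and X: "X \<in> vector_fields G (jdom G K)"
  shows "del_p G K a i X \<in> smooth_funs G (jdom G K)"
proof -
  note o = jet_open_jdom[OF K]
  have N: "N1 G K a i b \<in> smooth_funs G (jdom G K)" "N2 G K a i j \<in> smooth_funs G (jdom G K)" for b j
    using nlc_smooth[OF K, of "Inl b" "(i, a)"] nlc_smooth[OF K, of "Inr (Inl j)" "(i, a)"] by simp_all
  have "(\<lambda>e. X (p_coord K a i) e + (\<Sum>b\<in>UNIV. N1 G K a i b e * d_t K b X e)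
      + (\<Sum>j\<in>UNIV. N2 G K a i j e * d_x K j X e)) \<in> smooth_funs G (jdom G K)"
    by (rule smooth_funs_add[OF o smooth_funs_add[OF o vf_smooth[OF X o p_coord(1)[OF K]]
          smooth_funs_sum[OF o smooth_funs_mult[OF o N(1) d_t_smooth[OF K X]]]]
          smooth_funs_sum[OF o smooth_funs_mult[OF o N(2) d_x_smooth[OF K X]]]])
  then show ?thesis by (simp add: del_p_def[abs_def])
qed

lemma del_field:
  assumes "K \<in> jcharts G" "W \<subseteq> jdom G K"
  shows "del_t G K a \<in> vector_fields G W" "del_x G K i \<in> vector_fields G W"
    "part_p G K i a \<in> vector_fields G W"
  using frame_field[OF assms, of "Inl a"] frame_field[OF assms, of "Inr (Inl i)"]
    frame_field[OF assms, of "Inr (Inr (i, a))"] by simp_all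

lemma conn_frame_field:
  assumes "K \<in> jcharts G" "Y \<in> vector_fields G (jdom G K)"
  shows "conn G (frame G K d) Y \<in> vector_fields G (jdom G K)"
  by (rule conn_field[OF jet_open_jdom[OF assms(1)] frame_field[OF assms(1) subset_refl] assms(2)])

lemma conn_smooth:
  assumes K: "K \<in> jcharts G"
  shows "conn_T G K d b a \<in> smooth_funs G (jdom G K)" "conn_M G K d j i \<in> smooth_funs G (jdom G K)"
    "conn_V G K d s s' \<in> smooth_funs G (jdom G K)"
proof -
  note c = conn_frame_field[OF K]
  show "conn_T G K d b a \<in> smooth_funs G (jdom G K)"
    unfolding conn_T_def by (rule d_t_smooth[OF K c[OF del_field(1)[OF K subset_refl]]])
  show "conn_M G K d j i \<in> smooth_funs G (jdom G K)"
    unfolding conn_M_def by (rule d_x_smooth[OF K c[OF del_field(2)[OF K subset_refl]]])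
  show "conn_V G K d s s' \<in> smooth_funs G (jdom G K)"
    unfolding conn_V_def case_prod_beta by (rule del_p_smooth[OF K c[OF del_field(3)[OF K subset_refl]]])
qed

text \<open>A basis field equals its own projection, which N-linearity moves outside the derivative.
  There the projection is by definition an expansion in the block, with coefficients read off by the
  dual basis.\<close>

lemma conn_frame:
  assumes K: "K \<in> jcharts G"
  shows "vf_eq G (jdom G K) (conn G (frame G K d) (del_t G K b)) (vf_comb (conn_T G K d b) (del_t G K))"
    "vf_eq G (jdom G K) (conn G (frame G K d) (del_x G K j)) (vf_comb (conn_M G K d j) (del_x G K))"
    "vf_eq G (jdom G K) (conn G (frame G K d) (vert G K s)) (vf_comb (conn_V G K d s) (vert G K))"
proof -
  note o = jet_open_jdom[OF K] and ff = frame_field[OF K subset_refl]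
  note df = del_field[OF K subset_refl] and vf = vert_field[OF K subset_refl]
  have N: "vf_eq G (jdom G K) (conn G X (proj_T G K Y)) (proj_T G K (conn G X Y)) \<and>
      vf_eq G (jdom G K) (conn G X (proj_M G K Y)) (proj_M G K (conn G X Y)) \<and>
      vf_eq G (jdom G K) (conn G X (proj_V G K Y)) (proj_V G K (conn G X Y))"
    if "X \<in> vector_fields G (jdom G K)" "Y \<in> vector_fields G (jdom G K)" for X Y
    by (rule N_linear[unfolded N_linear_connection_def, THEN conjunct2, rule_format, OF K _ that]) (simp add: o)
  have "vf_eq G (jdom G K) (conn G (frame G K d) (del_t G K b)) (proj_T G K (conn G (frame G K d) (del_t G K b)))"
  proof (rule vf_eq_trans[OF conn_cong[OF o ff ff vf_eq_refl df(1) _ vf_eq_sym[OF proj_frame(1)[OF K]]]])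
    show "proj_T G K (del_t G K b) \<in> vector_fields G (jdom G K)"
      unfolding proj_T_def by (intro vf_comb_field df d_t_smooth[OF K])
  qed (use N[OF ff df(1)] in blast)
  then show "vf_eq G (jdom G K) (conn G (frame G K d) (del_t G K b)) (vf_comb (conn_T G K d b) (del_t G K))"
    unfolding proj_T_def conn_T_def[abs_def] .
  have "vf_eq G (jdom G K) (conn G (frame G K d) (del_x G K j)) (proj_M G K (conn G (frame G K d) (del_x G K j)))"
  proof (rule vf_eq_trans[OF conn_cong[OF o ff ff vf_eq_refl df(2) _ vf_eq_sym[OF proj_frame(2)[OF K]]]])
    show "proj_M G K (del_x G K j) \<in> vector_fields G (jdom G K)"
      unfolding proj_M_def by (intro vf_comb_field df d_x_smooth[OF K])
  qed (use N[OF ff df(2)] in blast)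
  then show "vf_eq G (jdom G K) (conn G (frame G K d) (del_x G K j)) (vf_comb (conn_M G K d j) (del_x G K))"
    unfolding proj_M_def conn_M_def[abs_def] .
  have "vf_eq G (jdom G K) (conn G (frame G K d) (vert G K s)) (proj_V G K (conn G (frame G K d) (vert G K s)))"
  proof (rule vf_eq_trans[OF conn_cong[OF o ff ff vf_eq_refl vf _ vf_eq_sym[OF proj_frame(3)[OF K]]]])
    show "proj_V G K (vert G K s) \<in> vector_fields G (jdom G K)"
      unfolding proj_V_def by (intro vf_comb_field vf) (simp add: case_prod_unfold del_p_smooth[OF K df(3)])
  qed (use N[OF ff vf] in blast)
  then show "vf_eq G (jdom G K) (conn G (frame G K d) (vert G K s)) (vf_comb (conn_V G K d s) (vert G K))"
    unfolding proj_V_def conn_V_def[abs_def] .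
qed

text \<open>The fields \<open>Q\<close> of the structure equation are the vertical basis fields,
  themselves part of the adapted frame, so their connection forms are again values of
  \<open>w\<close>.\<close>

lemma curvature_frame:
  fixes w :: "('m, 'n) dir \<Rightarrow> 'i::finite \<Rightarrow> 'i \<Rightarrow> _"
  assumes K: "K \<in> jcharts G" and E: "\<And>s. E s \<in> vector_fields G (jdom G K)"
    and w: "\<And>d s s'. w d s s' \<in> smooth_funs G (jdom G K)"
      "\<And>d s. vf_eq G (jdom G K) (conn G (frame G K d) (E s)) (vf_comb (w d s) E)"
  shows "vf_eq G (jdom G K) (curvature G (frame G K d) (frame G K d') (E s))
    (vf_comb (curv_form G K w d d' s) E)"
  unfolding curv_form_def[abs_def]
  by (rule curvature_structure_equation[OF jet_open_jdom[OF K] frame_field[OF K subset_refl]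
        frame_field[OF K subset_refl] E vert_field[OF K subset_refl] w(1) w(2) w(1) w(2)
        tau_smooth[OF K] frame_bracket[OF K]])
     (use w(2)[of "Inr (Inr _)"] in \<open>simp add: vert_eq_frame\<close>)

lemma curvature_TMV:
  assumes K: "K \<in> jcharts G"
  shows "vf_eq G (jdom G K) (curvature G (frame G K d) (frame G K d') (del_t G K b))
      (vf_comb (curv_form G K (conn_T G K) d d' b) (del_t G K))"
    "vf_eq G (jdom G K) (curvature G (frame G K d) (frame G K d') (del_x G K j))
      (vf_comb (curv_form G K (conn_M G K) d d' j) (del_x G K))"
    "vf_eq G (jdom G K) (curvature G (frame G K d) (frame G K d') (vert G K s))
      (vf_comb (curv_form G K (conn_V G K) d d' s) (vert G K))"
  by (intro curvature_frame K del_field vert_field subset_refl conn_smooth conn_frame)+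

section \<open>Change of chart for the curvature components\<close>

lemma curvature_change:
  assumes K: "K \<in> jcharts G" "K' \<in> jcharts G" and V: "jet_open G V" "V \<subseteq> jdom G K \<inter> jdom G K'"
    and f: "f \<in> smooth_funs G V" and e: "e \<in> V"
  shows "curvature G (frame G K d) (frame G K d') (frame G K d'') f e =
    (\<Sum>c\<in>UNIV. frame_jac K K' c d e * (\<Sum>c'\<in>UNIV. frame_jac K K' c' d' e *
      (\<Sum>c''\<in>UNIV. frame_jac K K' c'' d'' e * curvature G (frame G K' c) (frame G K' c') (frame G K' c'') f e)))"
proof -
  let ?W = "jdom G K \<inter> jdom G K'" and ?E = "frame G K" and ?E' = "frame G K'"
  let ?J = "\<lambda>d c. frame_jac K K' c d"
  have W: "jet_open G ?W" by (intro jet_open_Int jet_open_jdom K)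
  have E: "?E d \<in> vector_fields G ?W" for d by (rule frame_field[OF K(1)]) blast
  have E': "?E' d \<in> vector_fields G ?W" for d by (rule frame_field[OF K(2)]) blast
  note J = frame_jac_smooth[OF K]
  have ch: "vf_eq G ?W (?E d) (vf_comb (?J d) ?E')" for d
    by (rule vf_eqI) (simp add: vf_comb_def frame_change[OF K])
  have cf: "vf_comb (?J d) ?E' \<in> vector_fields G ?W" for d
    by (intro vf_comb_field E' J)
  note Vf = V f e
  have "curvature G (?E d) (?E d') (?E d'') f e =
      curvature G (vf_comb (?J d) ?E') (vf_comb (?J d') ?E') (vf_comb (?J d'') ?E') f e"
    by (rule vf_eqD[OF curvature_cong[OF W E cf ch E cf ch E cf ch] Vf])
  also have "\<dots> = (\<Sum>c\<in>UNIV. ?J d c e * curvature G (?E' c) (vf_comb (?J d') ?E') (vf_comb (?J d'') ?E') f e)"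
    unfolding vf_eqD[OF curvature_comb_1[OF W E' J cf cf] Vf] by (simp add: vf_comb_def)
  also have "\<dots> = (\<Sum>c\<in>UNIV. ?J d c e * (\<Sum>c'\<in>UNIV. ?J d' c' e * curvature G (?E' c) (?E' c') (vf_comb (?J d'') ?E') f e))"
    unfolding vf_eqD[OF curvature_comb_2[OF W E' J E' cf] Vf] by (simp add: vf_comb_def)
  also have "\<dots> = (\<Sum>c\<in>UNIV. ?J d c e * (\<Sum>c'\<in>UNIV. ?J d' c' e * (\<Sum>c''\<in>UNIV. ?J d'' c'' e *
      curvature G (?E' c) (?E' c') (?E' c'') f e)))"
    unfolding vf_eqD[OF curvature_comb_3[OF W E' J E' E'] Vf] by (simp add: vf_comb_def)
  finally show ?thesis .
qed

lemma del_coord_change: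
  assumes K: "K \<in> jcharts G" "K' \<in> jcharts G" and e: "e \<in> jdom G K" "e \<in> jdom G K'"
  shows "del_t G K a (t_coord K' a') e = jac (fst K) (fst K') (fst e) $ a' $ a"
    "del_x G K i (x_coord K' i') e = jac (snd K) (snd K') (fst (snd e)) $ i' $ i"
  by (simp_all add: del_t_def del_x_def part_t_def part_x_def part_p_def partial_t_coord[OF K e]
      partial_x_coord[OF K e] matrix_vector_mult_basis column_def)

text \<open>A component is isolated by applying the curvature field to a base coordinate function of
  \<open>K'\<close>: the frame of \<open>K'\<close> turns it into a Kronecker symbol, the frame of
  \<open>K\<close> into a Jacobian entry.\<close>

lemma curv_form_change:
  assumes K: "K \<in> jcharts G" "K' \<in> jcharts G" and e: "e \<in> jdom G K" "e \<in> jdom G K'"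
  shows "curv_form G K' (conn_T G K') d d' a a' e = (\<Sum>c\<in>UNIV. frame_jac K' K c d e * (\<Sum>c'\<in>UNIV. frame_jac K' K c' d' e *
      (\<Sum>b\<in>UNIV. jac (fst K') (fst K) (fst e) $ b $ a *
        (\<Sum>r\<in>UNIV. curv_form G K (conn_T G K) c c' b r e * jac (fst K) (fst K') (fst e) $ a' $ r))))" (is ?T)
    "curv_form G K' (conn_M G K') d d' i i' e = (\<Sum>c\<in>UNIV. frame_jac K' K c d e * (\<Sum>c'\<in>UNIV. frame_jac K' K c' d' e *
      (\<Sum>b\<in>UNIV. jac (snd K') (snd K) (fst (snd e)) $ b $ i *
        (\<Sum>r\<in>UNIV. curv_form G K (conn_M G K) c c' b r e * jac (snd K) (snd K') (fst (snd e)) $ i' $ r))))" (is ?M)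
proof -
  let ?W = "jdom G K \<inter> jdom G K'"
  have W: "jet_open G ?W" by (intro jet_open_Int jet_open_jdom K)
  have eW: "e \<in> ?W" using e by blast
  have W': "?W \<subseteq> jdom G K' \<inter> jdom G K" by blast
  have t: "t_coord K' a' \<in> smooth_funs G ?W" by (rule smooth_funs_subset[OF t_coord(1)[OF K(2)]]) blast
  have x: "x_coord K' i' \<in> smooth_funs G ?W" by (rule smooth_funs_subset[OF x_coord(1)[OF K(2)]]) blast
  have "curv_form G K' (conn_T G K') d d' a a' e =
      curvature G (frame G K' d) (frame G K' d') (del_t G K' a) (t_coord K' a') e"
    using vf_eqD[OF curvature_TMV(1)[OF K(2)] W Int_lower2 t eW]
    by (simp add: vf_comb_def frame_coords[OF K(2) e(2)] sum_kron)
  also have "\<dots> = (\<Sum>c\<in>UNIV. frame_jac K' K c d e * (\<Sum>c'\<in>UNIV. frame_jac K' K c' d' e *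
      (\<Sum>b\<in>UNIV. jac (fst K') (fst K) (fst e) $ b $ a * curvature G (frame G K c) (frame G K c') (del_t G K b) (t_coord K' a') e)))"
    using curvature_change[OF K(2,1) W W' t eW, of d d' "Inl a"] by (simp add: sum_frame_jac)
  also have "\<dots> = (\<Sum>c\<in>UNIV. frame_jac K' K c d e * (\<Sum>c'\<in>UNIV. frame_jac K' K c' d' e *
      (\<Sum>b\<in>UNIV. jac (fst K') (fst K) (fst e) $ b $ a *
        (\<Sum>r\<in>UNIV. curv_form G K (conn_T G K) c c' b r e * jac (fst K) (fst K') (fst e) $ a' $ r))))"
    unfolding vf_eqD[OF curvature_TMV(1)[OF K(1)] W Int_lower1 t eW] vf_comb_def del_coord_change[OF K e] ..
  finally show ?T .
  have "curv_form G K' (conn_M G K') d d' i i' e =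
      curvature G (frame G K' d) (frame G K' d') (del_x G K' i) (x_coord K' i') e"
    using vf_eqD[OF curvature_TMV(2)[OF K(2)] W Int_lower2 x eW]
    by (simp add: vf_comb_def frame_coords[OF K(2) e(2)] sum_kron)
  also have "\<dots> = (\<Sum>c\<in>UNIV. frame_jac K' K c d e * (\<Sum>c'\<in>UNIV. frame_jac K' K c' d' e *
      (\<Sum>b\<in>UNIV. jac (snd K') (snd K) (fst (snd e)) $ b $ i * curvature G (frame G K c) (frame G K c') (del_x G K b) (x_coord K' i') e)))"
    using curvature_change[OF K(2,1) W W' x eW, of d d' "Inr (Inl i)"] by (simp add: sum_frame_jac)
  also have "\<dots> = (\<Sum>c\<in>UNIV. frame_jac K' K c d e * (\<Sum>c'\<in>UNIV. frame_jac K' K c' d' e *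
      (\<Sum>b\<in>UNIV. jac (snd K') (snd K) (fst (snd e)) $ b $ i *
        (\<Sum>r\<in>UNIV. curv_form G K (conn_M G K) c c' b r e * jac (snd K) (snd K') (fst (snd e)) $ i' $ r))))"
    unfolding vf_eqD[OF curvature_TMV(2)[OF K(1)] W Int_lower1 x eW] vf_comb_def del_coord_change[OF K e] ..
  finally show ?M .
qed

end


section \<open>The metric, its Christoffel symbols and the vertical connection form\<close>

lemma kron_commute: "kron i j = kron j i"
  by (simp add: kron_def)

locale h_normal_bundle = N_linear_bundle G
  for G :: "('t::topological_space, 'm::finite, 'x::topological_space, 'n::finite) jet_data" +
  assumes normal: "h_normal G" and semi_riem: "semi_riemannian G"
begin

abbreviation metric_comp where "metric_comp K b c \<equiv> (\<lambda>e :: ('t, 'm, 'x, 'n) jpoint. metric G (fst K) (fst e) $ b $ c)"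

lemma metric_smooth_on:
  "\<alpha> \<in> T_atlas G \<Longrightarrow> smooth_on (snd \<alpha> ` fst \<alpha>) (\<lambda>u. metric G \<alpha> (chart_inv \<alpha> u) $ b $ c)"
  by (rule semi_riem[unfolded semi_riemannian_def, THEN conjunct1, THEN bspec, THEN spec, THEN spec])

lemma metric_sym:
  assumes "\<alpha> \<in> T_atlas G" "t \<in> fst \<alpha>" shows "metric G \<alpha> t $ b $ c = metric G \<alpha> t $ c $ b"
proof -
  have "transpose (metric G \<alpha> t) = metric G \<alpha> t"
    using semi_riem assms unfolding semi_riemannian_def by blast
  then have "metric G \<alpha> t $ b $ c = transpose (metric G \<alpha> t) $ b $ c" by simp
  then show ?thesis by (simp add: transpose_def)
qed

lemma metric_inverse:
  assumes "\<alpha> \<in> T_atlas G" "t \<in> fst \<alpha>"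
  shows "(\<Sum>c\<in>UNIV. metric G \<alpha> t $ a $ c * matrix_inv (metric G \<alpha> t) $ c $ b) = kron a b"
proof -
  have "det (metric G \<alpha> t) \<noteq> 0"
    using semi_riem assms unfolding semi_riemannian_def by blast
  then have "\<exists>B. metric G \<alpha> t ** B = mat 1 \<and> B ** metric G \<alpha> t = mat 1"
    unfolding invertible_det_nz[symmetric] invertible_def .
  from someI_ex[OF this] have "metric G \<alpha> t ** matrix_inv (metric G \<alpha> t) = mat 1"
    unfolding matrix_inv_def by (rule conjunct1)
  then have "(metric G \<alpha> t ** matrix_inv (metric G \<alpha> t)) $ a $ b = mat 1 $ a $ b" by simp
  then show ?thesis by (simp add: matrix_matrix_mult_def mat_def kron_def)
qed

lemma metric_deriv_sym:
  assumes \<alpha>: "\<alpha> \<in> T_atlas G" and t: "t \<in> fst \<alpha>"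
  shows "metric_deriv G \<alpha> a b c t = metric_deriv G \<alpha> a c b t"
  unfolding metric_deriv_def
proof (rule fun_cong[OF frechet_derivative_cong_open])
  show o: "open (snd \<alpha> ` fst \<alpha>)" by (rule chart_image_open[OF T_atlas \<alpha>])
  show z: "snd \<alpha> t \<in> snd \<alpha> ` fst \<alpha>" using t by blast
  show "(\<lambda>u. metric G \<alpha> (chart_inv \<alpha> u) $ b $ c) differentiable at (snd \<alpha> t)"
    by (rule smooth_on_differentiable[OF o metric_smooth_on[OF \<alpha>] z])
qed (rule metric_sym[OF \<alpha> chart_inv_right(2)])

text \<open>Lowering the index cancels the inverse metric and leaves the Christoffel symbols of the
  first kind.\<close>

lemma christoffel_lower:
  assumes \<alpha>: "\<alpha> \<in> T_atlas G" and t: "t \<in> fst \<alpha>"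
  shows "(\<Sum>a\<in>UNIV. metric G \<alpha> t $ d $ a * christoffel G \<alpha> a b c t) =
    (metric_deriv G \<alpha> b d c t + metric_deriv G \<alpha> c d b t - metric_deriv G \<alpha> d b c t) / 2"
proof -
  let ?X = "\<lambda>d. metric_deriv G \<alpha> b d c t + metric_deriv G \<alpha> c d b t - metric_deriv G \<alpha> d b c t"
  let ?h = "\<lambda>a b. metric G \<alpha> t $ a $ b" and ?i = "\<lambda>a b. matrix_inv (metric G \<alpha> t) $ a $ b"
  have "(\<Sum>a\<in>UNIV. ?h d a * christoffel G \<alpha> a b c t) = (\<Sum>a\<in>UNIV. \<Sum>d'\<in>UNIV. ?h d a * ?i a d' * (?X d' / 2))"
    unfolding christoffel_def sum_distrib_left by (intro sum.cong refl) (simp add: field_simps)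
  also have "\<dots> = (\<Sum>d'\<in>UNIV. (\<Sum>a\<in>UNIV. ?h d a * ?i a d') * (?X d' / 2))"
    unfolding sum_distrib_right by (rule sum.swap)
  also have "\<dots> = ?X d / 2"
    unfolding metric_inverse[OF assms] by (rule sum_kron)
  finally show ?thesis .
qed

text \<open>Functions pulled back from the first base manifold respond only to the
  \<open>t\<close>-part of a direction; in particular the vertical corrections in the adapted frame
  do not affect them.\<close>

lemma base_function:
  assumes K: "K \<in> jcharts G" and F: "smooth_on (snd (fst K) ` fst (fst K)) (\<lambda>u. F (chart_inv (fst K) u))"
  shows "(\<lambda>e. F (fst e) :: real) \<in> smooth_funs G (jdom G K)"
    "e \<in> jdom G K \<Longrightarrow> partial G K v (\<lambda>e. F (fst e)) e =
      frechet_derivative (\<lambda>u. F (chart_inv (fst K) u)) (at (snd (fst K) (fst e))) (fst v)"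
proof -
  let ?g = "\<lambda>u. F (chart_inv (fst K) u)" and ?S = "coords K ` jdom G K" and ?U = "snd (fst K) ` fst (fst K)"
  have oU: "open ?U" by (rule chart_image_open[OF T_atlas jchartsD(1)[OF K]])
  note oS = coords_open[OF K jet_open_jdom[OF K] subset_refl]
  have im: "fst ` ?S \<subseteq> ?U"
    using coords_image[OF K K] by auto
  have eq: "?g (fst z) = ((\<lambda>e. F (fst e)) \<circ> coords_inv G K) z" if "z \<in> ?S" for z
    using coords_inv_parts(1)[OF K that] by simp
  show "(\<lambda>e. F (fst e)) \<in> smooth_funs G (jdom G K)"
    by (rule smooth_funsI[OF jet_open_jdom[OF K] subset_refl K
          smooth_on_cong_open[OF oS eq smooth_on_fst[OF oS oU im F]]])
  assume e: "e \<in> jdom G K"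
  have z: "coords K e \<in> ?S" using e by blast
  have "?g differentiable (at (snd (fst K) (fst e)))"
    by (rule smooth_on_differentiable[OF oU F]) (use jdomD(2)[OF e] in blast)
  then have "(?g has_derivative frechet_derivative ?g (at (snd (fst K) (fst e)))) (at (fst (coords K e)))"
    by (simp add: frechet_derivative_works[symmetric] coords_def)
  from diff_chain_at[OF bounded_linear_imp_has_derivative[OF bounded_linear_fst] this]
  have 1: "((\<lambda>z. ?g (fst z)) has_derivative (\<lambda>v. frechet_derivative ?g (at (snd (fst K) (fst e))) (fst v))) (at (coords K e))"
    by (simp add: o_def)
  show "partial G K v (\<lambda>e. F (fst e)) e = frechet_derivative ?g (at (snd (fst K) (fst e))) (fst v)"
    by (rule partial_eqI[OF has_derivative_transform_within_open[OF 1 oS z eq]])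
qed

lemma metric_comp_smooth: "K \<in> jcharts G \<Longrightarrow> metric_comp K b c \<in> smooth_funs G (jdom G K)"
  by (rule base_function(1)[OF _ metric_smooth_on[OF jchartsD(1)]])

lemma frame_metric:
  assumes K: "K \<in> jcharts G" and e: "e \<in> jdom G K"
  shows "frame G K (Inl a) (metric_comp K b c) e = metric_deriv G (fst K) a b c (fst e)"
    "frame G K (Inr s) (metric_comp K b c) e = 0"
proof -
  note p = base_function(2)[OF K metric_smooth_on[OF jchartsD(1)[OF K]] e]
  have "linear (frechet_derivative (\<lambda>u. metric G (fst K) (chart_inv (fst K) u) $ b $ c) (at (snd (fst K) (fst e))))"
    by (intro linear_frechet_derivative smooth_on_differentiable[OF chart_image_open[OF T_atlas]
        metric_smooth_on[OF jchartsD(1)[OF K]]] imageI jchartsD[OF K] jdomD[OF e])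
  note z = linear_0[OF this]
  show "frame G K (Inl a) (metric_comp K b c) e = metric_deriv G (fst K) a b c (fst e)"
    unfolding frame_apply vert_eq_partial p by (simp add: z metric_deriv_def)
  have "fst (dir_vec (Inr s)) = 0" by (cases s) auto
  then show "frame G K (Inr s) (metric_comp K b c) e = 0"
    unfolding frame_apply vert_eq_partial p by (simp add: z)
qed

lemma conn_T_eq:
  assumes K: "K \<in> jcharts G" and e: "e \<in> jdom G K"
  shows "conn_T G K (Inl c) b a e = chris G K a b c e" "conn_T G K (Inr s) b a e = 0"
proof -
  note n = normal[unfolded h_normal_def, THEN bspec, OF K]
  show "conn_T G K (Inl c) b a e = chris G K a b c e"
    using n[THEN conjunct1] e by (simp add: conn_T_def A_T_def)
  show "conn_T G K (Inr s) b a e = 0"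
  proof (cases s)
    case (Inl k)
    then show ?thesis
      using n[THEN conjunct2, THEN conjunct1] e by (simp add: conn_T_def H_T_def)
  next
    case (Inr r)
    then show ?thesis
      using n[THEN conjunct2, THEN conjunct2, THEN conjunct1] e
      by (cases r) (simp add: conn_T_def C_T_def)
  qed
qed

text \<open>In a \<open>t\<close>-direction two Christoffel symbols of the first kind are added: the
  derivative of the metric in that direction occurs twice with factor one half, the other terms
  cancel by symmetry. In the remaining directions both sides are 0.\<close>

lemma metric_compatible:
  assumes K: "K \<in> jcharts G" and e: "e \<in> jdom G K"
  shows "frame G K d (metric_comp K b c) e =
    (\<Sum>a\<in>UNIV. metric_comp K a c e * conn_T G K d b a e) + (\<Sum>a\<in>UNIV. metric_comp K b a e * conn_T G K d c a e)"
proof (cases d)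
  case (Inl d0)
  note \<alpha> = jchartsD(1)[OF K] and t = jdomD(2)[OF e]
  have "(\<Sum>a\<in>UNIV. metric_comp K a c e * conn_T G K d b a e) =
      (\<Sum>a\<in>UNIV. metric G (fst K) (fst e) $ c $ a * christoffel G (fst K) a b d0 (fst e))"
    using metric_sym[OF \<alpha> t] by (simp add: Inl conn_T_eq[OF K e] chris_def)
  moreover have "(\<Sum>a\<in>UNIV. metric_comp K b a e * conn_T G K d c a e) =
      (\<Sum>a\<in>UNIV. metric G (fst K) (fst e) $ b $ a * christoffel G (fst K) a c d0 (fst e))"
    by (simp add: Inl conn_T_eq[OF K e] chris_def)
  ultimately show ?thesis
    unfolding christoffel_lower[OF \<alpha> t] Inl frame_metric(1)[OF K e]
    using metric_deriv_sym[OF \<alpha> t, of d0 b c] metric_deriv_sym[OF \<alpha> t, of b c d0]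
      metric_deriv_sym[OF \<alpha> t, of c b d0] by (simp add: field_simps)
next
  case (Inr s)
  then show ?thesis by (simp add: frame_metric[OF K e] conn_T_eq[OF K e])
qed

lemma J_tensor_alt:
  "J_tensor G K X Y Z e = (\<Sum>b\<in>UNIV. \<Sum>i\<in>UNIV. \<Sum>a\<in>UNIV.
     metric_comp K a b e * d_t K b Y e * d_x K i Z e * del_p G K a i X e)"
proof -
  have "(\<Sum>j\<in>UNIV. m * kron i j * p * y * d_x K j Z e) = m * y * d_x K i Z e * p" for m p y i
  proof -
    have "(\<Sum>j\<in>UNIV. m * kron i j * p * y * d_x K j Z e) = (\<Sum>j\<in>UNIV. kron i j * (m * y * d_x K j Z e * p))"
      by (simp add: mult_ac)
    then show ?thesis by (simp only: sum_kron)
  qed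
  then show ?thesis
    unfolding J_tensor_def by (simp only:) (rule sum3_swap)
qed

lemma J_tensor_vert:
  assumes "K \<in> jcharts G" "e \<in> jdom G K"
  shows "J_tensor G K (part_p G K j b) Y Z e = (\<Sum>b'\<in>UNIV. metric_comp K b b' e * d_t K b' Y e) * d_x K j Z e"
  unfolding J_tensor_alt dual_frame[OF assms]
  by (simp only: mult.assoc[symmetric] sum_kron sum_distrib_right)

lemma J_tensor_hor:
  assumes "K \<in> jcharts G" "e \<in> jdom G K"
  shows "J_tensor G K X (del_t G K c) (del_x G K k) e = (\<Sum>a\<in>UNIV. metric_comp K a c e * del_p G K a k X e)"
proof -
  have "J_tensor G K X (del_t G K c) (del_x G K k) e =
      (\<Sum>b\<in>UNIV. kron b c * (\<Sum>i\<in>UNIV. kron i k * (\<Sum>a\<in>UNIV. metric_comp K a b e * del_p G K a i X e)))"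
    unfolding J_tensor_alt dual_frame[OF assms] sum_distrib_left by (simp add: mult_ac)
  then show ?thesis by (simp only: sum_kron)
qed

text \<open>The condition \<open>DJ = 0\<close>, evaluated on an adapted frame and contracted with the inverse metric.\<close>

lemma conn_V_eq:
  assumes K: "K \<in> jcharts G" and e: "e \<in> jdom G K"
  shows "conn_V G K d (j, b) (i, a) e = kron i j * conn_T G K d b a e - kron a b * conn_M G K d i j e"
proof -
  let ?h = "\<lambda>a b. metric_comp K a b e" and ?F = "frame G K d"
  note o = jet_open_jdom[OF K] and fld = del_field[OF K subset_refl] and F = frame_field[OF K subset_refl, of d]
  let ?y = "\<lambda>a. conn_V G K d (j, b) (i, a) e - (kron i j * conn_T G K d b a e - kron a b * conn_M G K d i j e)"
  have "(\<Sum>a\<in>UNIV. ?h a c * ?y a) = 0" for c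
  proof -
    \<comment> \<open>The argument \<open>del_x G K i\<close> selects the fibre index
      \<open>i\<close> of the differentiated vertical field, while \<open>c\<close> stays free for
      the contraction with the inverse metric.\<close>
    have "?F (J_tensor G K (part_p G K j b) (del_t G K c) (del_x G K i)) e
        - J_tensor G K (conn G ?F (part_p G K j b)) (del_t G K c) (del_x G K i) e
        - J_tensor G K (part_p G K j b) (conn G ?F (del_t G K c)) (del_x G K i) e
        - J_tensor G K (part_p G K j b) (del_t G K c) (conn G ?F (del_x G K i)) e = 0"
      by (rule normal[unfolded h_normal_def, THEN bspec, OF K, THEN conjunct2, THEN conjunct2, THEN conjunct2,
          rule_format, OF conjI[OF o subset_refl] F fld(3) fld(1) fld(2) e])
    moreover have "?F (J_tensor G K (part_p G K j b) (del_t G K c) (del_x G K i)) e = kron i j * ?F (metric_comp K b c) e"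
    proof -
      have "?F (\<lambda>e. kron i j * metric_comp K b c e) e = ?F (J_tensor G K (part_p G K j b) (del_t G K c) (del_x G K i)) e"
      proof (rule vf_cong[OF F o smooth_funs_cmult[OF o metric_comp_smooth[OF K]] _ e])
        fix e assume e: "e \<in> jdom G K"
        show "kron i j * metric_comp K b c e = J_tensor G K (part_p G K j b) (del_t G K c) (del_x G K i) e"
          unfolding J_tensor_vert[OF K e] dual_frame[OF K e] by (simp add: sum_kron kron_commute)
      qed
      then show ?thesis
        unfolding vf_apply_cmult[OF F o metric_comp_smooth[OF K] e] by simp
    qed
    moreover have "J_tensor G K (conn G ?F (part_p G K j b)) (del_t G K c) (del_x G K i) e =
        (\<Sum>a\<in>UNIV. ?h a c * conn_V G K d (j, b) (i, a) e)"
      unfolding J_tensor_hor[OF K e] conn_V_def by simp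
    moreover have "J_tensor G K (part_p G K j b) (conn G ?F (del_t G K c)) (del_x G K i) e =
        kron i j * (\<Sum>a\<in>UNIV. ?h b a * conn_T G K d c a e)"
      unfolding J_tensor_vert[OF K e] conn_T_def dual_frame[OF K e] by (simp add: kron_commute)
    moreover have "J_tensor G K (part_p G K j b) (del_t G K c) (conn G ?F (del_x G K i)) e =
        ?h b c * conn_M G K d i j e"
      unfolding J_tensor_vert[OF K e] conn_M_def dual_frame[OF K e] by (simp add: sum_kron)
    moreover have "(\<Sum>a\<in>UNIV. ?h a c * ?y a) = (\<Sum>a\<in>UNIV. ?h a c * conn_V G K d (j, b) (i, a) e)
        - kron i j * (\<Sum>a\<in>UNIV. ?h a c * conn_T G K d b a e) + ?h b c * conn_M G K d i j e"
    proof -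
      have "(\<Sum>a\<in>UNIV. ?h a c * ?y a) = (\<Sum>a\<in>UNIV. ?h a c * conn_V G K d (j, b) (i, a) e
          - kron i j * (?h a c * conn_T G K d b a e) + kron a b * (?h a c * conn_M G K d i j e))"
        by (intro sum.cong refl) (simp add: algebra_simps)
      also have "\<dots> = (\<Sum>a\<in>UNIV. ?h a c * conn_V G K d (j, b) (i, a) e)
          - kron i j * (\<Sum>a\<in>UNIV. ?h a c * conn_T G K d b a e) + (\<Sum>a\<in>UNIV. kron a b * (?h a c * conn_M G K d i j e))"
        by (simp only: sum.distrib sum_subtractf sum_distrib_left)
      finally show ?thesis unfolding sum_kron .
    qed
    \<comment> \<open>Metric compatibility splits the derivative of the metric into two sums. One
      cancels the contribution of the \<open>del_t\<close> slot, the other supplies the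
      \<open>conn_T\<close> term of \<open>?y\<close>.\<close>
    ultimately show ?thesis
      unfolding metric_compatible[OF K e] by (simp add: algebra_simps)
  qed
  note zero = this
  let ?i = "\<lambda>c a. matrix_inv (metric G (fst K) (fst e)) $ c $ a"
  have "?y a = (\<Sum>a'\<in>UNIV. kron a' a * ?y a')"
    by (simp only: sum_kron)
  also have "\<dots> = (\<Sum>a'\<in>UNIV. \<Sum>c\<in>UNIV. ?h a' c * ?i c a * ?y a')"
    unfolding metric_inverse[OF jchartsD(1)[OF K] jdomD(2)[OF e], symmetric] sum_distrib_right ..
  also have "\<dots> = (\<Sum>c\<in>UNIV. ?i c a * (\<Sum>a'\<in>UNIV. ?h a' c * ?y a'))"
    by (subst sum.swap) (simp add: sum_distrib_left mult_ac)
  also have "\<dots> = 0"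
    unfolding zero by simp
  finally show ?thesis by simp
qed

end


section \<open>The curvature d-tensors\<close>

text \<open>Product of two vertical connection forms. The two mixed terms are exchanged when primed
  and unprimed forms swap roles, so they disappear on antisymmetrizing; the product of the
  \<open>B\<close> forms appears in reversed order, as for a dual.\<close>

lemma kron_product_sum:
  fixes A A' :: "'m::finite \<Rightarrow> 'm \<Rightarrow> real" and B B' :: "'n::finite \<Rightarrow> 'n \<Rightarrow> real"
  shows "(\<Sum>r\<in>UNIV. \<Sum>f\<in>UNIV. (kron r i * A a f - kron f a * B r i) * (kron l r * A' f d - kron d f * B' l r)) =
    kron i l * (\<Sum>f\<in>UNIV. A a f * A' f d) - A a d * B' l i - B l i * A' a d + kron d a * (\<Sum>r\<in>UNIV. B' l r * B r i)"
proof -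
  have "(\<Sum>f\<in>UNIV. (kron r i * A a f - kron f a * B r i) * (kron l r * A' f d - kron d f * B' l r)) =
      kron r i * (kron l r * (\<Sum>f\<in>UNIV. A a f * A' f d)) - kron r i * (B' l r * A a d)
      - kron l r * (B r i * A' a d) + kron d a * (B' l r * B r i)" for r
  proof -
    have "(\<Sum>f\<in>UNIV. (kron r i * A a f - kron f a * B r i) * (kron l r * A' f d - kron d f * B' l r)) =
        (\<Sum>f\<in>UNIV. kron r i * (kron l r * (A a f * A' f d)) - kron d f * (kron r i * (B' l r * A a f))
          - kron f a * (kron l r * (B r i * A' f d)) + kron d f * (kron f a * (B' l r * B r i)))"
      by (intro sum.cong refl) (simp add: algebra_simps)
    then show ?thesis
      by (simp only: sum.distrib sum_subtractf sum_kron sum_distrib_left)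
  qed
  then have "(\<Sum>r\<in>UNIV. \<Sum>f\<in>UNIV. (kron r i * A a f - kron f a * B r i) * (kron l r * A' f d - kron d f * B' l r)) =
      (\<Sum>r\<in>UNIV. kron r i * (kron l r * (\<Sum>f\<in>UNIV. A a f * A' f d)) - kron r i * (B' l r * A a d)
      - kron l r * (B r i * A' a d) + kron d a * (B' l r * B r i))"
    by simp
  also have "\<dots> = kron l i * (\<Sum>f\<in>UNIV. A a f * A' f d) - B' l i * A a d - B l i * A' a d
      + kron d a * (\<Sum>r\<in>UNIV. B' l r * B r i)"
    by (simp only: sum.distrib sum_subtractf sum_kron sum_distrib_left[symmetric])
  finally show ?thesis by (simp add: kron_commute mult.commute)
qed

context h_normal_bundle
begin

lemma frame_zero:
  assumes K: "K \<in> jcharts G" and e: "e \<in> jdom G K" and z: "\<And>e. e \<in> jdom G K \<Longrightarrow> f e = 0"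
  shows "frame G K d f e = 0"
proof -
  note F = frame_field[OF K subset_refl, of d] and o = jet_open_jdom[OF K]
  have "frame G K d (\<lambda>e. 0) e = frame G K d f e"
    by (rule vf_cong[OF F o smooth_funs_const]) (simp_all add: z e)
  then show ?thesis using vf_apply_const[OF F o e, of 0] by simp
qed

lemma frame_cong:
  assumes K: "K \<in> jcharts G" and e: "e \<in> jdom G K" and f: "f \<in> smooth_funs G (jdom G K)"
    and eq: "\<And>e. e \<in> jdom G K \<Longrightarrow> f e = g e"
  shows "frame G K d f e = frame G K d g e"
  by (rule vf_cong[OF frame_field[OF K subset_refl] jet_open_jdom[OF K] f eq e])

text \<open>The Christoffel symbols depend on the first base point alone, hence are constant along
  lines without \<open>t\<close>-part. Their smoothness is that of the connection component
  \<open>conn_T\<close>, with which they agree by h-normality.\<close>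

lemma frame_chris_zero:
  assumes K: "K \<in> jcharts G" and e: "e \<in> jdom G K"
  shows "frame G K (Inr s) (conn_T G K (Inl c) b a) e = 0"
proof -
  have z: "partial G K v (conn_T G K (Inl c) b a) e = 0" if v: "fst v = 0" for v
  proof (rule partial_line[OF jet_open_jdom[OF K] subset_refl K conn_smooth(1)[OF K] e])
    fix e' s assume e': "e' \<in> jdom G K" and eq: "coords K e' = coords K e + s *\<^sub>R v"
    have "fst (coords K e') = fst (coords K e)"
      unfolding eq using v by simp
    then have "snd (fst K) (fst e') = snd (fst K) (fst e)"
      by (simp add: coords_def)
    then have "chart_inv (fst K) (snd (fst K) (fst e')) = chart_inv (fst K) (snd (fst K) (fst e))"
      by (rule arg_cong)
    then have "fst e' = fst e"
      unfolding chart_inv_left[OF T_atlas jchartsD(1)[OF K] jdomD(2)[OF e']]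
        chart_inv_left[OF T_atlas jchartsD(1)[OF K] jdomD(2)[OF e]] .
    then show "conn_T G K (Inl c) b a e' = conn_T G K (Inl c) b a e + s * 0"
      by (simp add: conn_T_eq[OF K e] conn_T_eq[OF K e'] chris_def)
  qed
  have "fst (dir_vec (Inr s)) = 0" by (cases s) auto
  then show ?thesis
    unfolding frame_apply vert_eq_partial by (simp add: z)
qed

text \<open>In this block the connection form vanishes in all directions but those of
  \<open>t\<close>, which also removes the bracket term. If one direction is not a
  \<open>t\<close>-direction, only a derivative of the Christoffel symbols in that direction could
  remain, and it is 0.\<close>

lemma curv_form_T:
  assumes K: "K \<in> jcharts G" and e: "e \<in> jdom G K"
  shows "curv_form G K (conn_T G K) (Inl c) (Inl b) a d e = curv_chi G K d a b c e"
    "curv_form G K (conn_T G K) (Inr s) d' a d e = 0"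
proof -
  have "frame G K (Inl c) (conn_T G K (Inl b) a d) e = frame G K (Inl c) (chris G K d a b) e" for b c
    by (rule frame_cong[OF K e conn_smooth(1)[OF K]]) (rule conn_T_eq(1)[OF K])
  then show "curv_form G K (conn_T G K) (Inl c) (Inl b) a d e = curv_chi G K d a b c e"
    by (simp add: curv_form_def curv_chi_def conn_T_eq[OF K e])
  have "frame G K d' (conn_T G K (Inr s) a d) e = 0"
    by (rule frame_zero[OF K e conn_T_eq(2)[OF K]])
  moreover have "frame G K (Inr s) (conn_T G K d' a d) e = 0"
    by (cases d') (simp_all add: frame_chris_zero[OF K e] frame_zero[OF K e conn_T_eq(2)[OF K]])
  ultimately show "curv_form G K (conn_T G K) (Inr s) d' a d e = 0"
    by (simp add: curv_form_def conn_T_eq[OF K e])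
qed

lemma conn_M_components:
  "conn_M G K (Inl b) i l = A_M G K l i b" "conn_M G K (Inr (Inl k)) i l = H_M G K l i k"
  "conn_M G K (Inr (Inr (k, c))) i l = C_M G K l k i c"
  by (simp_all add: conn_M_def A_M_def H_M_def C_M_def)

lemma AH_V:
  assumes K: "K \<in> jcharts G" and e: "e \<in> jdom G K"
  shows "A_V G K f k r c b e = kron f c * A_M G K k r b e - kron k r * chris G K f c b e"
    "H_V G K f k r c j e = kron f c * H_M G K k r j e"
proof -
  have "A_V G K f k r c b e = - conn_V G K (Inl b) (k, c) (r, f) e"
    by (simp add: A_V_def conn_V_def)
  then show "A_V G K f k r c b e = kron f c * A_M G K k r b e - kron k r * chris G K f c b e"
    unfolding conn_V_eq[OF K e] conn_M_components conn_T_eq(1)[OF K e] by (simp add: kron_commute)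
  have "H_V G K f k r c j e = - conn_V G K (Inr (Inl j)) (k, c) (r, f) e"
    by (simp add: H_V_def conn_V_def)
  then show "H_V G K f k r c j e = kron f c * H_M G K k r j e"
    unfolding conn_V_eq[OF K e] conn_M_components conn_T_eq(2)[OF K e] by (simp add: kron_commute)
qed

text \<open>The coefficients \<open>tau\<close> are minus the torsions for two horizontal
  directions, so the bracket term becomes \<open>C_M\<close> contracted with torsion, with sign
  plus. For a mixed pair \<open>tau\<close> contains only the fibre derivative of the nonlinear
  connection, and the rest of the torsion has to be matched with the covariant derivative of
  \<open>C_M\<close>.\<close>

lemma curv_form_M:
  assumes K: "K \<in> jcharts G" and e: "e \<in> jdom G K"
  shows "curv_form G K (conn_M G K) (Inl c) (Inl b) i l e = curv_TT G K l i b c e"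
    "curv_form G K (conn_M G K) (Inr (Inl k)) (Inl b) i l e = curv_TM G K l i b k e"
    "curv_form G K (conn_M G K) (Inr (Inr (k, c))) (Inl b) i l e = curv_TV G K l k i b c e"
    "curv_form G K (conn_M G K) (Inr (Inl k)) (Inr (Inl j)) i l e = curv_MM G K l i j k e"
    "curv_form G K (conn_M G K) (Inr (Inr (k, c))) (Inr (Inl j)) i l e = curv_MV G K l k i j c e"
    "curv_form G K (conn_M G K) (Inr (Inr (k, c))) (Inr (Inr (j, b))) i l e = curv_VV G K l j k i b c e"
proof -
  have tau_sum: "(\<Sum>s\<in>UNIV. tau G K d d' s e * conn_M G K (Inr (Inr s)) i l e) =
      (\<Sum>f\<in>UNIV. \<Sum>r\<in>UNIV. tau G K d d' (r, f) e * C_M G K l r i f e)" for d d'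
    unfolding sum_UNIV_Times conn_M_components by (rule sum.swap)
  have z: "del_t G K b (\<lambda>e. 0) e = 0" "del_x G K j (\<lambda>e. 0) e = 0" "part_p G K k c (\<lambda>e. 0) e = 0" for b j k c
    using frame_zero[OF K e, of "\<lambda>e. 0" "Inl b"] frame_zero[OF K e, of "\<lambda>e. 0" "Inr (Inl j)"]
      frame_zero[OF K e, of "\<lambda>e. 0" "Inr (Inr (k, c))"] by simp_all
  note defs = conn_M_components tau_def z
  have neg: "(\<Sum>f\<in>UNIV. \<Sum>r\<in>UNIV. (y f r - x f r) * g f r) = - (\<Sum>f\<in>UNIV. \<Sum>r\<in>UNIV. g f r * (x f r - y f r))"
    for x y g :: "'m \<Rightarrow> 'n \<Rightarrow> real"
    by (simp add: sum_negf[symmetric] algebra_simps)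
  show "curv_form G K (conn_M G K) (Inl c) (Inl b) i l e = curv_TT G K l i b c e"
    unfolding curv_form_def tau_sum by (simp add: defs curv_TT_def tor_TT_def neg)
  show "curv_form G K (conn_M G K) (Inr (Inl k)) (Inl b) i l e = curv_TM G K l i b k e"
    unfolding curv_form_def tau_sum by (simp add: defs curv_TM_def tor_TM_def neg)
  show "curv_form G K (conn_M G K) (Inr (Inl k)) (Inr (Inl j)) i l e = curv_MM G K l i j k e"
    unfolding curv_form_def tau_sum by (simp add: defs curv_MM_def tor_MM_def neg)
  show "curv_form G K (conn_M G K) (Inr (Inr (k, c))) (Inr (Inr (j, b))) i l e = curv_VV G K l j k i b c e"
    unfolding curv_form_def tau_sum by (simp add: defs curv_VV_def)
  \<comment> \<open>The torsion \<open>tor_TV\<close> is the fibre derivative of \<open>N1\<close>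
    plus \<open>A_V\<close>; the part with \<open>A_V\<close> cancels the last term of
    \<open>C_slash\<close>. The same happens below with \<open>tor_MV\<close>, \<open>H_V\<close>
    and \<open>C_bar\<close>.\<close>
  have tor: "(\<Sum>f\<in>UNIV. \<Sum>r\<in>UNIV. C_M G K l r i f e * tor_TV G K f k r b c e) =
      (\<Sum>f\<in>UNIV. \<Sum>r\<in>UNIV. C_M G K l r i f e * part_p G K k c (N1 G K f r b) e) +
      (\<Sum>f\<in>UNIV. \<Sum>r\<in>UNIV. C_M G K l r i f e * A_V G K f k r c b e)"
    unfolding AH_V[OF K e] tor_TV_def by (simp add: algebra_simps sum.distrib sum_subtractf)
  show "curv_form G K (conn_M G K) (Inr (Inr (k, c))) (Inl b) i l e = curv_TV G K l k i b c e"
    unfolding curv_form_def tau_sum curv_TV_def C_slash_def tor by (simp add: defs sum_negf mult.commute)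
  have tor': "(\<Sum>f\<in>UNIV. \<Sum>r\<in>UNIV. C_M G K l r i f e * tor_MV G K f k r j c e) =
      (\<Sum>f\<in>UNIV. \<Sum>r\<in>UNIV. C_M G K l r i f e * part_p G K k c (N2 G K f r j) e) +
      (\<Sum>f\<in>UNIV. \<Sum>r\<in>UNIV. C_M G K l r i f e * H_V G K f k r c j e)"
    unfolding AH_V[OF K e] tor_MV_def by (simp add: algebra_simps sum.distrib sum_subtractf)
  show "curv_form G K (conn_M G K) (Inr (Inr (k, c))) (Inr (Inl j)) i l e = curv_MV G K l k i j c e"
    unfolding curv_form_def tau_sum curv_MV_def C_bar_def tor' by (simp add: defs sum_negf mult.commute)
qed

text \<open>Derivative and bracket terms are linear in the connection form. In the quadratic terms
  the mixed products cancel, and the reversed order of the \<open>conn_M\<close> factors gives them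
  the sign that fits minus the curvature of that block.\<close>

lemma curv_form_V:
  assumes K: "K \<in> jcharts G" and e: "e \<in> jdom G K"
  shows "curv_form G K (conn_V G K) d d' (i, a) (l, b) e =
    kron i l * curv_form G K (conn_T G K) d d' a b e - kron b a * curv_form G K (conn_M G K) d d' l i e"
proof -
  note o = jet_open_jdom[OF K]
  have fr: "frame G K d (conn_V G K d' (i, a) (l, b)) e =
      kron i l * frame G K d (conn_T G K d' a b) e - kron b a * frame G K d (conn_M G K d' l i) e" for d d'
  proof -
    note F = frame_field[OF K subset_refl, of d]
    note sT = conn_smooth(1)[OF K, of d' a b] and sM = conn_smooth(2)[OF K, of d' l i]
    have "frame G K d (conn_V G K d' (i, a) (l, b)) e =
        frame G K d (\<lambda>e. kron i l * conn_T G K d' a b e - kron b a * conn_M G K d' l i e) e"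
      by (rule frame_cong[OF K e conn_smooth(3)[OF K]]) (simp add: conn_V_eq[OF K] kron_commute[of l i])
    then show ?thesis
      unfolding vf_apply_diff[OF F o smooth_funs_cmult[OF o sT] smooth_funs_cmult[OF o sM] e]
        vf_apply_cmult[OF F o sT e] vf_apply_cmult[OF F o sM e] .
  qed
  have tau: "(\<Sum>r\<in>UNIV. tau G K d d' r e * conn_V G K (Inr (Inr r)) (i, a) (l, b) e) =
      kron i l * (\<Sum>r\<in>UNIV. tau G K d d' r e * conn_T G K (Inr (Inr r)) a b e)
      - kron b a * (\<Sum>r\<in>UNIV. tau G K d d' r e * conn_M G K (Inr (Inr r)) l i e)"
    unfolding conn_V_eq[OF K e] kron_commute[of l i]
    by (simp add: sum_distrib_left sum_subtractf algebra_simps)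
  have prod: "(\<Sum>r\<in>UNIV. conn_V G K d' (i, a) r e * conn_V G K d r (l, b) e) =
      kron i l * (\<Sum>f\<in>UNIV. conn_T G K d' a f e * conn_T G K d f b e)
      - conn_T G K d' a b e * conn_M G K d l i e - conn_M G K d' l i e * conn_T G K d a b e
      + kron b a * (\<Sum>r\<in>UNIV. conn_M G K d l r e * conn_M G K d' r i e)" for d d'
    unfolding sum_UNIV_Times conn_V_eq[OF K e] by (rule kron_product_sum)
  show ?thesis
    unfolding curv_form_def fr tau prod by (simp add: algebra_simps)
qed

lemma curvature_values:
  assumes K: "K \<in> jcharts G"
  shows "(\<And>e. e \<in> jdom G K \<Longrightarrow> \<forall>s. curv_form G K (conn_T G K) d d' a s e = g s e) \<Longrightarrow>
      vf_eq G (jdom G K) (curvature G (frame G K d) (frame G K d') (del_t G K a)) (vf_comb g (del_t G K))"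
    "(\<And>e. e \<in> jdom G K \<Longrightarrow> \<forall>s. curv_form G K (conn_M G K) d d' i s e = g' s e) \<Longrightarrow>
      vf_eq G (jdom G K) (curvature G (frame G K d) (frame G K d') (del_x G K i)) (vf_comb g' (del_x G K))"
    "(\<And>e. e \<in> jdom G K \<Longrightarrow> \<forall>s. curv_form G K (conn_V G K) d d' (i, a) s e = g'' s e) \<Longrightarrow>
      vf_eq G (jdom G K) (curvature G (frame G K d) (frame G K d') (part_p G K i a)) (vf_comb g'' (vert G K))"
proof -
  show "vf_eq G (jdom G K) (curvature G (frame G K d) (frame G K d') (del_t G K a)) (vf_comb g (del_t G K))"
    if "\<And>e. e \<in> jdom G K \<Longrightarrow> \<forall>s. curv_form G K (conn_T G K) d d' a s e = g s e"
    by (rule vf_eq_trans[OF curvature_TMV(1)[OF K] vf_eq_comb[OF vf_eq_refl]]) (use that in simp)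
  show "vf_eq G (jdom G K) (curvature G (frame G K d) (frame G K d') (del_x G K i)) (vf_comb g' (del_x G K))"
    if "\<And>e. e \<in> jdom G K \<Longrightarrow> \<forall>s. curv_form G K (conn_M G K) d d' i s e = g' s e"
    by (rule vf_eq_trans[OF curvature_TMV(2)[OF K] vf_eq_comb[OF vf_eq_refl]]) (use that in simp)
  show "vf_eq G (jdom G K) (curvature G (frame G K d) (frame G K d') (part_p G K i a)) (vf_comb g'' (vert G K))"
    if "\<And>e. e \<in> jdom G K \<Longrightarrow> \<forall>s. curv_form G K (conn_V G K) d d' (i, a) s e = g'' s e"
  proof -
    have "vf_eq G (jdom G K) (curvature G (frame G K d) (frame G K d') (vert G K (i, a))) (vf_comb g'' (vert G K))"
      by (rule vf_eq_trans[OF curvature_TMV(3)[OF K] vf_eq_comb[OF vf_eq_refl]]) (use that in blast)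
    then show ?thesis by simp
  qed
qed

text \<open>Each of the five vanishing pairs has a first field outside the \<open>del_t\<close>
  block, so this covers them all.\<close>

lemma curvature_T_zero:
  assumes K: "K \<in> jcharts G"
  shows "vf_eq G (jdom G K) (curvature G (frame G K (Inr s)) (frame G K d') (del_t G K a)) vf_zero"
proof -
  have "vf_eq G (jdom G K) (curvature G (frame G K (Inr s)) (frame G K d') (del_t G K a)) (vf_comb (\<lambda>d e. 0) (del_t G K))"
    by (rule curvature_values(1)[OF K]) (simp add: curv_form_T(2)[OF K])
  then show ?thesis by (simp add: vf_comb_def vf_zero_def)
qed

end


section \<open>Transformation rules of the seven curvature d-tensors\<close>

lemma sum_lists_0: "(\<Sum>xs\<in>{xs. length xs = 0}. F xs) = F []"
  by simp

text \<open>Splitting off the head unfolds a sum over index lists of fixed length, as in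
  \<open>d_tensor\<close>, into nested sums over single indices.\<close>

lemma sum_lists_Suc:
  fixes F :: "'a::finite list \<Rightarrow> real"
  shows "(\<Sum>xs\<in>{xs. length xs = Suc n}. F xs) = (\<Sum>x\<in>UNIV. \<Sum>xs\<in>{xs. length xs = n}. F (x # xs))"
proof -
  have "(\<Sum>xs\<in>{xs. length xs = Suc n}. F xs) = (\<Sum>(x, xs)\<in>UNIV \<times> {xs. length xs = n}. F (x # xs))"
    by (rule sum.reindex_bij_witness[where i = "\<lambda>(x, xs). x # xs" and j = "\<lambda>xs. (hd xs, tl xs)"])
       (auto simp: length_Suc_conv)
  then show ?thesis by (simp add: sum.cartesian_product)
qed

lemmas sum_lists = sum_lists_0 sum_lists_Suc numeral_2_eq_2 numeral_3_eq_3

lemma d_tensorI: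
  assumes "\<And>K K' e as' is' bs' js'. K \<in> jcharts G \<Longrightarrow> K' \<in> jcharts G \<Longrightarrow> e \<in> jdom G K \<Longrightarrow> e \<in> jdom G K' \<Longrightarrow>
    F K' as' is' bs' js' e = (\<Sum>as\<in>{as. length as = p}. \<Sum>is\<in>{is. length is = q}.
      \<Sum>bs\<in>{bs. length bs = r}. \<Sum>js\<in>{js. length js = s}.
        (\<Prod>u<p. jac (fst K) (fst K') (fst e) $ (as' ! u) $ (as ! u))
      * (\<Prod>u<q. jac (snd K) (snd K') (fst (snd e)) $ (is' ! u) $ (is ! u))
      * (\<Prod>u<r. jac (fst K') (fst K) (fst e) $ (bs ! u) $ (bs' ! u))
      * (\<Prod>u<s. jac (snd K') (snd K) (fst (snd e)) $ (js ! u) $ (js' ! u))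
      * F K as is bs js e)"
  shows "d_tensor G p q r s F"
  unfolding d_tensor_def case_prod_unfold prod.collapse
  by (intro ballI allI impI, rule assms) auto

context h_normal_bundle
begin

text \<open>After \<open>curv_form_change\<close> the new component is a nested sum in the order of
  the slots of the curvature, whereas \<open>d_tensor\<close> sums in the order of its index lists.
  The two given maps permute the tuples of summation indices accordingly, here and for the other six
  tensors.\<close>

lemma d_tensor_chi:
  "d_tensor G 1 0 3 0 (\<lambda>K as is bs js. curv_chi G K (as!0) (bs!0) (bs!1) (bs!2))"
proof (rule d_tensorI, goal_cases)
  case (1 K K' e as' is' bs' js')
  show ?case
    unfolding curv_form_T(1)[OF 1(2,4), symmetric] curv_form_change[OF 1] sum_frame_jac curv_form_T(1)[OF 1(1,3)]
    by (simp add: sum_lists sum_distrib_left, simp only: sum.cartesian_product,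
        rule sum.reindex_bij_witness[where i = "\<lambda>(d, a, b, c). (c, b, a, d)" and j = "\<lambda>(c, b, a, d). (d, a, b, c)"])
       (auto simp: mult_ac)
qed

lemma d_tensor_TT:
  "d_tensor G 0 1 2 1 (\<lambda>K as is bs js. curv_TT G K (is!0) (js!0) (bs!0) (bs!1))"
proof (rule d_tensorI, goal_cases)
  case (1 K K' e as' is' bs' js')
  show ?case
    unfolding curv_form_M(1)[OF 1(2,4), symmetric] curv_form_change[OF 1] sum_frame_jac curv_form_M(1)[OF 1(1,3)]
    by (simp add: sum_lists sum_distrib_left, simp only: sum.cartesian_product,
        rule sum.reindex_bij_witness[where i = "\<lambda>(l, b, c, i). (c, b, i, l)" and j = "\<lambda>(c, b, i, l). (l, b, c, i)"])
       (auto simp: mult_ac)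
qed

lemma d_tensor_TM:
  "d_tensor G 0 1 1 2 (\<lambda>K as is bs js. curv_TM G K (is!0) (js!0) (bs!0) (js!1))"
proof (rule d_tensorI, goal_cases)
  case (1 K K' e as' is' bs' js')
  show ?case
    unfolding curv_form_M(2)[OF 1(2,4), symmetric] curv_form_change[OF 1] sum_frame_jac curv_form_M(2)[OF 1(1,3)]
    by (simp add: sum_lists sum_distrib_left, simp only: sum.cartesian_product,
        rule sum.reindex_bij_witness[where i = "\<lambda>(l, b, i, k). (k, b, i, l)" and j = "\<lambda>(k, b, i, l). (l, b, i, k)"])
       (auto simp: mult_ac)
qed

lemma d_tensor_TV:
  "d_tensor G 0 2 2 1 (\<lambda>K as is bs js. curv_TV G K (is!0) (is!1) (js!0) (bs!0) (bs!1))"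
proof (rule d_tensorI, goal_cases)
  case (1 K K' e as' is' bs' js')
  show ?case
    unfolding curv_form_M(3)[OF 1(2,4), symmetric] curv_form_change[OF 1] sum_frame_jac curv_form_M(3)[OF 1(1,3)]
    by (simp add: sum_lists sum_distrib_left, simp only: sum.cartesian_product,
        rule sum.reindex_bij_witness[where i = "\<lambda>(l, k, b, c, i). (k, c, b, i, l)" and j = "\<lambda>(k, c, b, i, l). (l, k, b, c, i)"])
       (auto simp: mult_ac)
qed

lemma d_tensor_MM:
  "d_tensor G 0 1 0 3 (\<lambda>K as is bs js. curv_MM G K (is!0) (js!0) (js!1) (js!2))"
proof (rule d_tensorI, goal_cases)
  case (1 K K' e as' is' bs' js')
  show ?case
    unfolding curv_form_M(4)[OF 1(2,4), symmetric] curv_form_change[OF 1] sum_frame_jac curv_form_M(4)[OF 1(1,3)]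
    by (simp add: sum_lists sum_distrib_left, simp only: sum.cartesian_product,
        rule sum.reindex_bij_witness[where i = "\<lambda>(l, i, j, k). (k, j, i, l)" and j = "\<lambda>(k, j, i, l). (l, i, j, k)"])
       (auto simp: mult_ac)
qed

lemma d_tensor_MV:
  "d_tensor G 0 2 1 2 (\<lambda>K as is bs js. curv_MV G K (is!0) (is!1) (js!0) (js!1) (bs!0))"
proof (rule d_tensorI, goal_cases)
  case (1 K K' e as' is' bs' js')
  show ?case
    unfolding curv_form_M(5)[OF 1(2,4), symmetric] curv_form_change[OF 1] sum_frame_jac curv_form_M(5)[OF 1(1,3)]
    by (simp add: sum_lists sum_distrib_left, simp only: sum.cartesian_product,
        rule sum.reindex_bij_witness[where i = "\<lambda>(l, k, c, i, j). (k, c, j, i, l)" and j = "\<lambda>(k, c, j, i, l). (l, k, c, i, j)"])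
       (auto simp: mult_ac)
qed

lemma d_tensor_VV:
  "d_tensor G 0 3 2 1 (\<lambda>K as is bs js. curv_VV G K (is!0) (is!1) (is!2) (js!0) (bs!0) (bs!1))"
proof (rule d_tensorI, goal_cases)
  case (1 K K' e as' is' bs' js')
  show ?case
    unfolding curv_form_M(6)[OF 1(2,4), symmetric] curv_form_change[OF 1] sum_frame_jac curv_form_M(6)[OF 1(1,3)]
    by (simp add: sum_lists sum_distrib_left, simp only: sum.cartesian_product,
        rule sum.reindex_bij_witness[where i = "\<lambda>(l, j, k, b, c, i). (k, c, j, b, i, l)" and j = "\<lambda>(k, c, j, b, i, l). (l, j, k, b, c, i)"])
       (auto simp: mult_ac)
qed

end


theorem theorem4p3:
  fixes G :: "('t::{t2_space, second_countable_topology}, 'm::finite,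
               'x::{t2_space, second_countable_topology}, 'n::finite) jet_data"
  assumes "smooth_atlas (T_atlas G)" and "smooth_atlas (M_atlas G)"
    and "nonlinear_connection G"
    and "semi_riemannian G"
    and "N_linear_connection G"
    and "h_normal G"
  shows
    "d_tensor G 1 0 3 0 (\<lambda>K as is bs js. curv_chi G K (as!0) (bs!0) (bs!1) (bs!2)) \<and>
     d_tensor G 0 1 2 1 (\<lambda>K as is bs js. curv_TT G K (is!0) (js!0) (bs!0) (bs!1)) \<and>
     d_tensor G 0 1 1 2 (\<lambda>K as is bs js. curv_TM G K (is!0) (js!0) (bs!0) (js!1)) \<and>
     d_tensor G 0 2 2 1 (\<lambda>K as is bs js. curv_TV G K (is!0) (is!1) (js!0) (bs!0) (bs!1)) \<and>
     d_tensor G 0 1 0 3 (\<lambda>K as is bs js. curv_MM G K (is!0) (js!0) (js!1) (js!2)) \<and>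
     d_tensor G 0 2 1 2 (\<lambda>K as is bs js. curv_MV G K (is!0) (is!1) (js!0) (js!1) (bs!0)) \<and>
     d_tensor G 0 3 2 1 (\<lambda>K as is bs js. curv_VV G K (is!0) (is!1) (is!2) (js!0) (bs!0) (bs!1)) \<and>
     (\<forall>K\<in>jcharts G.
       (\<forall>a b c. vf_eq G (jdom G K)
          (curvature G (del_t G K c) (del_t G K b) (del_t G K a))
          (vf_comb (\<lambda>d. curv_chi G K d a b c) (del_t G K))) \<and>
       (\<forall>a b k. vf_eq G (jdom G K)
          (curvature G (del_x G K k) (del_t G K b) (del_t G K a)) vf_zero) \<and>
       (\<forall>a b c k. vf_eq G (jdom G K)
          (curvature G (part_p G K k c) (del_t G K b) (del_t G K a)) vf_zero) \<and>
       (\<forall>a j k. vf_eq G (jdom G K)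
          (curvature G (del_x G K k) (del_x G K j) (del_t G K a)) vf_zero) \<and>
       (\<forall>a j c k. vf_eq G (jdom G K)
          (curvature G (part_p G K k c) (del_x G K j) (del_t G K a)) vf_zero) \<and>
       (\<forall>a b c j k. vf_eq G (jdom G K)
          (curvature G (part_p G K k c) (part_p G K j b) (del_t G K a)) vf_zero) \<and>
       (\<forall>i b c. vf_eq G (jdom G K)
          (curvature G (del_t G K c) (del_t G K b) (del_x G K i))
          (vf_comb (\<lambda>l. curv_TT G K l i b c) (del_x G K))) \<and>
       (\<forall>i b k. vf_eq G (jdom G K)
          (curvature G (del_x G K k) (del_t G K b) (del_x G K i))
          (vf_comb (\<lambda>l. curv_TM G K l i b k) (del_x G K))) \<and>
       (\<forall>i b c k. vf_eq G (jdom G K)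
          (curvature G (part_p G K k c) (del_t G K b) (del_x G K i))
          (vf_comb (\<lambda>l. curv_TV G K l k i b c) (del_x G K))) \<and>
       (\<forall>i j k. vf_eq G (jdom G K)
          (curvature G (del_x G K k) (del_x G K j) (del_x G K i))
          (vf_comb (\<lambda>l. curv_MM G K l i j k) (del_x G K))) \<and>
       (\<forall>i j c k. vf_eq G (jdom G K)
          (curvature G (part_p G K k c) (del_x G K j) (del_x G K i))
          (vf_comb (\<lambda>l. curv_MV G K l k i j c) (del_x G K))) \<and>
       (\<forall>i b c j k. vf_eq G (jdom G K)
          (curvature G (part_p G K k c) (part_p G K j b) (del_x G K i))
          (vf_comb (\<lambda>l. curv_VV G K l j k i b c) (del_x G K))) \<and>
       (\<forall>i a b c. vf_eq G (jdom G K)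
          (curvature G (del_t G K c) (del_t G K b) (part_p G K i a))
          (vf_comb (\<lambda>(l, d) e. kron i l * curv_chi G K d a b c e - kron d a * curv_TT G K i l b c e)
                   (\<lambda>(l, d). part_p G K l d))) \<and>
       (\<forall>i a b k. vf_eq G (jdom G K)
          (curvature G (del_x G K k) (del_t G K b) (part_p G K i a))
          (vf_comb (\<lambda>(l, d) e. - (kron d a * curv_TM G K i l b k e))
                   (\<lambda>(l, d). part_p G K l d))) \<and>
       (\<forall>i a b c k. vf_eq G (jdom G K)
          (curvature G (part_p G K k c) (del_t G K b) (part_p G K i a))
          (vf_comb (\<lambda>(l, d) e. - (kron d a * curv_TV G K i k l b c e))
                   (\<lambda>(l, d). part_p G K l d))) \<and>
       (\<forall>i a j k. vf_eq G (jdom G K)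
          (curvature G (del_x G K k) (del_x G K j) (part_p G K i a))
          (vf_comb (\<lambda>(l, d) e. - (kron d a * curv_MM G K i l j k e))
                   (\<lambda>(l, d). part_p G K l d))) \<and>
       (\<forall>i a j c k. vf_eq G (jdom G K)
          (curvature G (part_p G K k c) (del_x G K j) (part_p G K i a))
          (vf_comb (\<lambda>(l, d) e. - (kron d a * curv_MV G K i k l j c e))
                   (\<lambda>(l, d). part_p G K l d))) \<and>
       (\<forall>i a b c j k. vf_eq G (jdom G K)
          (curvature G (part_p G K k c) (part_p G K j b) (part_p G K i a))
          (vf_comb (\<lambda>(l, d) e. - (kron d a * curv_VV G K i j k l b c e))
                   (\<lambda>(l, d). part_p G K l d))))"
proof -
  interpret h_normal_bundle G
    by unfold_locales (rule assms)+
  show ?thesis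
  proof (intro conjI ballI allI; (rule d_tensor_chi d_tensor_TT d_tensor_TM d_tensor_TV d_tensor_MM d_tensor_MV d_tensor_VV)?)
    fix K assume K: "K \<in> jcharts G"
    note zero = curvature_T_zero[OF K]
    note val = curvature_values[OF K]
    note form = curv_form_T[OF K] curv_form_M[OF K] curv_form_V[OF K]
    show "vf_eq G (jdom G K)
        (curvature G (del_t G K c) (del_t G K b) (del_t G K a))
        (vf_comb (\<lambda>d. curv_chi G K d a b c) (del_t G K))" for a b c
      by (rule val(1)[of "Inl c" "Inl b", unfolded frame.simps]) (simp add: form)
    show "vf_eq G (jdom G K)
        (curvature G (del_x G K k) (del_t G K b) (del_t G K a)) vf_zero" for a b k
      by (rule zero[of "Inl k" "Inl b" a, unfolded frame.simps])
    show "vf_eq G (jdom G K)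
        (curvature G (part_p G K k c) (del_t G K b) (del_t G K a)) vf_zero" for a b c k
      by (rule zero[of "Inr (k, c)" "Inl b" a, unfolded frame.simps])
    show "vf_eq G (jdom G K)
        (curvature G (del_x G K k) (del_x G K j) (del_t G K a)) vf_zero" for a j k
      by (rule zero[of "Inl k" "Inr (Inl j)" a, unfolded frame.simps])
    show "vf_eq G (jdom G K)
        (curvature G (part_p G K k c) (del_x G K j) (del_t G K a)) vf_zero" for a j c k
      by (rule zero[of "Inr (k, c)" "Inr (Inl j)" a, unfolded frame.simps])
    show "vf_eq G (jdom G K)
        (curvature G (part_p G K k c) (part_p G K j b) (del_t G K a)) vf_zero" for a b c j k
      by (rule zero[of "Inr (k, c)" "Inr (Inr (j, b))" a, unfolded frame.simps])
    show "vf_eq G (jdom G K)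
        (curvature G (del_t G K c) (del_t G K b) (del_x G K i))
        (vf_comb (\<lambda>l. curv_TT G K l i b c) (del_x G K))" for i b c
      by (rule val(2)[of "Inl c" "Inl b", unfolded frame.simps]) (simp add: form)
    show "vf_eq G (jdom G K)
        (curvature G (del_x G K k) (del_t G K b) (del_x G K i))
        (vf_comb (\<lambda>l. curv_TM G K l i b k) (del_x G K))" for i b k
      by (rule val(2)[of "Inr (Inl k)" "Inl b", unfolded frame.simps]) (simp add: form)
    show "vf_eq G (jdom G K)
        (curvature G (part_p G K k c) (del_t G K b) (del_x G K i))
        (vf_comb (\<lambda>l. curv_TV G K l k i b c) (del_x G K))" for i b c k
      by (rule val(2)[of "Inr (Inr (k, c))" "Inl b", unfolded frame.simps]) (simp add: form)
    show "vf_eq G (jdom G K)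
        (curvature G (del_x G K k) (del_x G K j) (del_x G K i))
        (vf_comb (\<lambda>l. curv_MM G K l i j k) (del_x G K))" for i j k
      by (rule val(2)[of "Inr (Inl k)" "Inr (Inl j)", unfolded frame.simps]) (simp add: form)
    show "vf_eq G (jdom G K)
        (curvature G (part_p G K k c) (del_x G K j) (del_x G K i))
        (vf_comb (\<lambda>l. curv_MV G K l k i j c) (del_x G K))" for i j c k
      by (rule val(2)[of "Inr (Inr (k, c))" "Inr (Inl j)", unfolded frame.simps]) (simp add: form)
    show "vf_eq G (jdom G K)
        (curvature G (part_p G K k c) (part_p G K j b) (del_x G K i))
        (vf_comb (\<lambda>l. curv_VV G K l j k i b c) (del_x G K))" for i b c j k
      by (rule val(2)[of "Inr (Inr (k, c))" "Inr (Inr (j, b))", unfolded frame.simps]) (simp add: form)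
    \<comment> \<open>Of the six vertical values only this one keeps a \<open>curv_chi\<close> term,
      since the curvature form of the \<open>del_t\<close> block is 0 for the other five
      pairs.\<close>
    show "vf_eq G (jdom G K)
        (curvature G (del_t G K c) (del_t G K b) (part_p G K i a))
        (vf_comb (\<lambda>(l, d) e. kron i l * curv_chi G K d a b c e - kron d a * curv_TT G K i l b c e)
          (\<lambda>(l, d). part_p G K l d))" for i a b c
      by (rule val(3)[of "Inl c" "Inl b", unfolded frame.simps]) (simp add: form)
    show "vf_eq G (jdom G K)
        (curvature G (del_x G K k) (del_t G K b) (part_p G K i a))
        (vf_comb (\<lambda>(l, d) e. - (kron d a * curv_TM G K i l b k e))
          (\<lambda>(l, d). part_p G K l d))" for i a b k
      by (rule val(3)[of "Inr (Inl k)" "Inl b", unfolded frame.simps]) (simp add: form)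
    show "vf_eq G (jdom G K)
        (curvature G (part_p G K k c) (del_t G K b) (part_p G K i a))
        (vf_comb (\<lambda>(l, d) e. - (kron d a * curv_TV G K i k l b c e))
          (\<lambda>(l, d). part_p G K l d))" for i a b c k
      by (rule val(3)[of "Inr (Inr (k, c))" "Inl b", unfolded frame.simps]) (simp add: form)
    show "vf_eq G (jdom G K)
        (curvature G (del_x G K k) (del_x G K j) (part_p G K i a))
        (vf_comb (\<lambda>(l, d) e. - (kron d a * curv_MM G K i l j k e))
          (\<lambda>(l, d). part_p G K l d))" for i a j k
      by (rule val(3)[of "Inr (Inl k)" "Inr (Inl j)", unfolded frame.simps]) (simp add: form)
    show "vf_eq G (jdom G K)
        (curvature G (part_p G K k c) (del_x G K j) (part_p G K i a))
        (vf_comb (\<lambda>(l, d) e. - (kron d a * curv_MV G K i k l j c e))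
          (\<lambda>(l, d). part_p G K l d))" for i a j c k
      by (rule val(3)[of "Inr (Inr (k, c))" "Inr (Inl j)", unfolded frame.simps]) (simp add: form)
    show "vf_eq G (jdom G K)
        (curvature G (part_p G K k c) (part_p G K j b) (part_p G K i a))
        (vf_comb (\<lambda>(l, d) e. - (kron d a * curv_VV G K i j k l b c e))
          (\<lambda>(l, d). part_p G K l d))" for i a b c j k
      by (rule val(3)[of "Inr (Inr (k, c))" "Inr (Inr (j, b))", unfolded frame.simps]) (simp add: form)
  qed
qed

end
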